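(* Let $V\in L^\infty(\mathbb{R}^d)$, $V\ge 0$, and let $-\Delta: H^2(\mathbb{R}^d)\to L^2(\mathbb{R}^d)$ be the negative Laplacian in $L^2(\mathbb{R}^d)$. For $y\in\mathbb{R}^d$ and $R>0$ put $C_R(y)=y+(0,R)^d$. The following are equivalent: (i) $-\Delta+V\gg0$, i.e. $\inf\sigma(-\Delta+V)>0$; (ii) there exist $R,\varrho>0$ such that $V$ is $(R,\varrho)$-thick, i.e. $\frac{1}{R^d}\int_{C_R(y)}V(x)\,\mathrm{d}x\ge\varrho$ for all $y\in\mathbb{R}^d$; (iii) $\displaystyle\liminf_{R\to\infty}\left(\inf_{y\in\mathbb{R}^d}\frac{1}{R^d}\int_{C_R(y)}V(x)\,\mathrm{d}x\right)>0$.
   Context: $V$ also denotes the bounded operator of multiplication by the function $V$ in $L^2(\mathbb{R}^d)$. A selfadjoint operator $A$ is strictly positive, $A\gg0$, if there is $\varepsilon>0$ with $(Af|f)\ge\varepsilon(f|f)$ for all $f\in\mathrm{dom}(A)$, equivalently $\sigma(A)\subset[\varepsilon,\infty)$. $H^2(\mathbb{R}^d)$ is the Sobolev space of order 2. *)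

theory Defs
  imports "HOL-Analysis.Analysis" "HOL-Library.Complex_Order"
begin

section \<open>The Hilbert space of square-integrable functions\<close>

definition sq_integrable :: "('a::euclidean_space \<Rightarrow> complex) \<Rightarrow> bool"
  where "sq_integrable f \<longleftrightarrow>
    f \<in> borel_measurable lebesgue \<and> integrable lebesgue (\<lambda>x. (cmod (f x))\<^sup>2)"

definition L2_rel :: "('a::euclidean_space \<Rightarrow> complex) \<Rightarrow> ('a \<Rightarrow> complex) \<Rightarrow> bool"
  where "L2_rel f g \<longleftrightarrow>
    sq_integrable f \<and> sq_integrable g \<and> (AE x in lebesgue. f x = g x)"

lemma sq_integrableD [dest]:
  assumes "sq_integrable f"
  shows "f \<in> borel_measurable lebesgue" "integrable lebesgue (\<lambda>x. (cmod (f x))\<^sup>2)"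
  using assms by (auto simp: sq_integrable_def)

lemma sq_integrable_zero [simp]: "sq_integrable (\<lambda>x. 0)"
  by (simp add: sq_integrable_def)

lemma sq_integrable_bounded_mult:
  assumes m: "m \<in> borel_measurable lebesgue" and C: "AE x in lebesgue. cmod (m x) \<le> C"
    and f: "sq_integrable f"
  shows "sq_integrable (\<lambda>x. m x * f x)"
  unfolding sq_integrable_def
proof
  have [measurable]: "f \<in> borel_measurable lebesgue" "m \<in> borel_measurable lebesgue"
    using f m by auto
  show "(\<lambda>x. m x * f x) \<in> borel_measurable lebesgue" by measurable
  show "integrable lebesgue (\<lambda>x. (cmod (m x * f x))\<^sup>2)"
  proof (rule Bochner_Integration.integrable_bound)
    show "integrable lebesgue (\<lambda>x. C\<^sup>2 * (cmod (f x))\<^sup>2)" using f by auto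
    show "(\<lambda>x. (cmod (m x * f x))\<^sup>2) \<in> borel_measurable lebesgue" by measurable
    show "AE x in lebesgue. norm ((cmod (m x * f x))\<^sup>2) \<le> norm (C\<^sup>2 * (cmod (f x))\<^sup>2)"
      using C
    proof eventually_elim
      case (elim x)
      then have "(cmod (m x))\<^sup>2 \<le> C\<^sup>2" by (simp add: power_mono)
      then show ?case by (simp add: norm_mult power_mult_distrib mult_right_mono)
    qed
  qed
qed

lemma sq_integrable_cmult: "sq_integrable f \<Longrightarrow> sq_integrable (\<lambda>x. c * f x)"
  by (rule sq_integrable_bounded_mult[where C = "cmod c"]) auto

lemma sq_integrable_add:
  assumes f: "sq_integrable f" and g: "sq_integrable g"
  shows "sq_integrable (\<lambda>x. f x + g x)"
  unfolding sq_integrable_def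
proof
  have [measurable]: "f \<in> borel_measurable lebesgue" "g \<in> borel_measurable lebesgue"
    using f g by auto
  show "(\<lambda>x. f x + g x) \<in> borel_measurable lebesgue" by measurable
  show "integrable lebesgue (\<lambda>x. (cmod (f x + g x))\<^sup>2)"
  proof (rule Bochner_Integration.integrable_bound)
    show "integrable lebesgue (\<lambda>x. 2 * (cmod (f x))\<^sup>2 + 2 * (cmod (g x))\<^sup>2)"
      using f g
      by (intro Bochner_Integration.integrable_add integrable_mult_right sq_integrableD(2))
    show "(\<lambda>x. (cmod (f x + g x))\<^sup>2) \<in> borel_measurable lebesgue" by measurable
    have "(cmod (a + b))\<^sup>2 \<le> 2 * (cmod a)\<^sup>2 + 2 * (cmod b)\<^sup>2" for a b
    proof -
      have "(cmod (a + b))\<^sup>2 \<le> (cmod a + cmod b)\<^sup>2"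
        by (simp add: norm_triangle_ineq power_mono)
      also have "\<dots> \<le> 2 * (cmod a)\<^sup>2 + 2 * (cmod b)\<^sup>2"
        using zero_le_power2[of "cmod a - cmod b"]
        by (simp add: power2_eq_square algebra_simps)
      finally show ?thesis .
    qed
    then show "AE x in lebesgue. norm ((cmod (f x + g x))\<^sup>2)
        \<le> norm (2 * (cmod (f x))\<^sup>2 + 2 * (cmod (g x))\<^sup>2)"
      by (auto intro!: AE_I2)
  qed
qed

lemma integrable_mult_cnj:
  assumes f: "sq_integrable f" and g: "sq_integrable g"
  shows "integrable lebesgue (\<lambda>x. f x * cnj (g x))"
proof (rule Bochner_Integration.integrable_bound)
  have [measurable]: "f \<in> borel_measurable lebesgue" "g \<in> borel_measurable lebesgue"
    using f g by auto
  show "integrable lebesgue (\<lambda>x. (cmod (f x))\<^sup>2 + (cmod (g x))\<^sup>2)"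
    using f g by auto
  show "(\<lambda>x. f x * cnj (g x)) \<in> borel_measurable lebesgue"
    by (intro borel_measurable_times borel_measurable_continuous_on[of cnj])
      (auto intro: continuous_intros)
  have "cmod a * cmod b \<le> (cmod a)\<^sup>2 + (cmod b)\<^sup>2" for a b
  proof -
    have "2 * (cmod a * cmod b) \<le> (cmod a)\<^sup>2 + (cmod b)\<^sup>2"
      using sum_squares_bound[of "cmod a" "cmod b"] by simp
    moreover have "0 \<le> cmod a * cmod b" by simp
    ultimately show ?thesis by linarith
  qed
  then show "AE x in lebesgue. norm (f x * cnj (g x))
      \<le> norm ((cmod (f x))\<^sup>2 + (cmod (g x))\<^sup>2)"
    by (auto intro!: AE_I2 simp: norm_mult)
qed

quotient_type (overloaded) 'a L2 = "'a::euclidean_space \<Rightarrow> complex" / partial: L2_rel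
proof (rule part_equivpI)
  show "\<exists>f :: 'a \<Rightarrow> complex. L2_rel f f"
    by (rule exI[of _ "\<lambda>x. 0"]) (simp add: L2_rel_def)
  show "symp (L2_rel :: ('a \<Rightarrow> complex) \<Rightarrow> _)" by (auto simp: symp_def L2_rel_def)
  show "transp (L2_rel :: ('a \<Rightarrow> complex) \<Rightarrow> _)"
  proof (rule transpI)
    fix f g h :: "'a \<Rightarrow> complex"
    assume fg: "L2_rel f g" and gh: "L2_rel g h"
    have "AE x in lebesgue. f x = g x" "AE x in lebesgue. g x = h x"
      using fg gh by (auto simp: L2_rel_def)
    then have "AE x in lebesgue. f x = h x" by eventually_elim simp
    then show "L2_rel f h" using fg gh by (simp add: L2_rel_def)
  qed
qed

lemma L2_relI:
  "sq_integrable f \<Longrightarrow> sq_integrable g \<Longrightarrow> AE x in lebesgue. f x = g x \<Longrightarrow> L2_rel f g"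
  by (simp add: L2_rel_def)

lift_definition cscale :: "complex \<Rightarrow> 'a::euclidean_space L2 \<Rightarrow> 'a L2"
  is "\<lambda>c f x. c * f x"
  by (auto simp: L2_rel_def sq_integrable_cmult)

text \<open>The inner product is linear in the first and antilinear in the second argument.\<close>

lift_definition cinner :: "'a::euclidean_space L2 \<Rightarrow> 'a L2 \<Rightarrow> complex"
  is "\<lambda>f g. LINT x|lebesgue. f x * cnj (g x)"
proof -
  fix f f' g g' :: "'a \<Rightarrow> complex"
  assume f: "L2_rel f f'" and g: "L2_rel g g'"
  have "AE x in lebesgue. f x = f' x" "AE x in lebesgue. g x = g' x"
    using f g by (auto simp: L2_rel_def)
  then have "AE x in lebesgue. f x * cnj (g x) = f' x * cnj (g' x)"
    by eventually_elim simp
  then show "(LINT x|lebesgue. f x * cnj (g x)) = (LINT x|lebesgue. f' x * cnj (g' x))"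
    using f g by (intro integral_cong_AE borel_measurable_integrable integrable_mult_cnj)
      (auto simp: L2_rel_def)
qed

instantiation L2 :: (euclidean_space) ab_group_add
begin

lift_definition zero_L2 :: "'a L2" is "\<lambda>x. 0"
  by (simp add: L2_rel_def)

lift_definition plus_L2 :: "'a L2 \<Rightarrow> 'a L2 \<Rightarrow> 'a L2" is "\<lambda>f g x. f x + g x"
  by (auto simp: L2_rel_def sq_integrable_add elim: eventually_elim2)

lift_definition uminus_L2 :: "'a L2 \<Rightarrow> 'a L2" is "\<lambda>f x. - f x"
  using sq_integrable_cmult[where c = "-1"] by (auto simp: L2_rel_def)

definition minus_L2 :: "'a L2 \<Rightarrow> 'a L2 \<Rightarrow> 'a L2" where "minus_L2 u v = u + - v"

instance
proof
  fix a b c :: "'a L2"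
  show "a + b + c = a + (b + c)"
    by transfer (auto simp: L2_rel_def sq_integrable_add algebra_simps)
  show "a + b = b + a"
    by transfer (auto simp: L2_rel_def sq_integrable_add algebra_simps)
  show "0 + a = a"
    by transfer (auto simp: L2_rel_def)
  show "- a + a = 0"
    by transfer (auto simp: L2_rel_def)
  show "a - b = a + - b" by (simp add: minus_L2_def)
qed

end

lemma cinner_add_left: "cinner (u + v) w = cinner u w + cinner v w"
  by transfer (simp add: L2_rel_def distrib_right integrable_mult_cnj)

lemma cinner_cscale_left: "cinner (cscale c u) w = c * cinner u w"
  by transfer (simp add: mult.assoc)

lemma cinner_commute: "cinner u v = cnj (cinner v u)"
proof transfer
  fix f g :: "'a \<Rightarrow> complex"
  show "(LINT x|lebesgue. f x * cnj (g x)) = cnj (LINT x|lebesgue. g x * cnj (f x))"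
    using Bochner_Integration.integral_cnj[of lebesgue "\<lambda>x. g x * cnj (f x)"] by (simp add: mult.commute)
qed

lemma cinner_self:
  "cinner u u = complex_of_real (LINT x|lebesgue. (cmod (rep_L2 u x))\<^sup>2)"
proof -
  have "cinner u u = (LINT x|lebesgue. rep_L2 u x * cnj (rep_L2 u x))"
    by (simp add: cinner.rep_eq)
  also have "\<dots> = (LINT x|lebesgue. complex_of_real ((cmod (rep_L2 u x))\<^sup>2))"
    by (simp only: complex_norm_square)
  finally show ?thesis by (simp only: integral_complex_of_real)
qed

lemma cinner_eq_zero_iff: "cinner u u = 0 \<longleftrightarrow> u = 0"
proof transfer
  fix f :: "'a \<Rightarrow> complex"
  assume "L2_rel f f"
  then have f: "sq_integrable f" by (simp add: L2_rel_def)
  have "(LINT x|lebesgue. f x * cnj (f x))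
      = complex_of_real (LINT x|lebesgue. (cmod (f x))\<^sup>2)"
    by (simp only: complex_norm_square[symmetric] integral_complex_of_real)
  also have "\<dots> = 0 \<longleftrightarrow> (AE x in lebesgue. (cmod (f x))\<^sup>2 = 0)"
    using integral_nonneg_eq_0_iff_AE[of lebesgue "\<lambda>x. (cmod (f x))\<^sup>2"] f by auto
  also have "\<dots> \<longleftrightarrow> L2_rel f (\<lambda>x. 0)"
    using f by (simp add: L2_rel_def)
  finally show "((LINT x|lebesgue. f x * cnj (f x)) = 0) = L2_rel f (\<lambda>x. 0)" .
qed

instantiation L2 :: (euclidean_space) real_inner
begin

definition scaleR_L2 :: "real \<Rightarrow> 'a L2 \<Rightarrow> 'a L2"
  where "scaleR_L2 r u = cscale (complex_of_real r) u"
definition inner_L2 :: "'a L2 \<Rightarrow> 'a L2 \<Rightarrow> real" where "inner_L2 u v = Re (cinner u v)"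
definition norm_L2 :: "'a L2 \<Rightarrow> real" where "norm_L2 u = sqrt (inner u u)"
definition dist_L2 :: "'a L2 \<Rightarrow> 'a L2 \<Rightarrow> real" where "dist_L2 u v = norm (u - v)"
definition sgn_L2 :: "'a L2 \<Rightarrow> 'a L2" where "sgn_L2 u = inverse (norm u) *\<^sub>R u"
definition uniformity_L2 :: "('a L2 \<times> 'a L2) filter"
  where "uniformity_L2 = (INF e\<in>{0<..}. principal {(u, v). dist u v < e})"
definition open_L2 :: "'a L2 set \<Rightarrow> bool"
  where "open_L2 U \<longleftrightarrow> (\<forall>u\<in>U. \<forall>\<^sub>F (u', v) in uniformity. u' = u \<longrightarrow> v \<in> U)"

instance
proof
  fix a b :: real and u v w :: "'a L2" and U :: "'a L2 set"
  show "dist u v = norm (u - v)" by (rule dist_L2_def)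
  show "a *\<^sub>R (u + v) = a *\<^sub>R u + a *\<^sub>R v"
    unfolding scaleR_L2_def
    by transfer (auto simp: L2_rel_def sq_integrable_add sq_integrable_cmult distrib_left)
  show "(a + b) *\<^sub>R u = a *\<^sub>R u + b *\<^sub>R u"
    unfolding scaleR_L2_def
    by transfer (auto simp: L2_rel_def sq_integrable_add sq_integrable_cmult distrib_right)
  show "a *\<^sub>R b *\<^sub>R u = (a * b) *\<^sub>R u"
    unfolding scaleR_L2_def
    by transfer (auto simp: L2_rel_def sq_integrable_cmult mult.assoc)
  show "1 *\<^sub>R u = u"
    unfolding scaleR_L2_def by transfer (auto simp: L2_rel_def)
  show "sgn u = inverse (norm u) *\<^sub>R u" by (rule sgn_L2_def)
  show "uniformity = (INF e\<in>{0<..}. principal {(u, v :: 'a L2). dist u v < e})"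
    by (rule uniformity_L2_def)
  show "open U \<longleftrightarrow> (\<forall>u\<in>U. \<forall>\<^sub>F (u', v) in uniformity. u' = u \<longrightarrow> v \<in> U)"
    by (rule open_L2_def)
  show "u \<bullet> v = v \<bullet> u"
    by (subst (2) inner_L2_def, subst cinner_commute) (simp add: inner_L2_def)
  show "(u + v) \<bullet> w = u \<bullet> w + v \<bullet> w"
    by (simp add: inner_L2_def cinner_add_left)
  show "(a *\<^sub>R u) \<bullet> v = a * (u \<bullet> v)"
    by (simp add: inner_L2_def scaleR_L2_def cinner_cscale_left)
  show "0 \<le> u \<bullet> u"
    by (simp add: inner_L2_def cinner_self)
  show "u \<bullet> u = 0 \<longleftrightarrow> u = 0"
    using cinner_eq_zero_iff[of u] by (simp add: inner_L2_def cinner_self)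
  show "norm u = sqrt (u \<bullet> u)" by (rule norm_L2_def)
qed

end


section \<open>Weak derivatives and the Sobolev space of order 2\<close>

definition partial_deriv :: "'a::euclidean_space \<Rightarrow> ('a \<Rightarrow> complex) \<Rightarrow> 'a \<Rightarrow> complex"
  where "partial_deriv b \<phi> x = vector_derivative (\<lambda>t. \<phi> (x + t *\<^sub>R b)) (at 0)"

text \<open>A function is of class \<open>C\<^sup>\<infinity>\<close> iff all its iterated partial derivatives (along a list
  of coordinate directions) are totally differentiable; they are then also continuous.\<close>

definition test_functions :: "('a::euclidean_space \<Rightarrow> complex) set"
  where "test_functions = {\<phi>.
    (\<forall>bs \<in> lists Basis. fold partial_deriv bs \<phi> differentiable_on UNIV) \<and>
    compact (closure {x. \<phi> x \<noteq> 0})}"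

text \<open>The integrals do not depend on the chosen representatives.\<close>

definition has_weak_partial :: "'a::euclidean_space \<Rightarrow> 'a L2 \<Rightarrow> 'a L2 \<Rightarrow> bool"
  where "has_weak_partial b u v \<longleftrightarrow> (\<forall>\<phi> \<in> test_functions.
    (LINT x|lebesgue. rep_L2 u x * partial_deriv b \<phi> x) =
      - (LINT x|lebesgue. rep_L2 v x * \<phi> x))"

definition weak_partial :: "'a::euclidean_space \<Rightarrow> 'a L2 \<Rightarrow> 'a L2"
  where "weak_partial b u = (THE v. has_weak_partial b u v)"

definition H2 :: "'a::euclidean_space L2 set"
  where "H2 = {u. \<forall>i \<in> Basis. \<exists>v. has_weak_partial i u v \<and>
    (\<forall>j \<in> Basis. \<exists>w. has_weak_partial j v w)}"

definition laplacian :: "'a::euclidean_space L2 \<Rightarrow> 'a L2"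
  where "laplacian u = (\<Sum>i\<in>Basis. weak_partial i (weak_partial i u))"


section \<open>Unbounded operators\<close>

text \<open>An unbounded operator is a pair of its domain and its action; the values of the second
  component outside the domain are irrelevant.\<close>

type_synonym 'a unbounded_op = "'a L2 set \<times> ('a L2 \<Rightarrow> 'a L2)"

abbreviation dom_op :: "'a::euclidean_space unbounded_op \<Rightarrow> 'a L2 set"
  where "dom_op A \<equiv> fst A"

abbreviation app_op :: "'a::euclidean_space unbounded_op \<Rightarrow> 'a L2 \<Rightarrow> 'a L2"
  where "app_op A \<equiv> snd A"

definition op_add ::
    "'a::euclidean_space unbounded_op \<Rightarrow> 'a unbounded_op \<Rightarrow> 'a unbounded_op"
  where "op_add A B = (dom_op A \<inter> dom_op B, \<lambda>u. app_op A u + app_op B u)"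

text \<open>Meant for selfadjoint operators. The order on the complex numbers is that of \<^theory>\<open>HOL-Library.Complex_Order\<close>, so the
  inequality includes that both sides have the same imaginary part, i.e. that the left-hand
  side is real.\<close>

definition strictly_positive :: "'a::euclidean_space unbounded_op \<Rightarrow> bool"
  where "strictly_positive A \<longleftrightarrow> (\<exists>\<epsilon>::real. \<epsilon> > 0 \<and>
    (\<forall>f \<in> dom_op A. cinner (app_op A f) f \<ge> complex_of_real \<epsilon> * cinner f f))"

definition resolvent_set :: "'a::euclidean_space unbounded_op \<Rightarrow> complex set"
  where "resolvent_set A = {z.
    bij_betw (\<lambda>u. app_op A u - cscale z u) (dom_op A) UNIV \<and>
    (\<exists>C. \<forall>u \<in> dom_op A. norm u \<le> C * norm (app_op A u - cscale z u))}"

definition spectrum :: "'a::euclidean_space unbounded_op \<Rightarrow> complex set"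
  where "spectrum A = - resolvent_set A"

text \<open>Meant for selfadjoint operators, whose spectrum is real.\<close>

definition inf_spectrum :: "'a::euclidean_space unbounded_op \<Rightarrow> ereal"
  where "inf_spectrum A = (INF z \<in> spectrum A. ereal (Re z))"


section \<open>Schroedinger operators and thick potentials\<close>

definition Linfty :: "('a::euclidean_space \<Rightarrow> real) set"
  where "Linfty = {V \<in> borel_measurable lebesgue. \<exists>C. AE x in lebesgue. \<bar>V x\<bar> \<le> C}"

lift_definition mult_fun :: "('a::euclidean_space \<Rightarrow> real) \<Rightarrow> 'a L2 \<Rightarrow> 'a L2"
  is "\<lambda>V f. if V \<in> Linfty then (\<lambda>x. complex_of_real (V x) * f x) else (\<lambda>x. 0)"
proof -
  fix V :: "'a \<Rightarrow> real" and f g :: "'a \<Rightarrow> complex"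
  assume fg: "L2_rel f g"
  have "sq_integrable (\<lambda>x. complex_of_real (V x) * h x)"
    if "V \<in> Linfty" "sq_integrable h" for h
  proof -
    obtain C where "AE x in lebesgue. \<bar>V x\<bar> \<le> C" "V \<in> borel_measurable lebesgue"
      using \<open>V \<in> Linfty\<close> by (auto simp: Linfty_def)
    then show ?thesis
      using \<open>sq_integrable h\<close> by (intro sq_integrable_bounded_mult[where C = C]) auto
  qed
  then show "L2_rel (if V \<in> Linfty then (\<lambda>x. complex_of_real (V x) * f x) else (\<lambda>x. 0))
      (if V \<in> Linfty then (\<lambda>x. complex_of_real (V x) * g x) else (\<lambda>x. 0))"
    using fg by (auto simp: L2_rel_def)
qed

definition neg_laplacian :: "'a::euclidean_space unbounded_op"
  where "neg_laplacian = (H2, \<lambda>u. - laplacian u)"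

definition mult_op :: "('a::euclidean_space \<Rightarrow> real) \<Rightarrow> 'a unbounded_op"
  where "mult_op V = (UNIV, mult_fun V)"

definition cube :: "real \<Rightarrow> real ^ 'n \<Rightarrow> (real ^ 'n) set"
  where "cube R y = {x. \<forall>i. y $ i < x $ i \<and> x $ i < y $ i + R}"

definition cube_mean :: "(real ^ 'n \<Rightarrow> real) \<Rightarrow> real \<Rightarrow> real ^ 'n \<Rightarrow> real"
  where "cube_mean V R y = 1 / R ^ CARD('n) * (LINT x:cube R y|lebesgue. V x)"

definition thick :: "real \<Rightarrow> real \<Rightarrow> (real ^ 'n \<Rightarrow> real) \<Rightarrow> bool"
  where "thick R \<rho> V \<longleftrightarrow> (\<forall>y. cube_mean V R y \<ge> \<rho>)"

end

theory Submission
  imports Defs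
begin

text \<open>The operator \<open>A = - \<Delta> + V\<close> has the quadratic form \<open>energy V u = \<integral> |\<nabla>u|\<^sup>2 + \<integral> V |u|\<^sup>2\<close>, and strict
  positivity means that this form dominates a positive multiple of \<open>\<parallel>u\<parallel>\<^sup>2\<close> on \<open>H2\<close>.

  If the form dominates \<open>\<epsilon> \<parallel>u\<parallel>\<^sup>2\<close>, then \<open>A - z\<close> is coercive for \<open>Re z < \<epsilon>\<close>, and it remains to show that it is
  onto. By the Banach fixed point theorem (\<open>surjective_perturbation\<close>) this reduces to the
  surjectivity of \<open>l - \<Delta>\<close> on \<open>H2\<close> for \<open>l > 0\<close>, a substitute for the selfadjointness of the Laplacian.
  The latter is proved without the Fourier transform: an element of \<open>L\<^sup>2\<close> that is orthogonal to all
  \<open>(l - \<Delta>) \<phi>\<close>, with \<open>\<phi>\<close> a product of bump functions, vanishes by the maximum principle applied to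
  its convolutions with bump functions (\<open>Liouville_eq_0\<close>), so the functions \<open>(l - \<Delta>) v\<close>, with \<open>v\<close> in
  the span of these products, are dense; and integration by parts bounds all derivatives of \<open>v\<close> up
  to order two by \<open>(l - \<Delta>) v\<close>, so one can pass to the limit (\<open>resolvent_solution\<close>). The same argument shows that the span of the products of bump
  functions is dense in \<open>H2\<close>, which extends integration by parts and the estimate
  \<open>\<parallel>u (x + h) - u x\<parallel> \<le> (\<Sum>i. |h\<^sub>i| \<parallel>\<partial>\<^sub>i u\<parallel>)\<close> to \<open>H2\<close>. Conversely, the infimum of the form on the unit
  sphere is a point of the spectrum (\<open>energy_lower_bound_if_inf_spectrum_pos\<close>).

  If \<open>V\<close> is thick, then \<open>\<rho> \<parallel>u\<parallel>\<^sup>2\<close> is at most the mean, over \<open>h\<close> in a cube, of the potential energies of the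
  translates of \<open>u\<close>. By the translation estimate these are at most twice the potential energy of
  \<open>u\<close> plus a multiple of the kinetic energy, which gives strict positivity (\<open>thick_imp_energy_ge\<close>).
  If \<open>A\<close> is strictly positive, then inserting bump functions adapted to large cubes, whose kinetic
  energies are negligible, shows that the means of \<open>V\<close> over large cubes are bounded below
  (\<open>strictly_positive_imp_cube_mean_ge\<close>). This bounds the lower limit of the infimum of the means from
  below, and a positive lower limit in turn implies that \<open>V\<close> is thick.\<close>


section \<open>Smooth bump functions of one real variable\<close>

text \<open>\<open>Ck n f\<close>: the function \<open>f\<close> is \<open>n\<close> times differentiable on the real line.\<close>

primrec Ck :: "nat \<Rightarrow> (real \<Rightarrow> real) \<Rightarrow> bool"
  where
    "Ck 0 f \<longleftrightarrow> True"
  | "Ck (Suc n) f \<longleftrightarrow> (\<exists>f'. (\<forall>x. (f has_real_derivative f' x) (at x)) \<and> Ck n f')"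

text \<open>Infinitely differentiable functions on the real line.\<close>

definition smooth1 :: "(real \<Rightarrow> real) \<Rightarrow> bool"
  where "smooth1 f \<longleftrightarrow> (\<forall>n. Ck n f)"

lemma smooth1_has_deriv:
  assumes "smooth1 f" shows "(f has_real_derivative deriv f x) (at x)"
proof -
  have "Ck (Suc 0) f" using assms unfolding smooth1_def by blast
  then obtain f' where "\<forall>x. (f has_real_derivative f' x) (at x)" by auto
  then show ?thesis using DERIV_imp_deriv by metis
qed

lemma smooth1_deriv:
  assumes "smooth1 f" shows "smooth1 (deriv f)"
  unfolding smooth1_def
proof
  fix n
  have "Ck (Suc n) f" using assms unfolding smooth1_def by blast
  then obtain f' where f': "\<forall>x. (f has_real_derivative f' x) (at x)" "Ck n f'" by auto
  then have "deriv f = f'" using DERIV_imp_deriv by blast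
  then show "Ck n (deriv f)" using f' by simp
qed

lemma Ck_Suc_imp: "Ck (Suc n) f \<Longrightarrow> Ck n f"
  by (induction n arbitrary: f) auto

lemma Ck_add: "Ck n f \<Longrightarrow> Ck n g \<Longrightarrow> Ck n (\<lambda>x. f x + g x)"
proof (induction n arbitrary: f g)
  case (Suc n)
  then obtain f' g' where "\<forall>x. (f has_real_derivative f' x) (at x)" "Ck n f'"
    "\<forall>x. (g has_real_derivative g' x) (at x)" "Ck n g'" by auto
  then show ?case using Suc.IH[of f' g'] by (auto intro!: exI[of _ "\<lambda>x. f' x + g' x"] DERIV_add)
qed simp

lemma Ck_mult: "Ck n f \<Longrightarrow> Ck n g \<Longrightarrow> Ck n (\<lambda>x. f x * g x)"
proof (induction n arbitrary: f g)
  case (Suc n)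
  then obtain f' g' where d: "\<forall>x. (f has_real_derivative f' x) (at x)" "Ck n f'"
    "\<forall>x. (g has_real_derivative g' x) (at x)" "Ck n g'" by auto
  have "Ck n f" "Ck n g" using Suc.prems Ck_Suc_imp by blast+
  then have "Ck n (\<lambda>x. f' x * g x + g' x * f x)" using Suc.IH d by (intro Ck_add) auto
  moreover have "((\<lambda>x. f x * g x) has_real_derivative f' x * g x + g' x * f x) (at x)" for x
    using d by (intro DERIV_mult) auto
  ultimately show ?case unfolding Ck.simps by (intro exI[of _ "\<lambda>x. f' x * g x + g' x * f x"]) auto
qed simp

lemma Ck_const: "Ck n (\<lambda>x. c)"
proof (induction n arbitrary: c)
  case (Suc n)
  show ?case unfolding Ck.simps using Suc by (intro exI[of _ "\<lambda>x. 0"]) auto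
qed simp

lemma Ck_affine: "Ck n f \<Longrightarrow> Ck n (\<lambda>x. f (a * x + b))"
proof (induction n arbitrary: f)
  case (Suc n)
  then obtain f' where d: "\<forall>x. (f has_real_derivative f' x) (at x)" "Ck n f'" by auto
  have "((\<lambda>x. f (a * x + b)) has_real_derivative f' (a * x + b) * a) (at x)" for x
    by (rule DERIV_chain2[of f]) (use d in \<open>auto intro!: derivative_eq_intros\<close>)
  moreover have "Ck n (\<lambda>x. f' (a * x + b) * a)"
    using Suc.IH[OF d(2)] by (intro Ck_mult Ck_const)
  ultimately show ?case unfolding Ck.simps by (intro exI[of _ "\<lambda>x. f' (a * x + b) * a"]) auto
qed simp

lemma smooth1_mult: "smooth1 f \<Longrightarrow> smooth1 g \<Longrightarrow> smooth1 (\<lambda>x. f x * g x)"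
  by (simp add: smooth1_def Ck_mult)

lemma smooth1_affine: "smooth1 f \<Longrightarrow> smooth1 (\<lambda>x. f (a * x + b))"
  by (simp add: smooth1_def Ck_affine)

text \<open>The family \<open>t \<mapsto> p (1/t) * exp (-1/t)\<close>, extended by \<open>0\<close> to \<open>t \<le> 0\<close>, with \<open>p\<close> a
  polynomial, is closed under differentiation.\<close>

definition flat :: "real poly \<Rightarrow> real \<Rightarrow> real"
  where "flat p t = (if t > 0 then poly p (1 / t) * exp (- (1 / t)) else 0)"

lemma poly_exp_tendsto_0: "((\<lambda>s::real. poly p s * exp (- s)) \<longlongrightarrow> 0) at_top"
proof -
  have "((\<lambda>s. \<Sum>i\<le>degree p. coeff p i * (s ^ i / exp s)) \<longlongrightarrow> (\<Sum>i\<le>degree p. coeff p i * 0)) at_top"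
    by (intro tendsto_sum tendsto_mult tendsto_const tendsto_power_div_exp_0)
  moreover have "poly p s * exp (- s) = (\<Sum>i\<le>degree p. coeff p i * (s ^ i / exp s))" for s
    by (simp add: poly_altdef sum_distrib_right exp_minus divide_inverse mult.assoc)
  ultimately show ?thesis by simp
qed

lemma flat_deriv: "(flat p has_real_derivative flat ([:0, 0, 1:] * (p - pderiv p)) t) (at t)"
proof -
  consider "t > 0" | "t < 0" | "t = 0" by linarith
  then show ?thesis
  proof cases
    case 1
    have "((\<lambda>t. poly p (1 / t) * exp (- (1 / t))) has_real_derivative
        poly ([:0, 0, 1:] * (p - pderiv p)) (1 / t) * exp (- (1 / t))) (at t)"
    proof -
      have inv: "((\<lambda>t. 1 / t) has_real_derivative - (1 / t * (1 / t))) (at t)"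
        using 1 by (auto intro!: derivative_eq_intros)
      have e: "((\<lambda>t. exp (- (1 / t))) has_real_derivative exp (- (1 / t)) * (1 / t * (1 / t))) (at t)"
        using DERIV_chain2[OF DERIV_exp DERIV_minus[OF inv]] by simp
      have "((\<lambda>t. poly p (1 / t)) has_real_derivative
          poly (pderiv p) (1 / t) * - (1 / t * (1 / t))) (at t)"
        by (rule DERIV_chain2[OF poly_DERIV inv])
      from DERIV_mult[OF this e] show ?thesis
        by (rule DERIV_cong) (simp add: algebra_simps)
    qed
    then have "(flat p has_real_derivative
        poly ([:0, 0, 1:] * (p - pderiv p)) (1 / t) * exp (- (1 / t))) (at t)"
      by (rule has_field_derivative_transform_within_open[where S = "{0<..}"])
        (use 1 in \<open>auto simp: flat_def\<close>)
    then show ?thesis using 1 by (simp add: flat_def)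
  next
    case 2
    have "((\<lambda>t. 0) has_real_derivative 0) (at t)" by simp
    then have "(flat p has_real_derivative 0) (at t)"
      by (rule has_field_derivative_transform_within_open[where S = "{..<0}"])
        (use 2 in \<open>auto simp: flat_def\<close>)
    then show ?thesis using 2 by (simp add: flat_def)
  next
    \<comment> \<open>At the origin the difference quotient from the right is \<open>p(s) s exp(-s)\<close> at \<open>s = 1/t\<close>.\<close>
    case 3
    have "((\<lambda>s. poly (pCons 0 p) (1 / s) * exp (- (1 / s))) \<longlongrightarrow> 0) (at_right 0)"
      using filterlim_compose[OF poly_exp_tendsto_0[of "pCons 0 p"] filterlim_inverse_at_top_right]
      by (simp add: inverse_eq_divide)
    then have "((\<lambda>s. flat p s / s) \<longlongrightarrow> 0) (at_right 0)"
      by (rule Lim_transform_eventually)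
        (auto simp: eventually_at_right_field flat_def intro!: exI[of _ 1])
    moreover have "((\<lambda>s. flat p s / s) \<longlongrightarrow> 0) (at_left 0)"
      by (rule Lim_transform_eventually[OF tendsto_const])
        (auto simp: eventually_at_left_field flat_def intro!: exI[of _ "-1"])
    ultimately have "((\<lambda>s. flat p s / s) \<longlongrightarrow> 0) (at 0)"
      by (simp add: filterlim_at_split)
    then show ?thesis using 3 by (simp add: DERIV_def flat_def)
  qed
qed

lemma smooth1_flat: "smooth1 (flat p)"
proof -
  have "Ck n (flat p)" for n
  proof (induction n arbitrary: p)
    case (Suc n)
    show ?case unfolding Ck.simps using flat_deriv Suc by blast
  qed simp
  then show ?thesis by (simp add: smooth1_def)
qed

text \<open>Infinitely differentiable functions of one real variable with bounded support.\<close>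

definition bump1 :: "(real \<Rightarrow> real) \<Rightarrow> bool"
  where "bump1 g \<longleftrightarrow> smooth1 g \<and> (\<exists>r. \<forall>t. \<bar>t\<bar> > r \<longrightarrow> g t = 0)"

text \<open>The derivative vanishes outside the same interval, because this exterior is open.\<close>

lemma bump1_deriv:
  assumes "bump1 g" shows "bump1 (deriv g)"
proof -
  obtain r where r: "\<And>t. \<bar>t\<bar> > r \<Longrightarrow> g t = 0" using assms by (auto simp: bump1_def)
  have "deriv g t = 0" if "\<bar>t\<bar> > r" for t
  proof -
    have op: "open {s. \<bar>s\<bar> > r}" by (intro open_Collect_less continuous_intros)
    have "((\<lambda>t. 0) has_real_derivative 0) (at t)" by simp
    then have "(g has_real_derivative 0) (at t)"
      by (rule has_field_derivative_transform_within_open[OF _ op]) (use that r in auto)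
    then show ?thesis by (rule DERIV_imp_deriv)
  qed
  then show ?thesis using assms by (auto simp: bump1_def smooth1_deriv)
qed

lemma bump1_shift:
  assumes "bump1 g" shows "bump1 (\<lambda>t. g (t + s))"
proof -
  obtain r where r: "\<And>t. \<bar>t\<bar> > r \<Longrightarrow> g t = 0" using assms by (auto simp: bump1_def)
  have "g (t + s) = 0" if "\<bar>t\<bar> > r + \<bar>s\<bar>" for t
    using that by (intro r) linarith
  moreover have "smooth1 (\<lambda>t. g (t + s))"
    using smooth1_affine[of g 1 s] assms by (simp add: bump1_def)
  ultimately show ?thesis by (auto simp: bump1_def)
qed

lemma bump1_scale:
  assumes "bump1 g" "a \<noteq> 0" shows "bump1 (\<lambda>t. g (a * t + b))"
proof -
  obtain r where r: "\<And>t. \<bar>t\<bar> > r \<Longrightarrow> g t = 0" using assms by (auto simp: bump1_def)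
  have "g (a * t + b) = 0" if "\<bar>t\<bar> > (\<bar>r\<bar> + \<bar>b\<bar>) / \<bar>a\<bar>" for t
  proof (rule r)
    have "\<bar>r\<bar> + \<bar>b\<bar> < \<bar>a * t\<bar>" using that assms(2) by (simp add: field_simps abs_mult)
    then show "\<bar>a * t + b\<bar> > r" by linarith
  qed
  moreover have "smooth1 (\<lambda>t. g (a * t + b))"
    using smooth1_affine[of g a b] assms by (simp add: bump1_def)
  ultimately show ?thesis by (auto simp: bump1_def)
qed

text \<open>As \<open>k\<close> tends to infinity, these bumps converge to the indicator function of \<open>(a, b)\<close>.\<close>

definition ibump :: "real \<Rightarrow> real \<Rightarrow> real \<Rightarrow> real \<Rightarrow> real"
  where "ibump a b k t = flat 1 (k * (t - a)) * flat 1 (k * (b - t))"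

lemma flat1_bounds: "0 \<le> flat 1 t" "flat 1 t \<le> 1"
  by (auto simp: flat_def)

lemma ibump_bounds: "0 \<le> ibump a b k t" "ibump a b k t \<le> 1"
  using flat1_bounds by (auto simp: ibump_def mult_le_one)

lemma ibump_zero: "k > 0 \<Longrightarrow> t \<notin> {a<..<b} \<Longrightarrow> ibump a b k t = 0"
  by (auto simp: ibump_def flat_def zero_less_mult_iff)

lemma bump1_ibump:
  assumes "k > 0" shows "bump1 (ibump a b k)"
proof -
  have "smooth1 (\<lambda>t. flat 1 (k * t + (- k * a)) * flat 1 ((- k) * t + k * b))"
    by (intro smooth1_mult smooth1_affine smooth1_flat)
  then have "smooth1 (ibump a b k)" unfolding ibump_def[abs_def] by (simp add: algebra_simps)
  moreover have "ibump a b k t = 0" if "\<bar>t\<bar> > \<bar>a\<bar> + \<bar>b\<bar>" for t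
    using assms by (rule ibump_zero) (use that in auto)
  ultimately show ?thesis by (auto simp: bump1_def)
qed

lemma ibump_tendsto: "(\<lambda>n. ibump a b (real (Suc n)) t) \<longlonglongrightarrow> (if a < t \<and> t < b then 1 else 0)"
proof -
  have lim: "(\<lambda>n. flat 1 (real (Suc n) * s)) \<longlonglongrightarrow> 1" if "s > 0" for s
  proof -
    have "(\<lambda>n. exp (- ((1 / s) * inverse (real (Suc n))))) \<longlonglongrightarrow> exp (- ((1 / s) * 0))"
      by (intro tendsto_intros LIMSEQ_inverse_real_of_nat)
    then show ?thesis using that by (simp add: flat_def inverse_eq_divide mult.commute del: of_nat_Suc)
  qed
  show ?thesis
  proof (cases "a < t \<and> t < b")
    case True
    have "(\<lambda>n. flat 1 (real (Suc n) * (t - a)) * flat 1 (real (Suc n) * (b - t))) \<longlonglongrightarrow> 1 * 1"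
      using True by (intro tendsto_mult lim) auto
    then show ?thesis using True by (simp add: ibump_def)
  next
    case False
    then have "ibump a b (real (Suc n)) t = 0" for n by (intro ibump_zero) auto
    then show ?thesis using False by (simp only:) simp
  qed
qed

lemma bump1_continuous: "bump1 g \<Longrightarrow> continuous_on UNIV g"
  by (rule DERIV_continuous_on[where D = "deriv g"]) (auto intro: smooth1_has_deriv simp: bump1_def)

lemma bump1_bounded:
  assumes "bump1 g" obtains K where "\<And>t. \<bar>g t\<bar> \<le> K"
proof -
  obtain r where r: "\<And>t. \<bar>t\<bar> > r \<Longrightarrow> g t = 0" using assms by (auto simp: bump1_def)
  have "compact (g ` {-\<bar>r\<bar>..\<bar>r\<bar>})"
    by (intro compact_continuous_image compact_Icc continuous_on_subset[OF bump1_continuous[OF assms]]) auto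
  then have "bounded (g ` {-\<bar>r\<bar>..\<bar>r\<bar>})" by (rule compact_imp_bounded)
  then obtain K where K: "\<And>t. t \<in> {-\<bar>r\<bar>..\<bar>r\<bar>} \<Longrightarrow> \<bar>g t\<bar> \<le> K" unfolding bounded_iff real_norm_def by blast
  have "\<bar>g t\<bar> \<le> K" for t
  proof (cases "\<bar>t\<bar> > \<bar>r\<bar>")
    case True then show ?thesis using r[of t] K[of 0] by auto
  next
    case False then show ?thesis by (intro K) auto
  qed
  then show ?thesis using that by blast
qed


section \<open>Products of bump functions\<close>

text \<open>The function \<open>x \<mapsto> \<Prod>b. g b (x \<bullet> b)\<close>. Products of one-dimensional bump functions are test
  functions, and their partial derivatives are again of this form, so that
  smoothness in several variables reduces to smoothness in one variable.\<close>

definition bprod :: "('a::euclidean_space \<Rightarrow> real \<Rightarrow> real) \<Rightarrow> 'a \<Rightarrow> complex"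
  where "bprod g x = complex_of_real (\<Prod>b\<in>Basis. g b (x \<bullet> b))"

text \<open>All factors of the product are bump functions; the values of the family outside the basis are
  irrelevant.\<close>

definition bumps :: "('a::euclidean_space \<Rightarrow> real \<Rightarrow> real) \<Rightarrow> bool"
  where "bumps g \<longleftrightarrow> (\<forall>b\<in>Basis. bump1 (g b))"

text \<open>The family of factors of the partial derivative in direction \<open>b\<close>.\<close>

definition dfac :: "'a \<Rightarrow> ('a::euclidean_space \<Rightarrow> real \<Rightarrow> real) \<Rightarrow> 'a \<Rightarrow> real \<Rightarrow> real"
  where "dfac b g = g(b := deriv (g b))"

lemma bumps_dfac: "b \<in> Basis \<Longrightarrow> bumps g \<Longrightarrow> bumps (dfac b g)"
  by (auto simp: bumps_def dfac_def bump1_deriv)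

lemma dfac_commute: "dfac b (dfac c g) = dfac c (dfac b g)"
  by (auto simp: dfac_def fun_eq_iff)

lemma bumps_shift: "bumps g \<Longrightarrow> bumps (\<lambda>b t. g b (t + x \<bullet> b))"
  by (auto simp: bumps_def bump1_shift)

lemma bprod_shift: "bprod g (x + y) = bprod (\<lambda>b t. g b (t + y \<bullet> b)) x"
  by (simp add: bprod_def inner_add_left)

lemma cnj_bprod [simp]: "cnj (bprod g x) = bprod g x"
  by (simp add: bprod_def)

lemma bprod_continuous: "bumps g \<Longrightarrow> continuous_on UNIV (bprod g)"
  unfolding bprod_def[abs_def] bumps_def
proof (intro continuous_on_of_real continuous_on_prod)
  fix b :: 'a assume "\<forall>b\<in>Basis. bump1 (g b)" "b \<in> Basis"
  then have "continuous_on UNIV (g b)" by (intro bump1_continuous) auto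
  then show "continuous_on UNIV (\<lambda>x. g b (x \<bullet> b))"
    by (rule continuous_on_compose2) (auto intro: continuous_intros)
qed

lemma bprod_differentiable:
  assumes "bumps g" shows "bprod g differentiable (at x)"
proof -
  have "(\<lambda>x. g b (x \<bullet> b)) differentiable (at x)" if "b \<in> Basis" for b
  proof -
    have "(g b has_derivative (*) (deriv (g b) (x \<bullet> b))) (at (x \<bullet> b))"
      using smooth1_has_deriv[of "g b"] assms that
      by (auto simp: bumps_def bump1_def has_field_derivative_def)
    then have "((\<lambda>x. g b (x \<bullet> b)) has_derivative (\<lambda>h. deriv (g b) (x \<bullet> b) * (h \<bullet> b))) (at x)"
      by (rule has_derivative_compose[rotated]) (auto intro!: derivative_eq_intros)
    then show ?thesis by (auto simp: differentiable_def)
  qed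
  then obtain D where D: "\<And>b. b \<in> Basis \<Longrightarrow> ((\<lambda>x. g b (x \<bullet> b)) has_derivative D b) (at x)"
    unfolding differentiable_def by metis
  have "((\<lambda>x. \<Prod>b\<in>Basis. g b (x \<bullet> b)) has_derivative
    (\<lambda>y. \<Sum>i\<in>Basis. D i y * (\<Prod>j\<in>Basis - {i}. g j (x \<bullet> j)))) (at x)"
    by (rule has_derivative_prod) (rule D)
  from has_derivative_of_real[OF this] show ?thesis
    unfolding bprod_def[abs_def] differentiable_def by blast
qed

lemma bprod_has_partial:
  assumes "bumps g" "b \<in> Basis"
  shows "((\<lambda>t. bprod g (x + t *\<^sub>R b)) has_vector_derivative bprod (dfac b g) x) (at 0)"
proof -
  have split: "(\<Prod>c\<in>Basis. h c (y \<bullet> c)) = h b (y \<bullet> b) * (\<Prod>c\<in>Basis - {b}. h c (y \<bullet> c))"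
    for h :: "'a \<Rightarrow> real \<Rightarrow> real" and y
    using assms(2) by (simp add: prod.remove)
  have d: "((\<lambda>t. g b (x \<bullet> b + t)) has_real_derivative deriv (g b) (x \<bullet> b)) (at 0)"
  proof -
    have "(g b has_real_derivative deriv (g b) (x \<bullet> b + 0)) (at (x \<bullet> b + 0))"
      using smooth1_has_deriv[of "g b"] assms by (auto simp: bumps_def bump1_def)
    then show ?thesis using DERIV_at_within_shift[of "g b" "deriv (g b) (x \<bullet> b + 0)" "x \<bullet> b" 0 UNIV] by (simp add: add.commute)
  qed
  have "((\<lambda>t. g b (x \<bullet> b + t) * (\<Prod>c\<in>Basis - {b}. g c (x \<bullet> c))) has_real_derivative
      deriv (g b) (x \<bullet> b) * (\<Prod>c\<in>Basis - {b}. g c (x \<bullet> c))) (at 0)"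
    using d by (rule DERIV_cmult_right)
  moreover have "(\<Prod>c\<in>Basis. g c ((x + t *\<^sub>R b) \<bullet> c)) =
      g b (x \<bullet> b + t) * (\<Prod>c\<in>Basis - {b}. g c (x \<bullet> c))" for t
  proof -
    have "(\<Prod>c\<in>Basis - {b}. g c ((x + t *\<^sub>R b) \<bullet> c)) = (\<Prod>c\<in>Basis - {b}. g c (x \<bullet> c))"
      using assms(2) by (intro prod.cong) (auto simp: inner_add_left inner_not_same_Basis)
    then show ?thesis using assms(2) split[of g "x + t *\<^sub>R b"]
      by (simp add: inner_add_left)
  qed
  moreover have "(\<Prod>c\<in>Basis. dfac b g c (x \<bullet> c)) =
      deriv (g b) (x \<bullet> b) * (\<Prod>c\<in>Basis - {b}. g c (x \<bullet> c))"
    unfolding split[of "dfac b g" x] by (auto simp: dfac_def intro!: prod.cong)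
  ultimately have "((\<lambda>t. \<Prod>c\<in>Basis. g c ((x + t *\<^sub>R b) \<bullet> c)) has_vector_derivative
      (\<Prod>c\<in>Basis. dfac b g c (x \<bullet> c))) (at 0)"
    by (simp only: has_real_derivative_iff_has_vector_derivative)
  then show ?thesis unfolding bprod_def
    by (rule bounded_linear.has_vector_derivative[OF bounded_linear_of_real])
qed

lemma bprod_support:
  assumes "bumps (g :: 'a::euclidean_space \<Rightarrow> _)" obtains r where "\<And>x. norm x > r \<Longrightarrow> bprod g x = 0"
proof -
  have "\<forall>b\<in>Basis. \<exists>r. \<forall>t. \<bar>t\<bar> > r \<longrightarrow> g b t = 0" using assms by (auto simp: bumps_def bump1_def)
  then obtain r where r: "\<And>b t. b \<in> Basis \<Longrightarrow> \<bar>t\<bar> > r b \<Longrightarrow> g b t = 0" by metis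
  have "bprod g x = 0" if "norm x > (\<Sum>b\<in>Basis. \<bar>r b\<bar>)" for x
  proof -
    have "(\<Sum>b\<in>Basis. \<bar>r b\<bar>) < (\<Sum>b\<in>Basis. \<bar>x \<bullet> b\<bar>)"
      using that norm_le_l1[of x] by linarith
    then obtain b where "b \<in> Basis" "\<bar>r b\<bar> < \<bar>x \<bullet> b\<bar>"
      by (meson linorder_not_less sum_mono)
    then have "g b (x \<bullet> b) = 0" using r[of b "x \<bullet> b"] by auto
    then show ?thesis using \<open>b \<in> Basis\<close> by (auto simp: bprod_def)
  qed
  then show ?thesis using that by blast
qed

lemma partial_deriv_bprod: "bumps g \<Longrightarrow> b \<in> Basis \<Longrightarrow> partial_deriv b (bprod g) = bprod (dfac b g)"
  by (rule ext) (simp add: partial_deriv_def vector_derivative_at[OF bprod_has_partial])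

lemma bprod_test_function:
  assumes "bumps g" shows "bprod g \<in> test_functions"
proof -
  have "fold partial_deriv bs (bprod g) differentiable_on UNIV" if "bs \<in> lists Basis" for bs
  proof -
    have "\<exists>h. bumps h \<and> fold partial_deriv bs (bprod g) = bprod h"
      using that assms
    proof (induction bs arbitrary: g)
      case (Cons b bs)
      then show ?case using bumps_dfac[of b g] by (auto simp: partial_deriv_bprod)
    qed auto
    then show ?thesis using bprod_differentiable
      by (auto simp: differentiable_on_def intro: differentiable_at_withinI)
  qed
  moreover obtain r where "\<And>x. norm x > r \<Longrightarrow> bprod g x = 0" using bprod_support[OF assms] by blast
  then have "{x. bprod g x \<noteq> 0} \<subseteq> cball 0 r" by (force simp: not_less[symmetric])
  then have "bounded {x. bprod g x \<noteq> 0}" using bounded_cball bounded_subset by blast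
  ultimately show ?thesis by (simp add: test_functions_def)
qed


section \<open>The Hilbert space structure\<close>

lemma L2_rel_refl: "L2_rel f f \<longleftrightarrow> sq_integrable f"
  by (simp add: L2_rel_def)

lemma sq_integrable_rep [simp]: "sq_integrable (rep_L2 u)"
  using Quotient3_rep_reflp[OF Quotient3_L2, of u] by (simp add: L2_rel_refl)

lemma abs_rep_L2 [simp]: "abs_L2 (rep_L2 u) = u"
  by (rule Quotient3_abs_rep[OF Quotient3_L2])

lemma abs_L2_eq_iff:
  assumes "sq_integrable f" "sq_integrable g"
  shows "abs_L2 f = abs_L2 g \<longleftrightarrow> (AE x in lebesgue. f x = g x)"
  using Quotient3_rel[OF Quotient3_L2, of f g] assms by (auto simp: L2_rel_def)

lemma rep_abs_L2:
  assumes "sq_integrable f" shows "AE x in lebesgue. rep_L2 (abs_L2 f) x = f x"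
  using abs_L2_eq_iff[OF sq_integrable_rep[of "abs_L2 f"] assms] by simp

lemma abs_L2_add: "sq_integrable f \<Longrightarrow> sq_integrable g \<Longrightarrow> abs_L2 f + abs_L2 g = abs_L2 (\<lambda>x. f x + g x)"
  by (rule plus_L2.abs_eq) (auto simp: L2_rel_refl)

lemma abs_L2_cscale: "sq_integrable f \<Longrightarrow> cscale c (abs_L2 f) = abs_L2 (\<lambda>x. c * f x)"
  by (rule cscale.abs_eq) (auto simp: L2_rel_refl)

lemma abs_L2_uminus: "sq_integrable f \<Longrightarrow> - abs_L2 f = abs_L2 (\<lambda>x. - f x)"
  by (rule uminus_L2.abs_eq) (auto simp: L2_rel_refl)

lemma sq_integrable_uminus: "sq_integrable f \<Longrightarrow> sq_integrable (\<lambda>x. - f x)"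
  using sq_integrable_cmult[of f "-1"] by simp

lemma sq_integrable_diff: "sq_integrable f \<Longrightarrow> sq_integrable g \<Longrightarrow> sq_integrable (\<lambda>x. f x - g x)"
  using sq_integrable_add[OF _ sq_integrable_uminus, of f g] by simp

lemma abs_L2_diff: "sq_integrable f \<Longrightarrow> sq_integrable g \<Longrightarrow> abs_L2 f - abs_L2 g = abs_L2 (\<lambda>x. f x - g x)"
  by (simp add: minus_L2_def abs_L2_uminus abs_L2_add sq_integrable_uminus)

lemma abs_L2_scaleR: "sq_integrable f \<Longrightarrow> r *\<^sub>R abs_L2 f = abs_L2 (\<lambda>x. complex_of_real r * f x)"
  by (simp add: scaleR_L2_def abs_L2_cscale)

lemma cinner_abs_L2:
  "sq_integrable f \<Longrightarrow> sq_integrable g \<Longrightarrow> cinner (abs_L2 f) (abs_L2 g) = (LINT x|lebesgue. f x * cnj (g x))"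
  by (rule cinner.abs_eq) (auto simp: L2_rel_refl)

lemma norm_L2_sq: "(norm u)\<^sup>2 = Re (cinner u u)"
  by (simp add: norm_eq_sqrt_inner inner_L2_def[symmetric])

lemma cinner_same: "cinner u u = complex_of_real ((norm u)\<^sup>2)"
  by (simp add: norm_L2_sq cinner_self)

lemma norm_abs_L2_sq:
  assumes "sq_integrable f"
  shows "(norm (abs_L2 f))\<^sup>2 = (LINT x|lebesgue. (cmod (f x))\<^sup>2)"
proof -
  have "cinner (abs_L2 f) (abs_L2 f) = (LINT x|lebesgue. complex_of_real ((cmod (f x))\<^sup>2))"
    using assms by (simp only: cinner_abs_L2 complex_norm_square)
  then show ?thesis by (simp only: integral_complex_of_real norm_L2_sq Re_complex_of_real)
qed

lemma cscale_add_right: "cscale c (u + v) = cscale c u + cscale c v"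
  by transfer (auto simp: L2_rel_def sq_integrable_add sq_integrable_cmult distrib_left)

lemma cscale_add_left: "cscale (c + d) u = cscale c u + cscale d u"
  by transfer (auto simp: L2_rel_def sq_integrable_add sq_integrable_cmult distrib_right)

lemma cscale_cscale [simp]: "cscale c (cscale d u) = cscale (c * d) u"
  by transfer (auto simp: L2_rel_def sq_integrable_cmult mult.assoc)

lemma cscale_one [simp]: "cscale 1 u = u"
  by transfer (auto simp: L2_rel_def)

lemma cscale_of_real: "cscale (complex_of_real r) u = r *\<^sub>R u"
  by (simp add: scaleR_L2_def)

lemma cscale_scaleR: "cscale c (r *\<^sub>R u) = r *\<^sub>R cscale c u"
  by (simp add: scaleR_L2_def mult.commute)

lemma cscale_zero_right [simp]: "cscale c 0 = 0"
  using cscale_add_right[of c 0 0] by simp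

lemma cscale_minus_right: "cscale c (- u) = - cscale c u"
  using cscale_add_right[of c u "- u"] by (simp add: eq_neg_iff_add_eq_0 add.commute)

lemma cscale_diff_right: "cscale c (u - v) = cscale c u - cscale c v"
  using cscale_add_right[of c u "- v"] by (simp add: cscale_minus_right)

lemma cscale_minus_left: "cscale (- c) u = - cscale c u"
  using cscale_cscale[of "-1" c u] cscale_of_real[of "-1" "cscale c u"] by simp

lemma cscale_sum_right: "cscale c (\<Sum>i\<in>I. f i) = (\<Sum>i\<in>I. cscale c (f i))"
  by (induction I rule: infinite_finite_induct) (auto simp: cscale_add_right)

lemma cinner_add_right: "cinner u (v + w) = cinner u v + cinner u w"
  by (subst (1 2 3) cinner_commute) (simp add: cinner_add_left)

lemma cinner_cscale_right: "cinner u (cscale c v) = cnj c * cinner u v"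
  by (subst (1 2) cinner_commute) (simp add: cinner_cscale_left)

lemma cinner_scaleR_left: "cinner (r *\<^sub>R u) v = r *\<^sub>R cinner u v"
  by (simp add: scaleR_L2_def cinner_cscale_left scaleR_conv_of_real)

lemma cinner_scaleR_right: "cinner u (r *\<^sub>R v) = r *\<^sub>R cinner u v"
  by (simp add: scaleR_L2_def cinner_cscale_right scaleR_conv_of_real)

lemma norm_cscale: "norm (cscale c u) = cmod c * norm u"
proof -
  have "(norm (cscale c u))\<^sup>2 = (cmod c * norm u)\<^sup>2"
    unfolding norm_L2_sq cinner_cscale_left cinner_cscale_right
    by (simp add: cinner_same cmod_power2 power_mult_distrib mult.assoc[symmetric])
      (simp add: power2_eq_square cmod_def)
  then show ?thesis by (simp add: power2_eq_iff_nonneg)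
qed

text \<open>The imaginary part of the inner product is a real inner product with \<open>\<i> v\<close>.\<close>

lemma cinner_eq_Complex: "cinner u v = Complex (inner u v) (inner u (cscale \<i> v))"
  by (rule complex_eqI) (simp_all add: inner_L2_def cinner_cscale_right)

lemma norm_cinner_le: "cmod (cinner u v) \<le> norm u * norm v * 2"
proof -
  have "cmod (cinner u v) \<le> \<bar>inner u v\<bar> + \<bar>inner u (cscale \<i> v)\<bar>"
    using cmod_le[of "cinner u v"] by (simp add: cinner_eq_Complex)
  also have "\<dots> \<le> norm u * norm v + norm u * norm (cscale \<i> v)"
    by (intro add_mono Cauchy_Schwarz_ineq2)
  finally show ?thesis by (simp add: norm_cscale)
qed

lemma bounded_bilinear_cinner: "bounded_bilinear (cinner :: 'a::euclidean_space L2 \<Rightarrow> _)"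
  by (rule bounded_bilinear.intro)
    (auto simp: cinner_add_left cinner_add_right cinner_scaleR_left cinner_scaleR_right
      intro!: exI[of _ 2] norm_cinner_le)

lemma bounded_linear_cscale: "bounded_linear (cscale c)"
  by (rule bounded_linear_intro[where K = "cmod c"])
    (auto simp: cscale_add_right cscale_scaleR norm_cscale mult.commute)

lemmas tendsto_cinner = bounded_bilinear.tendsto[OF bounded_bilinear_cinner]
lemmas cinner_diff_left = bounded_bilinear.diff_left[OF bounded_bilinear_cinner]
lemmas cinner_diff_right = bounded_bilinear.diff_right[OF bounded_bilinear_cinner]
lemmas cinner_sum_left = bounded_bilinear.sum_left[OF bounded_bilinear_cinner]
lemmas cinner_sum_right = bounded_bilinear.sum_right[OF bounded_bilinear_cinner]
lemmas cinner_zero_left = bounded_bilinear.zero_left[OF bounded_bilinear_cinner]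
lemmas cinner_zero_right = bounded_bilinear.zero_right[OF bounded_bilinear_cinner]

lemma norm_abs_L2_le:
  assumes f: "f \<in> borel_measurable lebesgue" and K: "\<And>x. cmod (f x) \<le> K"
    and S: "S \<in> lmeasurable" "\<And>x. x \<notin> S \<Longrightarrow> f x = 0" and "0 \<le> K"
  shows "sq_integrable f" "norm (abs_L2 f) \<le> K * sqrt (measure lebesgue S)"
proof -
  have i: "integrable lebesgue (\<lambda>x. K\<^sup>2 * indicator S x)"
    using S by (auto simp: fmeasurable_def)
  have b: "(cmod (f x))\<^sup>2 \<le> K\<^sup>2 * indicator S x" for x
    using K[of x] S(2)[of x] by (auto simp: indicator_def power_mono)
  show sq: "sq_integrable f"
    unfolding sq_integrable_def
  proof (intro conjI f Bochner_Integration.integrable_bound[OF i] AE_I2)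
    have [measurable]: "f \<in> borel_measurable lebesgue" by fact
    show "(\<lambda>x. (cmod (f x))\<^sup>2) \<in> borel_measurable lebesgue" by measurable
    show "norm ((cmod (f x))\<^sup>2) \<le> norm (K\<^sup>2 * indicator S x)" for x
      using b[of x] by simp
  qed
  have "(norm (abs_L2 f))\<^sup>2 \<le> (LINT x|lebesgue. K\<^sup>2 * indicator S x)"
    unfolding norm_abs_L2_sq[OF sq] using sq b
    by (intro integral_mono i) (auto simp: sq_integrable_def)
  also have "\<dots> = (K * sqrt (measure lebesgue S))\<^sup>2"
    using S by (simp add: fmeasurable_def power_mult_distrib)
  finally show "norm (abs_L2 f) \<le> K * sqrt (measure lebesgue S)"
    by (rule power2_le_imp_le) (use assms in simp)
qed


subsection \<open>Completeness\<close>

text \<open>If \<open>norm (X (n+1) - X n) \<le> 2^-n\<close>, then \<open>\<Sum>n. 2^n |X (n+1) - X n|^2\<close> has a finite integral, so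
  by the inequality of the arithmetic and geometric mean \<open>X n\<close> converges almost everywhere.\<close>

lemma L2_fast_Cauchy_AE_convergent:
  fixes X :: "nat \<Rightarrow> 'a::euclidean_space L2"
  assumes fast: "\<And>n. norm (X (Suc n) - X n) \<le> (1/2)^n"
  shows "AE x in lebesgue. convergent (\<lambda>n. rep_L2 (X n) x)"
proof -
  define f where "f n = rep_L2 (X n)" for n
  have sqf: "sq_integrable (f n)" for n by (simp add: f_def)
  have [measurable]: "f n \<in> borel_measurable lebesgue" for n using sqf by blast
  define d where "d n x = 2 ^ n * (cmod (f (Suc n) x - f n x))\<^sup>2" for n x
  have int: "(\<integral>\<^sup>+x. ennreal (d n x) \<partial>lebesgue) \<le> ennreal ((1/2)^n)" for n
  proof -
    have sq: "sq_integrable (\<lambda>x. f (Suc n) x - f n x)" by (intro sq_integrable_diff sqf)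
    have "X (Suc n) - X n = abs_L2 (\<lambda>x. f (Suc n) x - f n x)"
      by (simp add: abs_L2_diff[OF sqf sqf, symmetric]) (simp add: f_def)
    then have "integral\<^sup>L lebesgue (d n) = 2 ^ n * (norm (X (Suc n) - X n))\<^sup>2"
      using norm_abs_L2_sq[OF sq] by (simp add: d_def[abs_def])
    also have "\<dots> \<le> 2 ^ n * ((1/2) ^ n)\<^sup>2"
      using fast[of n] by (intro mult_left_mono power_mono) auto
    also have "\<dots> = (1/2) ^ n" by (simp add: power2_eq_square field_simps)
    finally have "integral\<^sup>L lebesgue (d n) \<le> (1/2) ^ n" .
    moreover have "integrable lebesgue (d n)"
      unfolding d_def[abs_def] using sq by auto
    ultimately show ?thesis
      by (subst nn_integral_eq_integral) (auto simp: d_def intro!: ennreal_leI)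
  qed
  have "(\<integral>\<^sup>+x. (\<Sum>n. ennreal (d n x)) \<partial>lebesgue) = (\<Sum>n. \<integral>\<^sup>+x. ennreal (d n x) \<partial>lebesgue)"
    unfolding d_def by (intro nn_integral_suminf) measurable
  also have "\<dots> \<le> (\<Sum>n. ennreal ((1/2)^n))"
    by (intro suminf_le int) auto
  also have "\<dots> = ennreal (\<Sum>n. (1/2)^n)"
    by (rule suminf_ennreal_eq) (use geometric_sums[of "1/2::real"] in \<open>auto simp: sums_iff\<close>)
  finally have "(\<integral>\<^sup>+x. (\<Sum>n. ennreal (d n x)) \<partial>lebesgue) \<noteq> \<infinity>"
    by (auto simp: top_unique)
  then have "AE x in lebesgue. (\<Sum>n. ennreal (d n x)) \<noteq> \<infinity>"
    unfolding d_def by (intro nn_integral_PInf_AE) (auto, measurable)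
  then show ?thesis
  proof eventually_elim
    case (elim x)
    then have sd: "summable (\<lambda>n. d n x)"
      by (intro summable_suminf_not_top) (auto simp: d_def)
    have "summable (\<lambda>n. f (Suc n) x - f n x)"
    proof (rule summable_comparison_test')
      show "summable (\<lambda>n. (1/2)^n + d n x)"
        by (intro summable_add sd summable_geometric) auto
      fix n :: nat
      define c where "c = cmod (f (Suc n) x - f n x)"
      have "0 \<le> ((1/2)^n - c)\<^sup>2 * 2 ^ n" by simp
      also have "\<dots> = (1/2)^n + d n x - 2 * c"
        by (simp add: d_def c_def[symmetric] power2_eq_square algebra_simps power_mult_distrib[symmetric])
      finally have "2 * c \<le> (1/2)^n + d n x" by simp
      moreover have "0 \<le> c" by (simp add: c_def)
      ultimately show "norm (f (Suc n) x - f n x) \<le> (1/2)^n + d n x"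
        unfolding c_def by linarith
    qed
    then have "convergent (\<lambda>n. \<Sum>k<n. f (Suc k) x - f k x)"
      by (simp add: summable_iff_convergent)
    then have "convergent (\<lambda>n. (f n x - f 0 x) + f 0 x)"
      unfolding sum_lessThan_telescope[of "\<lambda>k. f k x"] by (intro convergent_add convergent_const)
    then show ?case by (simp add: f_def)
  qed
qed

text \<open>The pointwise limit is the limit in norm, by the lemma of Fatou.\<close>

lemma L2_fast_Cauchy_convergent:
  fixes X :: "nat \<Rightarrow> 'a::euclidean_space L2"
  assumes fast: "\<And>n. norm (X (Suc n) - X n) \<le> (1/2)^n" and C: "Cauchy X"
  shows "convergent X"
proof -
  define f where "f n = rep_L2 (X n)" for n
  have sqf: "sq_integrable (f n)" for n by (simp add: f_def)
  have [measurable]: "f n \<in> borel_measurable lebesgue" for n using sqf by blast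
  define F where "F x = lim (\<lambda>n. f n x)" for x
  have F: "AE x in lebesgue. (\<lambda>n. f n x) \<longlonglongrightarrow> F x"
    using L2_fast_Cauchy_AE_convergent[OF fast]
    by eventually_elim (simp add: F_def f_def convergent_LIMSEQ_iff)
  have [measurable]: "F \<in> borel_measurable lebesgue"
    unfolding F_def by (intro borel_measurable_lim_metric) measurable
  have key: "sq_integrable (\<lambda>x. F x - f n x) \<and> norm (abs_L2 (\<lambda>x. F x - f n x)) \<le> e"
    if "e > 0" and N: "\<And>m. m \<ge> N \<Longrightarrow> norm (X m - X n) \<le> e" for e n N
  proof -
    have "(\<integral>\<^sup>+x. ennreal ((cmod (F x - f n x))\<^sup>2) \<partial>lebesgue)
        = (\<integral>\<^sup>+x. liminf (\<lambda>m. ennreal ((cmod (f m x - f n x))\<^sup>2)) \<partial>lebesgue)"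
    proof (intro nn_integral_cong_AE, use F in eventually_elim)
      case (elim x)
      have "(\<lambda>m. ennreal ((cmod (f m x - f n x))\<^sup>2)) \<longlonglongrightarrow> ennreal ((cmod (F x - f n x))\<^sup>2)"
        by (intro tendsto_intros elim)
      then show ?case using lim_imp_Liminf trivial_limit_sequentially by metis
    qed
    also have "\<dots> \<le> liminf (\<lambda>m. \<integral>\<^sup>+x. ennreal ((cmod (f m x - f n x))\<^sup>2) \<partial>lebesgue)"
      by (intro nn_integral_liminf) measurable
    also have "\<dots> \<le> liminf (\<lambda>m::nat. ennreal (e\<^sup>2))"
    proof (intro Liminf_mono eventually_sequentiallyI[of N])
      fix m assume "N \<le> m"
      have sq: "sq_integrable (\<lambda>x. f m x - f n x)" by (intro sq_integrable_diff sqf)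
      have "X m - X n = abs_L2 (\<lambda>x. f m x - f n x)"
        by (simp add: abs_L2_diff[OF sqf sqf, symmetric]) (simp add: f_def)
      then have "(LINT x|lebesgue. (cmod (f m x - f n x))\<^sup>2) \<le> e\<^sup>2"
        using norm_abs_L2_sq[OF sq] power_mono[OF N[OF \<open>N \<le> m\<close>], of 2] by simp
      then show "(\<integral>\<^sup>+x. ennreal ((cmod (f m x - f n x))\<^sup>2) \<partial>lebesgue) \<le> ennreal (e\<^sup>2)"
        using sq by (subst nn_integral_eq_integral) (auto intro!: ennreal_leI)
    qed
    also have "\<dots> = ennreal (e\<^sup>2)" by (intro Liminf_const) simp
    finally have le: "(\<integral>\<^sup>+x. ennreal ((cmod (F x - f n x))\<^sup>2) \<partial>lebesgue) \<le> ennreal (e\<^sup>2)" .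
    have sq: "sq_integrable (\<lambda>x. F x - f n x)"
      unfolding sq_integrable_def
    proof (intro conjI integrableI_nonneg)
      show "(\<integral>\<^sup>+x. ennreal ((cmod (F x - f n x))\<^sup>2) \<partial>lebesgue) < \<infinity>"
        using le by (rule order_le_less_trans) simp
    qed (auto, measurable)
    have "ennreal ((norm (abs_L2 (\<lambda>x. F x - f n x)))\<^sup>2) \<le> ennreal (e\<^sup>2)"
      using le unfolding norm_abs_L2_sq[OF sq]
      using sq by (subst (asm) nn_integral_eq_integral) auto
    then have "(norm (abs_L2 (\<lambda>x. F x - f n x)))\<^sup>2 \<le> e\<^sup>2"
      by (simp add: ennreal_le_iff)
    then show ?thesis using sq that(1) by (auto intro: power2_le_imp_le)
  qed
  have cau: "\<exists>N. \<forall>m\<ge>N. \<forall>n\<ge>N. norm (X m - X n) \<le> e" if "e > 0" for e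
    using C that unfolding Cauchy_def dist_norm by (meson less_imp_le)
  obtain N1 where "\<forall>m\<ge>N1. \<forall>n\<ge>N1. norm (X m - X n) \<le> 1" using cau[of 1] by auto
  then have "sq_integrable (\<lambda>x. F x - f N1 x)" using key[of 1 N1 N1] by auto
  from sq_integrable_add[OF this sqf[of N1]] have sqF: "sq_integrable F" by simp
  have "X \<longlonglongrightarrow> abs_L2 F"
  proof (rule LIMSEQ_I)
    fix r :: real assume "r > 0"
    then obtain N where N: "\<forall>m\<ge>N. \<forall>n\<ge>N. norm (X m - X n) \<le> r / 2" using cau[of "r/2"] by auto
    have "norm (X n - abs_L2 F) < r" if "n \<ge> N" for n
    proof -
      have "abs_L2 F - X n = abs_L2 (\<lambda>x. F x - f n x)"
        by (simp add: abs_L2_diff[OF sqF sqf, symmetric]) (simp add: f_def)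
      then have "norm (abs_L2 F - X n) \<le> r / 2" using key[of "r/2" N n] N that \<open>r > 0\<close> by auto
      then show ?thesis using \<open>r > 0\<close> by (simp add: norm_minus_commute)
    qed
    then show "\<exists>no. \<forall>n\<ge>no. norm (X n - abs_L2 F) < r" by blast
  qed
  then show ?thesis by (rule convergentI)
qed

instance L2 :: (euclidean_space) complete_space
proof
  fix X :: "nat \<Rightarrow> 'a L2"
  assume C: "Cauchy X"
  have "\<exists>N. \<forall>m\<ge>N. \<forall>n\<ge>N. norm (X m - X n) < (1/2)^k" for k
    using C unfolding Cauchy_def dist_norm by simp
  then obtain N where N: "\<And>k m n. m \<ge> N k \<Longrightarrow> n \<ge> N k \<Longrightarrow> norm (X m - X n) < (1/2)^k" by metis
  \<comment> \<open>A strictly increasing sequence of indices with \<open>r k \<ge> N k\<close>.\<close>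
  define r where "r k = k + (\<Sum>i\<le>k. N i)" for k
  have r: "strict_mono r" by (rule strict_mono_Suc_iff[THEN iffD2]) (simp add: r_def)
  have rN: "N k \<le> r k" for k
    using member_le_sum[of k "{..k}" N] by (simp add: r_def)
  have "norm ((X \<circ> r) (Suc k) - (X \<circ> r) k) \<le> (1/2)^k" for k
    using N[of k "r (Suc k)" "r k"] rN[of k] strict_monoD[OF r, of k "Suc k"] by simp
  moreover have "Cauchy (X \<circ> r)" using C r by (rule Cauchy_subseq_Cauchy)
  ultimately have "convergent (X \<circ> r)" by (rule L2_fast_Cauchy_convergent)
  then obtain l where "(X \<circ> r) \<longlonglongrightarrow> l" by (auto simp: convergent_def)
  then have "X \<longlonglongrightarrow> l" by (rule Cauchy_converges_subseq[OF C r])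
  then show "convergent X" by (rule convergentI)
qed


subsection \<open>Dense subspaces\<close>

text \<open>A minimising sequence for the distance of \<open>f\<close> to \<open>S\<close> is a Cauchy sequence by the parallelogram
  identity, and the difference of \<open>f\<close> and its limit is orthogonal to \<open>S\<close>.\<close>

lemma subspace_dense_if_orthogonal_trivial:
  fixes S :: "'h::{real_inner, complete_space} set"
  assumes S: "subspace S" and orth: "\<And>w. (\<And>s. s \<in> S \<Longrightarrow> inner w s = 0) \<Longrightarrow> w = 0"
  shows "f \<in> closure S"
proof -
  define d where "d = (INF s\<in>S. norm (f - s))"
  have bdd: "bdd_below ((\<lambda>s. norm (f - s)) ` S)" by (rule bdd_belowI[of _ 0]) auto
  have ne: "S \<noteq> {}" using S subspace_0 by blast
  have d_le: "d \<le> norm (f - s)" if "s \<in> S" for s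
    unfolding d_def using bdd that by (rule cINF_lower)
  have d0: "0 \<le> d" unfolding d_def using ne by (intro cINF_greatest) auto
  have "\<exists>s\<in>S. norm (f - s) < d + inverse (real (Suc n))" for n
    using cINF_less_iff[OF ne bdd, of "d + inverse (real (Suc n))"] by (auto simp: d_def)
  then obtain s where s: "\<And>n. s n \<in> S" "\<And>n. norm (f - s n) < d + inverse (real (Suc n))" by metis
  have lim_n: "(\<lambda>n. norm (f - s n)) \<longlonglongrightarrow> d"
  proof (rule tendsto_sandwich[OF _ _ tendsto_const])
    show "\<forall>\<^sub>F n in sequentially. d \<le> norm (f - s n)" using d_le s by auto
    show "\<forall>\<^sub>F n in sequentially. norm (f - s n) \<le> d + inverse (real (Suc n))"
      using s(2) by (intro always_eventually allI less_imp_le)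
    show "(\<lambda>n. d + inverse (real (Suc n))) \<longlonglongrightarrow> d"
      using tendsto_add[OF tendsto_const LIMSEQ_inverse_real_of_nat, of d] by simp
  qed
  have par: "(norm (s m - s n))\<^sup>2 \<le> 2 * ((norm (f - s m))\<^sup>2 - d\<^sup>2) + 2 * ((norm (f - s n))\<^sup>2 - d\<^sup>2)" for m n
  proof -
    have "(1/2) *\<^sub>R (s m + s n) \<in> S" using S s by (intro subspace_scale subspace_add)
    from power_mono[OF d_le[OF this] d0, of 2]
    have "4 * d\<^sup>2 \<le> 4 * (norm (f - (1/2) *\<^sub>R (s m + s n)))\<^sup>2" by simp
    also have "\<dots> = 2 * (norm (f - s m))\<^sup>2 + 2 * (norm (f - s n))\<^sup>2 - (norm (s m - s n))\<^sup>2"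
      unfolding power2_norm_eq_inner
      by (simp add: algebra_simps inner_diff_left inner_diff_right inner_add_left inner_add_right inner_commute)
    finally show ?thesis by simp
  qed
  have "Cauchy s"
  proof (rule metric_CauchyI)
    fix e :: real assume "e > 0"
    have "(\<lambda>n. (norm (f - s n))\<^sup>2 - d\<^sup>2) \<longlonglongrightarrow> d\<^sup>2 - d\<^sup>2"
      by (intro tendsto_intros lim_n)
    then have "\<forall>\<^sub>F n in sequentially. (norm (f - s n))\<^sup>2 - d\<^sup>2 < e\<^sup>2 / 4"
      using \<open>e > 0\<close> by (intro order_tendstoD) auto
    then obtain N where N: "\<And>n. n \<ge> N \<Longrightarrow> (norm (f - s n))\<^sup>2 - d\<^sup>2 < e\<^sup>2 / 4"
      by (auto simp: eventually_sequentially)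
    have "dist (s m) (s n) < e" if "m \<ge> N" "n \<ge> N" for m n
    proof -
      have "(norm (s m - s n))\<^sup>2 < e\<^sup>2" using par[of m n] N[OF that(1)] N[OF that(2)] by argo
      then show ?thesis using \<open>e > 0\<close> by (auto simp: dist_norm intro: power2_less_imp_less)
    qed
    then show "\<exists>M. \<forall>m\<ge>M. \<forall>n\<ge>M. dist (s m) (s n) < e" by blast
  qed
  then obtain p where p: "s \<longlonglongrightarrow> p" by (auto simp: Cauchy_convergent_iff convergent_def)
  have "norm (f - p) = d"
    using LIMSEQ_unique[OF lim_n tendsto_norm[OF tendsto_diff[OF tendsto_const p]]] by simp
  have "inner (f - p) v = 0" if "v \<in> S" for v
  proof -
    have ge: "(norm (f - p))\<^sup>2 \<le> (norm (f - p - t *\<^sub>R v))\<^sup>2" for t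
    proof -
      have "d \<le> norm (f - s n - t *\<^sub>R v)" for n
      proof -
        have "s n + t *\<^sub>R v \<in> S" using S s that by (intro subspace_add subspace_scale)
        from d_le[OF this] show ?thesis by (simp add: algebra_simps)
      qed
      then have "d \<le> norm (f - p - t *\<^sub>R v)"
        by (intro LIMSEQ_le_const[OF tendsto_norm[OF tendsto_diff[OF tendsto_diff[OF tendsto_const p] tendsto_const]]]) auto
      then show ?thesis using \<open>norm (f - p) = d\<close> d0 by (simp add: power_mono)
    qed
    define w where "w = f - p"
    have q: "0 \<le> t * (t * inner v v) - 2 * (t * inner w v)" for t
    proof -
      have "(norm (w - t *\<^sub>R v))\<^sup>2 = (norm w)\<^sup>2 + (t * (t * inner v v) - 2 * (t * inner w v))"
        unfolding power2_norm_eq_inner by (simp add: inner_diff_left inner_diff_right inner_commute)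
      then show ?thesis using ge[of t] unfolding w_def by simp
    qed
    show ?thesis
    proof (cases "v = 0")
      case False
      then have pos: "inner v v > 0" by simp
      \<comment> \<open>This \<open>t\<close> minimises the quadratic polynomial in \<open>q\<close>.\<close>
      define t where "t = inner w v / inner v v"
      have t: "t * inner v v = inner w v" using pos by (simp add: t_def)
      have "t * inner w v \<le> 0" using q[of t] unfolding t by simp
      moreover have "t * inner w v = (inner w v)\<^sup>2 / inner v v" by (simp add: t_def power2_eq_square)
      ultimately have "(inner w v)\<^sup>2 \<le> 0" using pos by (simp add: divide_le_0_iff)
      then show ?thesis by (simp add: w_def)
    qed simp
  qed
  then have "f - p = 0" by (rule orth)
  then show ?thesis using p s(1) by (auto simp: closure_sequential)
qed


section \<open>Translations\<close>

lemma
  fixes h :: "'a::euclidean_space"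
  shows lebesgue_shift_measurable: "(\<lambda>x. x + h) \<in> lebesgue \<rightarrow>\<^sub>M lebesgue"
    and lebesgue_shift_distr: "distr lebesgue lebesgue (\<lambda>x. x + h) = lebesgue"
proof -
  have T: "(\<lambda>x. h + (\<Sum>j\<in>Basis. (1 * (x \<bullet> j)) *\<^sub>R j)) = (\<lambda>x. x + h)"
    by (simp add: euclidean_representation add.commute)
  show "(\<lambda>x. x + h) \<in> lebesgue \<rightarrow>\<^sub>M lebesgue"
    using lebesgue_affine_measurable[of "\<lambda>_. 1" h] unfolding T by simp
  show "distr lebesgue lebesgue (\<lambda>x. x + h) = lebesgue"
    using lebesgue_affine_euclidean[of "\<lambda>_. 1" h] unfolding T by (simp add: density_1)
qed

lemma AE_lebesgue_shift:
  assumes "AE x in lebesgue. P x" shows "AE x in lebesgue. P (x + h)"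
proof (rule AE_distrD[OF lebesgue_shift_measurable])
  show "AE x in distr lebesgue lebesgue (\<lambda>x. x + h). P x" unfolding lebesgue_shift_distr by fact
qed

lemma measurable_lebesgue_shift:
  "f \<in> borel_measurable lebesgue \<Longrightarrow> (\<lambda>x. f (x + h)) \<in> borel_measurable lebesgue"
  using measurable_compose[OF lebesgue_shift_measurable] by blast

lemma integral_lebesgue_shift:
  fixes f :: "'a::euclidean_space \<Rightarrow> 'b::{banach, second_countable_topology}"
  assumes "f \<in> borel_measurable lebesgue"
  shows "(LINT x|lebesgue. f (x + h)) = (LINT x|lebesgue. f x)"
  using integral_distr[OF lebesgue_shift_measurable assms, of h] by (simp add: lebesgue_shift_distr)

lemma integrable_lebesgue_shift:
  fixes f :: "'a::euclidean_space \<Rightarrow> 'b::{banach, second_countable_topology}"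
  assumes "integrable lebesgue f"
  shows "integrable lebesgue (\<lambda>x. f (x + h))"
  using integrable_distr[OF lebesgue_shift_measurable, of h f] assms by (simp add: lebesgue_shift_distr)

lemma sq_integrable_shift: "sq_integrable f \<Longrightarrow> sq_integrable (\<lambda>x. f (x + h))"
  unfolding sq_integrable_def
  using integrable_lebesgue_shift[of "\<lambda>x. (cmod (f x))\<^sup>2" h] by (auto intro: measurable_lebesgue_shift)

text \<open>The translate \<open>x \<mapsto> f (x + h)\<close>; it is well defined since translations preserve null sets.\<close>

lift_definition translate :: "'a::euclidean_space \<Rightarrow> 'a L2 \<Rightarrow> 'a L2"
  is "\<lambda>h f x. f (x + h)"
proof -
  fix h and f g :: "'a \<Rightarrow> complex"
  assume fg: "L2_rel f g"
  then have "AE x in lebesgue. f x = g x" by (simp add: L2_rel_def)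
  from AE_lebesgue_shift[OF this, of h] fg show "L2_rel (\<lambda>x. f (x + h)) (\<lambda>x. g (x + h))"
    by (simp add: L2_rel_def sq_integrable_shift)
qed

lemma translate_abs_L2: "sq_integrable f \<Longrightarrow> translate h (abs_L2 f) = abs_L2 (\<lambda>x. f (x + h))"
  by (rule translate.abs_eq) (simp add: L2_rel_refl)

lemma translate_add: "translate h (u + v) = translate h u + translate h v"
  by transfer (auto simp: L2_rel_def sq_integrable_add sq_integrable_shift)

lemma translate_cscale: "translate h (cscale c u) = cscale c (translate h u)"
  by transfer (auto simp: L2_rel_def sq_integrable_cmult sq_integrable_shift)

lemma translate_translate: "translate h (translate k u) = translate (h + k) u"
  by transfer (auto simp: L2_rel_def sq_integrable_shift add.assoc)

lemma translate_0 [simp]: "translate 0 u = u"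
  by transfer (auto simp: L2_rel_def)

lemma cinner_translate: "cinner (translate h u) (translate h v) = cinner u v"
proof transfer
  fix h and f g :: "'a \<Rightarrow> complex"
  assume "L2_rel f f" "L2_rel g g"
  then have "(\<lambda>x. f x * cnj (g x)) \<in> borel_measurable lebesgue"
    by (intro borel_measurable_integrable integrable_mult_cnj) (auto simp: L2_rel_refl)
  from integral_lebesgue_shift[OF this]
  show "(LINT x|lebesgue. f (x + h) * cnj (g (x + h))) = (LINT x|lebesgue. f x * cnj (g x))" .
qed

lemma norm_translate [simp]: "norm (translate h u) = norm u"
proof -
  have "(norm (translate h u))\<^sup>2 = (norm u)\<^sup>2" by (simp add: norm_L2_sq cinner_translate)
  then show ?thesis by (simp add: power2_eq_iff_nonneg)
qed

lemma bounded_linear_translate: "bounded_linear (translate h)"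
  by (rule bounded_linear_intro[where K = 1])
    (auto simp: translate_add translate_cscale scaleR_L2_def)

lemma translate_diff: "translate h (u - v) = translate h u - translate h v"
  by (rule linear_diff[OF bounded_linear.linear[OF bounded_linear_translate]])


section \<open>Differentiation in L2 along translations\<close>

lemma continuous_vanishing_bounded:
  fixes f :: "'a::euclidean_space \<Rightarrow> complex"
  assumes f: "continuous_on UNIV f" and r: "\<And>x. norm x > r \<Longrightarrow> f x = 0"
  obtains K where "K \<ge> 0" "\<And>x. cmod (f x) \<le> K"
proof -
  have "compact (f ` cball 0 r)"
    by (intro compact_continuous_image compact_cball continuous_on_subset[OF f]) auto
  then have "bounded (f ` cball 0 r)" by (rule compact_imp_bounded)
  then obtain K where K: "\<And>x. x \<in> cball 0 r \<Longrightarrow> cmod (f x) \<le> K" unfolding bounded_iff by blast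
  have "cmod (f x) \<le> \<bar>K\<bar>" for x
  proof (cases "norm x > r")
    case False
    then have "x \<in> cball 0 r" by simp
    from K[OF this] show ?thesis by linarith
  qed (simp add: r)
  then show ?thesis using that[of "\<bar>K\<bar>"] by auto
qed

lemma continuous_borel_lebesgue:
  fixes f :: "'a::euclidean_space \<Rightarrow> 'b::topological_space"
  shows "continuous_on UNIV f \<Longrightarrow> f \<in> borel_measurable lebesgue"
  by (intro measurable_completion) (simp add: borel_measurable_continuous_onI)

lemma continuous_vanishing_sq_integrable:
  fixes f :: "'a::euclidean_space \<Rightarrow> complex"
  assumes f: "continuous_on UNIV f" and r: "\<And>x. norm x > r \<Longrightarrow> f x = 0"
  shows "sq_integrable f"
proof -
  obtain K where K: "K \<ge> 0" "\<And>x. cmod (f x) \<le> K" using continuous_vanishing_bounded[OF f r] by blast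
  show ?thesis
    by (rule norm_abs_L2_le(1)[OF continuous_borel_lebesgue[OF f] K(2) lmeasurable_cball _ K(1), of 0 r])
      (simp add: r)
qed

text \<open>\<open>f\<close> is continuous with compact support and has the continuous derivative \<open>f'\<close> in
  direction \<open>b\<close>.\<close>

definition C1c :: "'a::euclidean_space \<Rightarrow> ('a \<Rightarrow> complex) \<Rightarrow> ('a \<Rightarrow> complex) \<Rightarrow> bool"
  where "C1c b f f' \<longleftrightarrow> continuous_on UNIV f \<and> continuous_on UNIV f' \<and>
    (\<forall>x. ((\<lambda>t. f (x + t *\<^sub>R b)) has_vector_derivative f' x) (at 0)) \<and>
    (\<exists>r. \<forall>x. norm x > r \<longrightarrow> f x = 0)"

lemma C1c_deriv:
  assumes "C1c b f f'"
  shows "((\<lambda>t. f (x + t *\<^sub>R b)) has_vector_derivative f' (x + s *\<^sub>R b)) (at s)"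
proof -
  have "((\<lambda>t. f ((x + s *\<^sub>R b) + t *\<^sub>R b)) has_vector_derivative f' (x + s *\<^sub>R b)) (at 0)"
    using assms by (auto simp: C1c_def)
  moreover have "((\<lambda>t. t - s) has_vector_derivative 1) (at s)"
    by (auto intro!: derivative_eq_intros)
  ultimately have "((\<lambda>t. f ((x + s *\<^sub>R b) + t *\<^sub>R b)) \<circ> (\<lambda>t. t - s) has_vector_derivative 1 *\<^sub>R f' (x + s *\<^sub>R b)) (at s)"
    by (intro vector_diff_chain_at) auto
  then show ?thesis by (simp add: o_def algebra_simps)
qed

lemma C1c_support:
  assumes "C1c b f f'"
  obtains r where "r \<ge> 0" "\<And>x. norm x > r \<Longrightarrow> f x = 0" "\<And>x. norm x > r \<Longrightarrow> f' x = 0"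
proof -
  obtain r where r: "\<And>x. norm x > r \<Longrightarrow> f x = 0" using assms by (auto simp: C1c_def)
  have "f' x = 0" if "norm x > r" for x
  proof -
    have op: "open {t. norm (x + t *\<^sub>R b) > r}" by (intro open_Collect_less continuous_intros)
    have "((\<lambda>t. 0) has_vector_derivative 0) (at 0)" by simp
    then have "((\<lambda>t. f (x + t *\<^sub>R b)) has_vector_derivative 0) (at 0)"
      by (rule has_vector_derivative_transform_within_open[OF _ op]) (use that r in auto)
    moreover have "((\<lambda>t. f (x + t *\<^sub>R b)) has_vector_derivative f' x) (at 0)"
      using assms by (auto simp: C1c_def)
    ultimately show ?thesis by (rule vector_derivative_unique_at[symmetric])
  qed
  then show ?thesis using that[of "\<bar>r\<bar>"] r by auto
qed

lemma C1c_sq_integrable: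
  assumes "C1c b f f'" shows "sq_integrable f" "sq_integrable f'"
proof -
  obtain r where r: "\<And>x. norm x > r \<Longrightarrow> f x = 0" "\<And>x. norm x > r \<Longrightarrow> f' x = 0"
    using C1c_support[OF assms] by metis
  show "sq_integrable f"
    by (rule continuous_vanishing_sq_integrable[of _ r]) (use assms r in \<open>auto simp: C1c_def\<close>)
  show "sq_integrable f'"
    by (rule continuous_vanishing_sq_integrable[of _ r]) (use assms r in \<open>auto simp: C1c_def\<close>)
qed

lemma vanishing_uniformly_continuous:
  fixes f :: "'a::euclidean_space \<Rightarrow> complex"
  assumes f: "continuous_on UNIV f" and r: "\<And>x. norm x > r \<Longrightarrow> f x = 0"
  shows "uniformly_continuous_on UNIV f"
  unfolding uniformly_continuous_on_def
proof (intro allI impI)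
  fix e :: real assume "e > 0"
  have "uniformly_continuous_on (cball 0 (r + 1)) f"
    by (intro compact_uniformly_continuous continuous_on_subset[OF f]) auto
  then obtain d where d: "d > 0" "\<And>x y. x \<in> cball 0 (r + 1) \<Longrightarrow> y \<in> cball 0 (r + 1) \<Longrightarrow>
      dist y x < d \<Longrightarrow> dist (f y) (f x) < e"
    using \<open>e > 0\<close> unfolding uniformly_continuous_on_def by metis
  have "dist (f y) (f x) < e" if "dist y x < min d 1" for x y
  proof (cases "x \<in> cball 0 (r + 1) \<and> y \<in> cball 0 (r + 1)")
    case True
    then show ?thesis using d(2)[of x y] that by auto
  next
    case False
    have "\<bar>norm x - norm y\<bar> < 1"
      using that norm_triangle_ineq3[of y x] unfolding dist_norm by linarith
    with False have "norm x > r" "norm y > r" by auto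
    then show ?thesis using r \<open>e > 0\<close> by simp
  qed
  then show "\<exists>d>0. \<forall>x\<in>UNIV. \<forall>y\<in>UNIV. dist y x < d \<longrightarrow> dist (f y) (f x) < e"
    using \<open>d > 0\<close> by (intro exI[of _ "min d 1"]) auto
qed

text \<open>The curve of translates of \<open>f\<close> is differentiable at \<open>0\<close> with respect to the norm of \<open>L\<^sup>2\<close>. The
  mean value theorem and the uniform continuity of \<open>f'\<close> bound the error pointwise, and its support
  stays in a fixed ball.\<close>

lemma C1c_translate_estimate:
  assumes C: "C1c b f f'" and "e > 0"
  obtains d where "d > 0" "\<And>t. \<bar>t\<bar> < d \<Longrightarrow>
    norm (translate (t *\<^sub>R b) (abs_L2 f) - abs_L2 f - t *\<^sub>R abs_L2 f') \<le> e * \<bar>t\<bar>"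
proof -
  obtain r where r: "r \<ge> 0" "\<And>x. norm x > r \<Longrightarrow> f x = 0" "\<And>x. norm x > r \<Longrightarrow> f' x = 0"
    using C1c_support[OF C] by metis
  note sq = C1c_sq_integrable[OF C]
  have cont: "continuous_on UNIV f" "continuous_on UNIV f'" using C by (auto simp: C1c_def)
  \<comment> \<open>For \<open>|t| \<le> 1\<close> the translate of \<open>f\<close> by \<open>t b\<close> vanishes outside \<open>S\<close>.\<close>
  define S :: "'a set" where "S = cball 0 (r + norm b)"
  define M where "M = sqrt (measure lebesgue S)"
  have "M \<ge> 0" by (simp add: M_def)
  define e' where "e' = e / (M + 1)"
  have "e' > 0" "e' * M \<le> e" using \<open>e > 0\<close> \<open>M \<ge> 0\<close> by (auto simp: e'_def field_simps)
  obtain d where d: "d > 0" "\<And>x y. dist y x < d \<Longrightarrow> dist (f' y) (f' x) < e'"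
    using vanishing_uniformly_continuous[OF cont(2) r(3)] \<open>e' > 0\<close>
    unfolding uniformly_continuous_on_def by (metis UNIV_I)
  define d' where "d' = min 1 (d / (norm b + 1))"
  have "d' > 0" using \<open>d > 0\<close> by (simp add: d'_def add_nonneg_pos)
  moreover have "norm (translate (t *\<^sub>R b) (abs_L2 f) - abs_L2 f - t *\<^sub>R abs_L2 f') \<le> e * \<bar>t\<bar>"
    if t: "\<bar>t\<bar> < d'" for t
  proof -
    have t1: "\<bar>t\<bar> \<le> 1" using t by (simp add: d'_def)
    have "\<bar>t\<bar> < d / (norm b + 1)" using t by (simp add: d'_def)
    moreover have "norm b + 1 > 0" using norm_ge_zero[of b] by linarith
    ultimately have "\<bar>t\<bar> * (norm b + 1) < d" by (simp only: pos_less_divide_eq)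
    then have tb: "\<bar>t\<bar> * norm b < d" using norm_ge_zero[of b] by (simp add: distrib_left)
    define g where "g x = f (x + t *\<^sub>R b) - f x - of_real t * f' x" for x
    have sqt: "sq_integrable (\<lambda>x. f (x + t *\<^sub>R b))" using sq by (intro sq_integrable_shift)
    have "translate (t *\<^sub>R b) (abs_L2 f) - abs_L2 f - t *\<^sub>R abs_L2 f' = abs_L2 g"
      unfolding g_def using sq sqt
      by (simp add: translate_abs_L2 abs_L2_diff abs_L2_scaleR sq_integrable_diff sq_integrable_cmult)
    moreover have "norm (abs_L2 g) \<le> (\<bar>t\<bar> * e') * sqrt (measure lebesgue S)"
    proof (rule norm_abs_L2_le(2))
      show "g \<in> borel_measurable lebesgue"
        unfolding g_def
        by (intro continuous_borel_lebesgue continuous_intros continuous_on_compose2[OF cont(1)] cont) auto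
      show "S \<in> lmeasurable" by (simp add: S_def)
      show "0 \<le> \<bar>t\<bar> * e'" using \<open>e' > 0\<close> by simp
      show "g x = 0" if "x \<notin> S" for x
      proof -
        have nx: "norm x > r + norm b" using that by (simp add: S_def)
        have "norm (t *\<^sub>R b) \<le> norm b" using t1 by (simp add: mult_left_le_one_le)
        then have "norm (x + t *\<^sub>R b) > r" using nx norm_diff_ineq[of x "t *\<^sub>R b"] by linarith
        moreover have "norm x > r" using nx norm_ge_zero[of b] by linarith
        ultimately show ?thesis using r by (simp add: g_def)
      qed
      show "cmod (g x) \<le> \<bar>t\<bar> * e'" for x
      proof -
        have "norm (f (x + t *\<^sub>R b) - f (x + 0 *\<^sub>R b) - (t - 0) *\<^sub>R f' (x + 0 *\<^sub>R b)) \<le> norm (t - 0) * e'"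
        proof (rule vector_differentiable_bound_linearization[where S = "closed_segment 0 t"])
          fix s assume s: "s \<in> closed_segment 0 t"
          show "((\<lambda>t. f (x + t *\<^sub>R b)) has_vector_derivative f' (x + s *\<^sub>R b)) (at s within closed_segment 0 t)"
            by (rule has_vector_derivative_at_within[OF C1c_deriv[OF C]])
          have "\<bar>s\<bar> \<le> \<bar>t\<bar>" using s by (auto simp: closed_segment_eq_real_ivl split: if_splits)
          then have "\<bar>s\<bar> * norm b < d" using tb mult_right_mono[of "\<bar>s\<bar>" "\<bar>t\<bar>" "norm b"] by simp
          then show "norm (f' (x + s *\<^sub>R b) - f' (x + 0 *\<^sub>R b)) \<le> e'"
            using d(2)[of "x + s *\<^sub>R b" x] by (simp add: dist_norm)
        qed auto
        then show ?thesis by (simp add: g_def scaleR_conv_of_real)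
      qed
    qed
    moreover have "(\<bar>t\<bar> * e') * sqrt (measure lebesgue S) \<le> e * \<bar>t\<bar>"
      using mult_left_mono[OF \<open>e' * M \<le> e\<close>, of "\<bar>t\<bar>"] by (simp add: M_def mult_ac)
    ultimately show ?thesis by simp
  qed
  ultimately show ?thesis using that by blast
qed

lemma C1c_translate_has_vector_derivative:
  assumes C: "C1c b f f'"
  shows "((\<lambda>t. translate (t *\<^sub>R b) (abs_L2 f)) has_vector_derivative translate (s *\<^sub>R b) (abs_L2 f')) (at s)"
  unfolding has_vector_derivative_def has_derivative_at_alt
proof (intro conjI allI impI)
  show "bounded_linear (\<lambda>x. x *\<^sub>R translate (s *\<^sub>R b) (abs_L2 f'))"
    by (rule bounded_linear_scaleR_left)
  fix e :: real assume "e > 0"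
  then obtain d where d: "d > 0" "\<And>t. \<bar>t\<bar> < d \<Longrightarrow>
    norm (translate (t *\<^sub>R b) (abs_L2 f) - abs_L2 f - t *\<^sub>R abs_L2 f') \<le> e * \<bar>t\<bar>"
    using C1c_translate_estimate[OF C] by metis
  have "norm (translate (y *\<^sub>R b) (abs_L2 f) - translate (s *\<^sub>R b) (abs_L2 f) - (y - s) *\<^sub>R translate (s *\<^sub>R b) (abs_L2 f'))
      \<le> e * norm (y - s)" if "norm (y - s) < d" for y
  proof -
    have "translate (y *\<^sub>R b) (abs_L2 f) = translate (s *\<^sub>R b) (translate ((y - s) *\<^sub>R b) (abs_L2 f))"
      by (simp add: translate_translate algebra_simps)
    then have "translate (y *\<^sub>R b) (abs_L2 f) - translate (s *\<^sub>R b) (abs_L2 f) - (y - s) *\<^sub>R translate (s *\<^sub>R b) (abs_L2 f')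
      = translate (s *\<^sub>R b) (translate ((y - s) *\<^sub>R b) (abs_L2 f) - abs_L2 f - (y - s) *\<^sub>R abs_L2 f')"
      by (simp add: translate_diff linear_scale[OF bounded_linear.linear[OF bounded_linear_translate]])
    then show ?thesis using d(2)[of "y - s"] that by simp
  qed
  then show "\<exists>d>0. \<forall>y. norm (y - s) < d \<longrightarrow>
      norm (translate (y *\<^sub>R b) (abs_L2 f) - translate (s *\<^sub>R b) (abs_L2 f) - (y - s) *\<^sub>R translate (s *\<^sub>R b) (abs_L2 f'))
        \<le> e * norm (y - s)"
    using \<open>d > 0\<close> by blast
qed

text \<open>Integration by parts: the inner product of two functions is invariant under simultaneous
  translation, so its derivative vanishes.\<close>

lemma C1c_integration_by_parts:
  assumes f: "C1c b f f'" and g: "C1c b g g'"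
  shows "cinner (abs_L2 f') (abs_L2 g) = - cinner (abs_L2 f) (abs_L2 g')"
proof -
  have "((\<lambda>t. cinner (translate (t *\<^sub>R b) (abs_L2 f)) (translate (t *\<^sub>R b) (abs_L2 g))) has_vector_derivative
      cinner (translate (0 *\<^sub>R b) (abs_L2 f)) (translate (0 *\<^sub>R b) (abs_L2 g')) +
      cinner (translate (0 *\<^sub>R b) (abs_L2 f')) (translate (0 *\<^sub>R b) (abs_L2 g))) (at 0)"
    by (rule bounded_bilinear.has_vector_derivative[OF bounded_bilinear_cinner
          C1c_translate_has_vector_derivative[OF f] C1c_translate_has_vector_derivative[OF g]])
  then have "((\<lambda>t::real. cinner (abs_L2 f) (abs_L2 g)) has_vector_derivative
      cinner (abs_L2 f) (abs_L2 g') + cinner (abs_L2 f') (abs_L2 g)) (at 0)"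
    by (simp add: cinner_translate)
  from vector_derivative_unique_at[OF this has_vector_derivative_const] show ?thesis
    by (simp add: eq_neg_iff_add_eq_0 add.commute)
qed


section \<open>Weak derivatives\<close>

lemma test_function_C1c:
  fixes b :: "'a::euclidean_space"
  assumes \<phi>: "\<phi> \<in> test_functions" and b: "b \<in> Basis"
  shows "C1c b \<phi> (partial_deriv b \<phi>)"
proof -
  have smooth: "\<And>bs. bs \<in> lists Basis \<Longrightarrow> fold partial_deriv bs \<phi> differentiable_on UNIV"
    and cpt: "compact (closure {x. \<phi> x \<noteq> 0})" using \<phi> by (auto simp: test_functions_def)
  have d0: "\<phi> differentiable_on UNIV" using smooth[of "[]"] by simp
  have d1: "partial_deriv b \<phi> differentiable_on UNIV" using smooth[of "[b]"] b by simp
  have "bounded {x. \<phi> x \<noteq> 0}" using compact_imp_bounded[OF cpt] bounded_subset closure_subset by blast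
  then obtain r where r: "\<And>x. \<phi> x \<noteq> 0 \<Longrightarrow> norm x \<le> r" by (auto simp: bounded_iff)
  have supp: "\<exists>r. \<forall>x. norm x > r \<longrightarrow> \<phi> x = 0" using r by (meson not_le)
  have "((\<lambda>t. \<phi> (x + t *\<^sub>R b)) has_vector_derivative partial_deriv b \<phi> x) (at 0)" for x
  proof -
    have "\<phi> differentiable (at (x + 0 *\<^sub>R b))" using d0 by (simp add: differentiable_on_def)
    then obtain D where "(\<phi> has_derivative D) (at (x + 0 *\<^sub>R b))" unfolding differentiable_def by blast
    moreover have "((\<lambda>t. x + t *\<^sub>R b) has_derivative (\<lambda>t. t *\<^sub>R b)) (at 0)"
      by (auto intro!: derivative_eq_intros)
    ultimately have "((\<lambda>t. \<phi> (x + t *\<^sub>R b)) has_derivative (\<lambda>t. D (t *\<^sub>R b))) (at 0)"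
      by (rule has_derivative_compose[rotated])
    then have "(\<lambda>t. \<phi> (x + t *\<^sub>R b)) differentiable (at 0)" unfolding differentiable_def by blast
    then show ?thesis unfolding partial_deriv_def by (simp add: vector_derivative_works)
  qed
  then show ?thesis
    unfolding C1c_def using supp differentiable_imp_continuous_on[OF d0] differentiable_imp_continuous_on[OF d1]
    by simp
qed

lemma C1c_cnj: "C1c b f f' \<Longrightarrow> C1c b (\<lambda>x. cnj (f x)) (\<lambda>x. cnj (f' x))"
  unfolding C1c_def by (auto intro: has_vector_derivative_cnj continuous_on_cnj)

lemma pf_C1c: "bumps g \<Longrightarrow> b \<in> Basis \<Longrightarrow> C1c b (bprod g) (bprod (dfac b g))"
  unfolding C1c_def
  using bprod_continuous[of g] bprod_continuous[OF bumps_dfac, of b g] bprod_has_partial[of g b] bprod_support[of g]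
  by (metis bumps_dfac)

lemma cinner_abs_L2_right:
  assumes "sq_integrable g"
  shows "cinner u (abs_L2 g) = (LINT x|lebesgue. rep_L2 u x * cnj (g x))"
  using cinner_abs_L2[OF sq_integrable_rep[of u] assms] by simp

text \<open>The defining pairing is bilinear, whereas the inner product is antilinear in the second argument;
  hence the complex conjugates.\<close>

lemma has_weak_partial_iff:
  assumes b: "b \<in> Basis"
  shows "has_weak_partial b u v \<longleftrightarrow> (\<forall>\<phi>\<in>test_functions.
    cinner u (abs_L2 (\<lambda>x. cnj (partial_deriv b \<phi> x))) = - cinner v (abs_L2 (\<lambda>x. cnj (\<phi> x))))"
proof -
  have "cinner u (abs_L2 (\<lambda>x. cnj (partial_deriv b \<phi> x))) = (LINT x|lebesgue. rep_L2 u x * partial_deriv b \<phi> x)"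
    "cinner v (abs_L2 (\<lambda>x. cnj (\<phi> x))) = (LINT x|lebesgue. rep_L2 v x * \<phi> x)"
    if "\<phi> \<in> test_functions" for \<phi>
    using C1c_sq_integrable[OF C1c_cnj[OF test_function_C1c[OF that b]]]
    by (simp_all add: cinner_abs_L2_right)
  then show ?thesis unfolding has_weak_partial_def by simp
qed

lemma C1c_has_weak_partial:
  "b \<in> Basis \<Longrightarrow> C1c b f f' \<Longrightarrow> has_weak_partial b (abs_L2 f) (abs_L2 f')"
  unfolding has_weak_partial_iff
  using C1c_integration_by_parts[OF _ C1c_cnj[OF test_function_C1c]] by force

lemma has_weak_partial_add:
  "b \<in> Basis \<Longrightarrow> has_weak_partial b u v \<Longrightarrow> has_weak_partial b u' v' \<Longrightarrow> has_weak_partial b (u + u') (v + v')"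
  unfolding has_weak_partial_iff by (simp add: cinner_add_left)

lemma has_weak_partial_cscale:
  "b \<in> Basis \<Longrightarrow> has_weak_partial b u v \<Longrightarrow> has_weak_partial b (cscale c u) (cscale c v)"
  unfolding has_weak_partial_iff by (simp add: cinner_cscale_left)

lemma has_weak_partial_0: "b \<in> Basis \<Longrightarrow> has_weak_partial b 0 0"
  by (simp add: has_weak_partial_iff cinner_zero_left)

text \<open>Weak derivatives are closed operators.\<close>

lemma has_weak_partial_lim:
  assumes "b \<in> Basis" and H: "\<And>n::nat. has_weak_partial b (u n) (v n)"
    and u: "u \<longlonglongrightarrow> u'" and v: "v \<longlonglongrightarrow> v'"
  shows "has_weak_partial b u' v'"
  unfolding has_weak_partial_iff[OF \<open>b \<in> Basis\<close>]
proof
  fix \<phi> :: "'a \<Rightarrow> complex" assume \<phi>: "\<phi> \<in> test_functions"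
  have "(\<lambda>n. cinner (u n) (abs_L2 (\<lambda>x. cnj (partial_deriv b \<phi> x)))) \<longlonglongrightarrow> cinner u' (abs_L2 (\<lambda>x. cnj (partial_deriv b \<phi> x)))"
    by (intro tendsto_cinner u tendsto_const)
  moreover have "(\<lambda>n. - cinner (v n) (abs_L2 (\<lambda>x. cnj (\<phi> x)))) \<longlonglongrightarrow> - cinner v' (abs_L2 (\<lambda>x. cnj (\<phi> x)))"
    by (intro tendsto_minus tendsto_cinner v tendsto_const)
  ultimately show "cinner u' (abs_L2 (\<lambda>x. cnj (partial_deriv b \<phi> x))) = - cinner v' (abs_L2 (\<lambda>x. cnj (\<phi> x)))"
    using H \<phi> unfolding has_weak_partial_iff[OF \<open>b \<in> Basis\<close>] by (intro LIMSEQ_unique) auto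
qed

text \<open>The element of \<open>L\<^sup>2\<close> represented by a product of bump functions.\<close>

definition bump_L2 :: "('a::euclidean_space \<Rightarrow> real \<Rightarrow> real) \<Rightarrow> 'a L2"
  where "bump_L2 g = abs_L2 (bprod g)"

lemma bprod_sq_integrable: "bumps g \<Longrightarrow> sq_integrable (bprod g)"
  using C1c_sq_integrable(1)[OF pf_C1c] nonempty_Basis by blast

lemma has_weak_partial_bump_L2: "b \<in> Basis \<Longrightarrow> bumps g \<Longrightarrow> has_weak_partial b (bump_L2 g) (bump_L2 (dfac b g))"
  unfolding bump_L2_def by (intro C1c_has_weak_partial pf_C1c)

lemma has_weak_partialD:
  assumes "b \<in> Basis" "has_weak_partial b u v" "bumps g"
  shows "cinner u (bump_L2 (dfac b g)) = - cinner v (bump_L2 g)"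
  using assms bprod_test_function[OF assms(3)] unfolding has_weak_partial_iff[OF assms(1)]
  by (force simp: partial_deriv_bprod bump_L2_def)


subsection \<open>The fundamental lemma of the calculus of variations\<close>

lemma sigma_finite_lebesgue: "sigma_finite_measure (lebesgue :: 'a::euclidean_space measure)"
proof
  obtain A :: "'a set set" where "countable A" "A \<subseteq> sets lborel" "\<Union>A = space lborel" "\<forall>a\<in>A. emeasure lborel a \<noteq> \<infinity>"
    using lborel.sigma_finite_countable by blast
  then show "\<exists>A::'a set set. countable A \<and> A \<subseteq> sets lebesgue \<and> \<Union>A = space lebesgue \<and>
      (\<forall>a\<in>A. emeasure lebesgue a \<noteq> \<infinity>)"
    by (intro exI[of _ A]) (auto simp: subset_eq)
qed

text \<open>The boxes form a generator of the Borel sets that is stable under intersections. The total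
  integral is needed for complements.\<close>

lemma integral_box_zero_imp_AE:
  fixes F :: "'a::euclidean_space \<Rightarrow> complex"
  assumes F: "integrable lebesgue F" and total: "(LINT x|lebesgue. F x) = 0"
    and box: "\<And>a b. (LINT x:box a b|lebesgue. F x) = 0"
  shows "AE x in lebesgue. F x = 0"
proof (rule sigma_finite_measure.density_zero[OF sigma_finite_lebesgue F])
  have si: "set_integrable lebesgue A F" if "A \<in> sets lebesgue" for A
    unfolding set_integrable_def using that F by (rule integrable_mult_indicator)
  have stable: "Int_stable (range (\<lambda>(a, b). box a b :: 'a set))"
    by (auto simp: Int_stable_def box_Int_box)
  have sub: "range (\<lambda>(a, b). box a b :: 'a set) \<subseteq> Pow UNIV" by simp
  have sets: "sigma_sets UNIV (range (\<lambda>(a, b). box a b :: 'a set)) = sets borel"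
    by (simp add: borel_eq_box)
  have borel: "(LINT x:A|lebesgue. F x) = 0" if A: "A \<in> sigma_sets UNIV (range (\<lambda>(a, b). box a b :: 'a set))" for A
    using stable sub A
  proof (induction rule: sigma_sets_induct_disjoint)
    case (basic A)
    then show ?case using box by auto
  next
    case empty
    show ?case by (simp add: set_lebesgue_integral_def)
  next
    case (compl A)
    then have m: "A \<in> sets lebesgue" unfolding sets by auto
    have "(LINT x:A \<union> (UNIV - A)|lebesgue. F x) = (LINT x:A|lebesgue. F x) + (LINT x:UNIV - A|lebesgue. F x)"
      using m by (intro set_integral_Un si) auto
    moreover have "(LINT x:A \<union> (UNIV - A)|lebesgue. F x) = 0"
      using total by (simp add: set_lebesgue_integral_def)
    ultimately show ?case using compl by simp
  next
    case (union A)
    then have m: "A i \<in> sets lebesgue" for i unfolding sets by (auto simp: subset_eq)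
    have "(LINT x:(\<Union>i. A i)|lebesgue. F x) = (\<Sum>i. LINT x:A i|lebesgue. F x)"
      using m union(1) by (intro lebesgue_integral_countable_add si) (auto simp: disjoint_family_on_def)
    then show ?case using union by simp
  qed
  fix A :: "'a set" assume "A \<in> sets lebesgue"
  then obtain S N N' where S: "A = S \<union> N" "N \<subseteq> N'" "N' \<in> null_sets lborel" "S \<in> sets lborel"
    by (rule sets_completionE)
  have "AE x in lebesgue. x \<notin> N'" using S(3) by (intro AE_not_in null_sets_completionI)
  then have "AE x in lebesgue. indicator A x *\<^sub>R F x = indicator S x *\<^sub>R F x"
    by eventually_elim (use S in \<open>auto simp: indicator_def\<close>)
  then have "(LINT x:A|lebesgue. F x) = (LINT x:S|lebesgue. F x)"
    unfolding set_lebesgue_integral_def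
    by (intro integral_cong_AE borel_measurable_integrable integrable_mult_indicator F)
       (use \<open>A \<in> sets lebesgue\<close> S in auto)
  also have "\<dots> = 0" using S by (intro borel) (simp add: borel_eq_box)
  finally show "(LINT x:A|lebesgue. F x) = 0" .
qed

lemma L2_set_integrable:
  fixes f :: "'a::euclidean_space \<Rightarrow> complex"
  assumes f: "sq_integrable f" and S: "S \<in> lmeasurable"
  shows "set_integrable lebesgue S f"
  unfolding set_integrable_def
proof (rule Bochner_Integration.integrable_bound)
  have [measurable]: "f \<in> borel_measurable lebesgue" "S \<in> sets lebesgue" using f S by auto
  show "integrable lebesgue (\<lambda>x. indicator S x + (cmod (f x))\<^sup>2)"
    using f S by (intro Bochner_Integration.integrable_add) (auto simp: fmeasurable_def)
  show "(\<lambda>x. indicator S x *\<^sub>R f x) \<in> borel_measurable lebesgue" by measurable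
  have "c \<le> 1 + c\<^sup>2" for c :: real
  proof (cases "c \<le> 1")
    case False
    then have "c * 1 \<le> c * c" by (intro mult_left_mono) auto
    then show ?thesis by (simp add: power2_eq_square)
  qed (simp add: add_increasing2)
  then show "AE x in lebesgue. norm (indicator S x *\<^sub>R f x) \<le> norm (indicator S x + (cmod (f x))\<^sup>2)"
    by (auto intro!: AE_I2 simp: indicator_def)
qed

lemma box_indicator_prod:
  "(\<Prod>c\<in>Basis. if a \<bullet> c < x \<bullet> c \<and> x \<bullet> c < b \<bullet> c then 1 else 0 :: real) = indicator (box a b) x"
  by (auto simp: indicator_def mem_box prod_zero_iff)

text \<open>The indicator function of a box is the pointwise limit of products of bump functions that are
  bounded by it.\<close>

lemma L2_box_integral_zero:
  fixes v :: "'a::euclidean_space L2"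
  assumes v: "\<And>g. bumps g \<Longrightarrow> cinner v (bump_L2 g) = 0"
  shows "(LINT x:box a b|lebesgue. rep_L2 v x) = 0"
proof -
  define f where "f = rep_L2 v"
  have sqf: "sq_integrable f" by (simp add: f_def)
  then have f_meas: "f \<in> borel_measurable lebesgue" by blast
  define g where "g n = (\<lambda>c. ibump (a \<bullet> c) (b \<bullet> c) (real (Suc n)))" for n
  have g: "bumps (g n)" for n by (auto simp: bumps_def g_def intro!: bump1_ibump simp del: of_nat_Suc)
  have bprod_meas: "bprod (g n) \<in> borel_measurable lebesgue" for n
    using bprod_sq_integrable[OF g] by blast
  have bound: "cmod (bprod (g n) x) \<le> indicator (box a b) x" for n x
  proof (cases "x \<in> box a b")
    case True
    have "\<bar>\<Prod>c\<in>Basis. g n c (x \<bullet> c)\<bar> \<le> 1"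
      unfolding abs_prod by (rule prod_le_1) (use ibump_bounds in \<open>auto simp: g_def abs_le_iff simp del: of_nat_Suc\<close>)
    then show ?thesis using True by (simp only: bprod_def norm_of_real) simp
  next
    case False
    then obtain c where c: "c \<in> Basis" "x \<bullet> c \<notin> {a \<bullet> c<..<b \<bullet> c}" by (auto simp: mem_box)
    then have "g n c (x \<bullet> c) = 0" unfolding g_def by (intro ibump_zero) auto
    then have "bprod (g n) x = 0" using c by (auto simp: bprod_def)
    then show ?thesis by simp
  qed
  have "(\<lambda>n. LINT x|lebesgue. f x * bprod (g n) x) \<longlonglongrightarrow> (LINT x|lebesgue. f x * of_real (indicator (box a b) x))"
  proof (rule integral_dominated_convergence)
    have "(\<lambda>x. indicator (box a b) x *\<^sub>R f x) \<in> borel_measurable lebesgue"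
      using L2_set_integrable[OF sqf lmeasurable_box, of a b] unfolding set_integrable_def
      by (rule borel_measurable_integrable)
    then show "(\<lambda>x. f x * of_real (indicator (box a b) x)) \<in> borel_measurable lebesgue"
      by (simp add: scaleR_conv_of_real mult.commute)
    show "(\<lambda>x. f x * bprod (g n) x) \<in> borel_measurable lebesgue" for n
      by (intro borel_measurable_times bprod_meas f_meas)
    show "integrable lebesgue (\<lambda>x. norm (indicator (box a b) x *\<^sub>R f x))"
      using L2_set_integrable[OF sqf lmeasurable_box, of a b]
      unfolding set_integrable_def by (rule integrable_norm)
    show "AE x in lebesgue. (\<lambda>n. f x * bprod (g n) x) \<longlonglongrightarrow> f x * of_real (indicator (box a b) x)"
    proof (intro AE_I2 tendsto_mult tendsto_const)
      fix x
      have "(\<lambda>n. \<Prod>c\<in>Basis. g n c (x \<bullet> c)) \<longlonglongrightarrow>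
          (\<Prod>c\<in>Basis. if a \<bullet> c < x \<bullet> c \<and> x \<bullet> c < b \<bullet> c then 1 else 0)"
        unfolding g_def by (intro tendsto_prod ibump_tendsto)
      then show "(\<lambda>n. bprod (g n) x) \<longlonglongrightarrow> of_real (indicator (box a b) x)"
        unfolding bprod_def box_indicator_prod by (rule tendsto_of_real)
    qed
    show "AE x in lebesgue. norm (f x * bprod (g n) x) \<le> norm (indicator (box a b) x *\<^sub>R f x)" for n
    proof (rule AE_I2)
      fix x
      show "norm (f x * bprod (g n) x) \<le> norm (indicator (box a b) x *\<^sub>R f x)"
        using mult_left_mono[OF bound[of n x] norm_ge_zero[of "f x"]] by (simp add: norm_mult mult.commute)
    qed
  qed
  moreover have "(LINT x|lebesgue. f x * bprod (g n) x) = 0" for n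
    using v[OF g[of n]] unfolding bump_L2_def cinner_abs_L2_right[OF bprod_sq_integrable[OF g]] by (simp add: f_def)
  ultimately have "(LINT x|lebesgue. f x * of_real (indicator (box a b) x)) = 0"
    by (simp add: LIMSEQ_const_iff)
  then show ?thesis
    by (simp add: set_lebesgue_integral_def f_def scaleR_conv_of_real mult.commute)
qed

text \<open>The boxes \<open>B n\<close> serve to reduce the claim to integrable functions.\<close>

lemma L2_eq_0_if_orthogonal_bump_L2:
  fixes v :: "'a::euclidean_space L2"
  assumes v: "\<And>g. bumps g \<Longrightarrow> cinner v (bump_L2 g) = 0"
  shows "v = 0"
proof -
  define B :: "nat \<Rightarrow> 'a set" where "B n = box (- (real n *\<^sub>R One)) (real n *\<^sub>R One)" for n
  have "AE x in lebesgue. indicator (B n) x *\<^sub>R rep_L2 v x = 0" for n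
  proof (rule integral_box_zero_imp_AE)
    show "integrable lebesgue (\<lambda>x. indicator (B n) x *\<^sub>R rep_L2 v x)"
      using L2_set_integrable[OF sq_integrable_rep lmeasurable_box] unfolding set_integrable_def B_def by blast
    show "(LINT x|lebesgue. indicator (B n) x *\<^sub>R rep_L2 v x) = 0"
      using L2_box_integral_zero[OF v] unfolding set_lebesgue_integral_def B_def by blast
    fix a b :: 'a
    obtain c d where cd: "box a b \<inter> B n = box c d" unfolding B_def box_Int_box by blast
    show "(LINT x:box a b|lebesgue. indicator (B n) x *\<^sub>R rep_L2 v x) = 0"
      using L2_box_integral_zero[OF v, of c d]
      unfolding set_lebesgue_integral_def cd[symmetric] by (simp add: indicator_inter_arith)
  qed
  then have "AE x in lebesgue. \<forall>n. indicator (B n) x *\<^sub>R rep_L2 v x = 0"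
    unfolding AE_all_countable by blast
  then have "AE x in lebesgue. rep_L2 v x = 0"
  proof eventually_elim
    case (elim x)
    obtain n where "x \<in> B n" using UN_box_eq_UNIV unfolding B_def by blast
    then show ?case using elim[rule_format, of n] by simp
  qed
  then have "abs_L2 (rep_L2 v) = abs_L2 (\<lambda>x. 0)" by (subst abs_L2_eq_iff) auto
  then show ?thesis by (simp add: zero_L2.abs_eq[symmetric])
qed

lemma has_weak_partial_unique:
  assumes b: "b \<in> Basis" and "has_weak_partial b u v" "has_weak_partial b u v'"
  shows "v = v'"
proof -
  have "v - v' = 0"
  proof (rule L2_eq_0_if_orthogonal_bump_L2)
    fix g :: "'a \<Rightarrow> real \<Rightarrow> real" assume "bumps g"
    then show "cinner (v - v') (bump_L2 g) = 0"
      using has_weak_partialD[OF b assms(2)] has_weak_partialD[OF b assms(3)] by (simp add: cinner_diff_left)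
  qed
  then show ?thesis by simp
qed

lemma weak_partial_eq: "b \<in> Basis \<Longrightarrow> has_weak_partial b u v \<Longrightarrow> weak_partial b u = v"
  unfolding weak_partial_def using has_weak_partial_unique by blast


section \<open>A Liouville theorem\<close>

lemma deriv_shift:
  assumes "smooth1 g" shows "deriv (\<lambda>t. g (t + s)) = (\<lambda>t. deriv g (t + s))"
proof
  fix t
  have "((\<lambda>t. g (t + s)) has_real_derivative deriv g (t + s)) (at t)"
    using smooth1_has_deriv[OF assms, of "t + s"] by (simp add: DERIV_shift)
  then show "deriv (\<lambda>t. g (t + s)) t = deriv g (t + s)" by (rule DERIV_imp_deriv)
qed

lemma dfac_shift:
  assumes "bumps g" "b \<in> Basis"
  shows "dfac b (\<lambda>c t. g c (t + x \<bullet> c)) = (\<lambda>c t. dfac b g c (t + x \<bullet> c))"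
  using assms deriv_shift[of "g b" "x \<bullet> b"] by (auto simp: dfac_def bumps_def bump1_def)

lemma translate_bump_L2: "bumps g \<Longrightarrow> translate x (bump_L2 g) = bump_L2 (\<lambda>b t. g b (t + x \<bullet> b))"
  by (simp add: bump_L2_def translate_abs_L2 bprod_sq_integrable bprod_shift)

text \<open>\<open>v\<close> is the derivative of \<open>u\<close> in direction \<open>b\<close> in the sense that the curve of translates of
  \<open>u\<close> is differentiable in norm.\<close>

definition curve_deriv :: "'a::euclidean_space \<Rightarrow> 'a L2 \<Rightarrow> 'a L2 \<Rightarrow> bool"
  where "curve_deriv b u v \<longleftrightarrow>
    (\<forall>s. ((\<lambda>t. translate (t *\<^sub>R b) u) has_vector_derivative translate (s *\<^sub>R b) v) (at s))"

lemma curve_deriv_bump_L2: "bumps g \<Longrightarrow> b \<in> Basis \<Longrightarrow> curve_deriv b (bump_L2 g) (bump_L2 (dfac b g))"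
  unfolding curve_deriv_def bump_L2_def using C1c_translate_has_vector_derivative[OF pf_C1c] by blast

lemma curve_deriv_add: "curve_deriv b u v \<Longrightarrow> curve_deriv b u' v' \<Longrightarrow> curve_deriv b (u + u') (v + v')"
  unfolding curve_deriv_def translate_add by (auto intro: has_vector_derivative_add)

lemma curve_deriv_cscale: "curve_deriv b u v \<Longrightarrow> curve_deriv b (cscale c u) (cscale c v)"
  unfolding curve_deriv_def translate_cscale
  by (auto intro: bounded_linear.has_vector_derivative[OF bounded_linear_cscale])

lemma TD_0: "curve_deriv b 0 0"
  by (simp add: curve_deriv_def linear_0[OF bounded_linear.linear[OF bounded_linear_translate]])

lemma curve_deriv_shift:
  assumes "curve_deriv b u v"
  shows "((\<lambda>t. translate (x + t *\<^sub>R b) u) has_vector_derivative translate (x + s *\<^sub>R b) v) (at s)"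
  using bounded_linear.has_vector_derivative[OF bounded_linear_translate[of x] assms[unfolded curve_deriv_def, rule_format, of s]]
  by (simp add: translate_translate)

lemma curve_deriv_norm_le:
  assumes "curve_deriv b u v" shows "norm (translate (t *\<^sub>R b) u - u) \<le> \<bar>t\<bar> * norm v"
proof -
  have "norm (translate (t *\<^sub>R b) u - translate (0 *\<^sub>R b) u) \<le> norm v * norm (t - 0)"
  proof (rule differentiable_bound[where S = UNIV])
    fix s
    show "((\<lambda>t. translate (t *\<^sub>R b) u) has_derivative (\<lambda>h. h *\<^sub>R translate (s *\<^sub>R b) v)) (at s within UNIV)"
      using assms by (simp add: curve_deriv_def has_vector_derivative_def)
    show "onorm (\<lambda>h. h *\<^sub>R translate (s *\<^sub>R b) v) \<le> norm v"
      by (rule onorm_le) (simp add: mult.commute)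
  qed auto
  then show ?thesis by (simp add: mult.commute)
qed

text \<open>The translation by \<open>h\<close> is performed coordinate by coordinate.\<close>

lemma translate_diff_norm_le:
  fixes u :: "'a::euclidean_space L2"
  assumes "\<And>c. c \<in> Basis \<Longrightarrow> curve_deriv c u (v c)"
  shows "norm (translate h u - u) \<le> (\<Sum>c\<in>Basis. \<bar>h \<bullet> c\<bar> * norm (v c))"
proof -
  have "norm (translate (\<Sum>c\<in>F. (h \<bullet> c) *\<^sub>R c) u - u) \<le> (\<Sum>c\<in>F. \<bar>h \<bullet> c\<bar> * norm (v c))"
    if "F \<subseteq> Basis" for F
    using finite_subset[OF that finite_Basis] that
  proof (induction F rule: finite_induct)
    case (insert c F)
    define k where "k = (\<Sum>c\<in>F. (h \<bullet> c) *\<^sub>R c)"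
    define a where "a = (h \<bullet> c) *\<^sub>R c"
    have eq: "translate (a + k) u - u = translate a (translate k u - u) + (translate a u - u)"
      by (simp add: translate_diff translate_translate)
    have "norm (translate (a + k) u - u) \<le> norm (translate a (translate k u - u)) + norm (translate a u - u)"
      unfolding eq by (rule norm_triangle_ineq)
    also have "\<dots> \<le> norm (translate k u - u) + \<bar>h \<bullet> c\<bar> * norm (v c)"
      using curve_deriv_norm_le[OF assms, of c "h \<bullet> c"] insert.prems by (simp add: a_def)
    finally have "norm (translate (a + k) u - u) \<le> norm (translate k u - u) + \<bar>h \<bullet> c\<bar> * norm (v c)" .
    then show ?case using insert by (simp add: k_def a_def)
  qed simp
  from this[of Basis] show ?thesis by (simp add: euclidean_representation)
qed

lemma translate_bump_L2_continuous:
  assumes "bumps (g :: 'a::euclidean_space \<Rightarrow> _)" shows "continuous_on UNIV (\<lambda>x. translate x (bump_L2 g))"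
  unfolding continuous_on
proof
  fix x :: 'a
  have "(\<lambda>y. translate y (bump_L2 g) - translate x (bump_L2 g)) \<midarrow>x\<rightarrow> 0"
  proof (rule Lim_null_comparison)
    have "norm (translate y (bump_L2 g) - translate x (bump_L2 g)) \<le> (\<Sum>c\<in>Basis. \<bar>(y - x) \<bullet> c\<bar> * norm (bump_L2 (dfac c g)))" for y
    proof -
      have "translate y (bump_L2 g) - translate x (bump_L2 g) = translate x (translate (y - x) (bump_L2 g) - bump_L2 g)"
        by (simp add: translate_diff translate_translate)
      then show ?thesis using translate_diff_norm_le[OF curve_deriv_bump_L2[OF assms], of "y - x"] by simp
    qed
    then show "\<forall>\<^sub>F y in at x. norm (translate y (bump_L2 g) - translate x (bump_L2 g)) \<le> (\<Sum>c\<in>Basis. \<bar>(y - x) \<bullet> c\<bar> * norm (bump_L2 (dfac c g)))"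
      by simp
    have "((\<lambda>y. \<Sum>c\<in>Basis. \<bar>(y - x) \<bullet> c\<bar> * norm (bump_L2 (dfac c g))) \<longlongrightarrow> (\<Sum>c\<in>Basis. \<bar>(x - x) \<bullet> c\<bar> * norm (bump_L2 (dfac c g)))) (at x)"
      by (intro tendsto_intros)
    then show "((\<lambda>y. \<Sum>c\<in>Basis. \<bar>(y - x) \<bullet> c\<bar> * norm (bump_L2 (dfac c g))) \<longlongrightarrow> 0) (at x)" by simp
  qed
  then show "((\<lambda>x. translate x (bump_L2 g)) \<longlongrightarrow> translate x (bump_L2 g)) (at x within UNIV)"
    by (simp add: LIM_zero_iff)
qed

lemma second_derivative_at_max:
  fixes h h' :: "real \<Rightarrow> real"
  assumes h: "\<And>t. (h has_real_derivative h' t) (at t)" and h': "(h' has_real_derivative c) (at 0)"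
    and max: "\<And>t. h t \<le> h 0"
  shows "c \<le> 0"
proof (rule ccontr)
  assume "\<not> c \<le> 0"
  then obtain d where d: "d > 0" "\<And>t. 0 < t \<Longrightarrow> t < d \<Longrightarrow> h' 0 < h' (0 + t)"
    using DERIV_pos_inc_right[OF h'] by auto
  have "h' 0 = 0" by (rule DERIV_local_max[OF h, of 1]) (use max in auto)
  obtain z where z: "0 < z" "z < d / 2" "h (d / 2) - h 0 = (d / 2 - 0) * h' z"
    using MVT2[of 0 "d / 2" h h'] h \<open>d > 0\<close> by auto
  have "h' z > 0" using d(2)[of z] z \<open>h' 0 = 0\<close> \<open>d > 0\<close> by simp
  then have "(d / 2 - 0) * h' z > 0" using \<open>d > 0\<close> by simp
  then show False using z(3) max[of "d / 2"] by simp
qed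

text \<open>An \<open>L\<^sup>2\<close> solution \<open>u\<close> of \<open>(l - \<Delta>) u = 0\<close> in the sense of distributions vanishes: for a
  bump function \<open>\<phi>\<close>, the function \<open>F x = \<langle>u, \<phi>(\<cdot> + x)\<rangle>\<close> is a bounded classical solution, and the
  maximum principle applies to \<open>F x - d |x|\<^sup>2\<close> with small \<open>d > 0\<close>.\<close>

lemma Liouville_le:
  fixes u :: "'a::euclidean_space L2"
  assumes l: "l > 0"
    and orth: "\<And>g. bumps g \<Longrightarrow> inner u (l *\<^sub>R bump_L2 g - (\<Sum>b\<in>Basis. bump_L2 (dfac b (dfac b g)))) = 0"
    and g: "bumps g"
  shows "inner u (bump_L2 g) \<le> 0"
proof (rule ccontr)
  define F where "F x = inner u (translate x (bump_L2 g))" for x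
  define F1 where "F1 b x = inner u (translate x (bump_L2 (dfac b g)))" for b x
  define F2 where "F2 b x = inner u (translate x (bump_L2 (dfac b (dfac b g))))" for b x
  assume "\<not> inner u (bump_L2 g) \<le> 0"
  then have F0: "F 0 > 0" by (simp add: F_def)
  \<comment> \<open>With this choice, \<open>2 d DIM('a) = l F 0 / 2\<close>, so that the maximum principle yields \<open>l F 0 \<le> l F 0 / 2\<close>.\<close>
  define d where "d = l * F 0 / (4 * DIM('a))"
  have d: "d > 0" using l F0 by (simp add: d_def)
  define M where "M = norm u * norm (bump_L2 g)"
  have M: "F x \<le> M" for x
    using Cauchy_Schwarz_ineq2[of u "translate x (bump_L2 g)"] by (simp add: F_def M_def)
  have "M \<ge> 0" by (simp add: M_def)
  define H where "H x = F x - d * (norm x)\<^sup>2" for x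
  \<comment> \<open>Outside the ball of radius \<open>r\<close> the function \<open>H\<close> is negative.\<close>
  define r where "r = sqrt ((M + 1) / d)"
  have r: "d * r\<^sup>2 = M + 1" "r \<ge> 0" using d \<open>M \<ge> 0\<close> by (simp_all add: r_def)
  have "continuous_on (cball 0 r) H"
    unfolding H_def F_def
    by (intro continuous_intros continuous_on_subset[OF translate_bump_L2_continuous[OF g]]) auto
  then obtain x1 where x1: "x1 \<in> cball 0 r" "\<And>y. y \<in> cball 0 r \<Longrightarrow> H y \<le> H x1"
    using continuous_attains_sup[of "cball 0 r" H] r(2) by (auto simp: cball_eq_empty)
  have H0: "F 0 \<le> H x1" using x1(2)[of 0] r(2) by (simp add: H_def)
  have max: "H y \<le> H x1" for y
  proof (cases "y \<in> cball 0 r")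
    case False
    then have "r\<^sup>2 \<le> (norm y)\<^sup>2" using r(2) by (intro power_mono) auto
    then have "d * r\<^sup>2 \<le> d * (norm y)\<^sup>2" using d by simp
    then have "H y < 0" using M[of y] r(1) by (simp add: H_def)
    then show ?thesis using F0 H0 by linarith
  qed (rule x1(2))
  have F2_le: "F2 b x1 \<le> 2 * d" if b: "b \<in> Basis" for b
  proof -
    have dF: "((\<lambda>t. F (x1 + t *\<^sub>R b)) has_real_derivative F1 b (x1 + s *\<^sub>R b)) (at s)" for s
      unfolding F_def F1_def has_real_derivative_iff_has_vector_derivative
      by (rule bounded_linear.has_vector_derivative[OF bounded_linear_inner_right curve_deriv_shift[OF curve_deriv_bump_L2[OF g b]]])
    have dF1: "((\<lambda>t. F1 b (x1 + t *\<^sub>R b)) has_real_derivative F2 b (x1 + s *\<^sub>R b)) (at s)" for s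
      unfolding F1_def F2_def has_real_derivative_iff_has_vector_derivative
      by (rule bounded_linear.has_vector_derivative[OF bounded_linear_inner_right
            curve_deriv_shift[OF curve_deriv_bump_L2[OF bumps_dfac[OF b g] b]]])
    have nsq: "(norm (x1 + t *\<^sub>R b))\<^sup>2 = (norm x1)\<^sup>2 + 2 * t * (x1 \<bullet> b) + t\<^sup>2" for t
      using b unfolding power2_norm_eq_inner
      by (simp add: inner_add_left inner_add_right inner_commute power2_eq_square)
    have "((\<lambda>t. H (x1 + t *\<^sub>R b)) has_real_derivative F1 b (x1 + s *\<^sub>R b) - d * (2 * (x1 \<bullet> b) + 2 * s)) (at s)" for s
      unfolding H_def nsq by (rule DERIV_diff[OF dF]) (auto intro!: derivative_eq_intros)
    moreover have "((\<lambda>s. F1 b (x1 + s *\<^sub>R b) - d * (2 * (x1 \<bullet> b) + 2 * s)) has_real_derivative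
        F2 b (x1 + 0 *\<^sub>R b) - d * 2) (at 0)"
      by (rule DERIV_diff[OF dF1]) (auto intro!: derivative_eq_intros)
    ultimately have "F2 b (x1 + 0 *\<^sub>R b) - d * 2 \<le> 0"
      by (rule second_derivative_at_max) (simp add: max)
    then show ?thesis by simp
  qed
  have "l * F x1 = (\<Sum>b\<in>Basis. F2 b x1)"
  proof -
    define g' where "g' = (\<lambda>c t. g c (t + x1 \<bullet> c))"
    have "bumps g'" unfolding g'_def by (rule bumps_shift[OF g])
    moreover have "bump_L2 (dfac b (dfac b g')) = translate x1 (bump_L2 (dfac b (dfac b g)))" if "b \<in> Basis" for b
      unfolding g'_def using g that by (simp add: dfac_shift bumps_dfac translate_bump_L2)
    moreover have "bump_L2 g' = translate x1 (bump_L2 g)" unfolding g'_def using g by (simp add: translate_bump_L2)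
    ultimately show ?thesis using orth[of g']
      by (simp add: F_def F2_def inner_diff_right inner_sum_right)
  qed
  also have "\<dots> \<le> (\<Sum>b\<in>(Basis :: 'a set). 2 * d)" by (intro sum_mono F2_le)
  also have "\<dots> = l * F 0 / 2" by (simp add: d_def)
  finally have "l * F x1 \<le> l * F 0 / 2" .
  moreover have "F 0 \<le> F x1"
    using H0 d by (simp add: H_def) (smt (verit) mult_nonneg_nonneg zero_le_power2)
  then have "l * F 0 \<le> l * F x1" using l by simp
  moreover have "l * F 0 > 0" using l F0 by simp
  ultimately show False by linarith
qed

lemma Liouville:
  assumes l: "l > 0"
    and orth: "\<And>g. bumps g \<Longrightarrow> inner u (l *\<^sub>R bump_L2 g - (\<Sum>b\<in>Basis. bump_L2 (dfac b (dfac b g)))) = 0"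
    and g: "bumps g"
  shows "inner u (bump_L2 g) = 0"
  using Liouville_le[OF l orth g] Liouville_le[of l "- u", OF l _ g] orth by force

lemma inner_cscale_left: "inner (cscale c u) v = inner u (cscale (cnj c) v)"
  by (simp add: inner_L2_def cinner_cscale_left cinner_cscale_right)

text \<open>The factor \<open>c\<close> compensates for the real inner product: \<open>c = 1\<close> and \<open>c = \<i>\<close> give the real and
  the imaginary part.\<close>

lemma Liouville_eq_0:
  assumes l: "l > 0"
    and orth: "\<And>c g. bumps g \<Longrightarrow> inner u (cscale c (l *\<^sub>R bump_L2 g - (\<Sum>b\<in>Basis. bump_L2 (dfac b (dfac b g))))) = 0"
  shows "u = 0"
proof (rule L2_eq_0_if_orthogonal_bump_L2)
  fix g :: "'a \<Rightarrow> real \<Rightarrow> real" assume g: "bumps g"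
  have "inner u (bump_L2 g) = 0" by (rule Liouville[OF l _ g]) (use orth[of _ 1] in simp)
  moreover have "inner (cscale (- \<i>) u) (bump_L2 g) = 0"
    by (rule Liouville[OF l _ g]) (use orth[of _ "\<i>"] in \<open>simp add: inner_cscale_left\<close>)
  ultimately show "cinner u (bump_L2 g) = 0"
    by (simp add: cinner_eq_Complex inner_cscale_left zero_complex.code)
qed


section \<open>The core of the Laplacian\<close>

text \<open>The complex span of the products of bump functions, written as the real span of their complex
  multiples.\<close>

definition core :: "'a::euclidean_space L2 set"
  where "core = span {cscale c (bump_L2 g) |c g. bumps g}"

lemma subspace_core: "subspace core" by (simp add: core_def)

lemma core_bump_L2: "bumps g \<Longrightarrow> cscale c (bump_L2 g) \<in> core"
  unfolding core_def by (rule span_base) auto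

lemma core_induct [consumes 1, case_names zero add]:
  assumes "u \<in> core" "P 0" "\<And>c g u. bumps g \<Longrightarrow> u \<in> core \<Longrightarrow> P u \<Longrightarrow> P (cscale c (bump_L2 g) + u)"
  shows "P u"
proof -
  have "u \<in> core \<and> P u"
    using assms(1) unfolding core_def
  proof (induction rule: span_induct_alt)
    case base then show ?case using assms(2) by (simp add: span_zero)
  next
    case (step r x y)
    then obtain c g where x: "x = cscale c (bump_L2 g)" "bumps g" by auto
    have "r *\<^sub>R x = cscale (of_real r * c) (bump_L2 g)" by (simp add: x scaleR_L2_def)
    then show ?case using assms(3)[of g y "of_real r * c"] step x core_bump_L2[of g "of_real r * c"] subspace_core
      by (auto simp: core_def[symmetric] intro: subspace_add)
  qed
  then show ?thesis ..
qed

lemma core_partial_ex: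
  assumes b: "b \<in> Basis" and u: "u \<in> core"
  shows "\<exists>v\<in>core. has_weak_partial b u v \<and> curve_deriv b u v"
  using u
proof (induction rule: core_induct)
  case zero then show ?case
    using has_weak_partial_0[OF b] TD_0 subspace_0[OF subspace_core] by blast
next
  case (add c g u)
  then obtain v where v: "v \<in> core" "has_weak_partial b u v" "curve_deriv b u v" by blast
  have "cscale c (bump_L2 (dfac b g)) + v \<in> core"
    using v(1) core_bump_L2[OF bumps_dfac[OF b add(1)]] subspace_core by (blast intro: subspace_add)
  moreover have "has_weak_partial b (cscale c (bump_L2 g) + u) (cscale c (bump_L2 (dfac b g)) + v)"
    by (intro has_weak_partial_add has_weak_partial_cscale has_weak_partial_bump_L2 b add v)
  moreover have "curve_deriv b (cscale c (bump_L2 g) + u) (cscale c (bump_L2 (dfac b g)) + v)"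
    by (intro curve_deriv_add curve_deriv_cscale curve_deriv_bump_L2 b add v)
  ultimately show ?case by blast
qed

lemma
  assumes b: "b \<in> Basis" and u: "u \<in> core"
  shows core_weak_partial: "has_weak_partial b u (weak_partial b u)"
    and weak_partial_in_core: "weak_partial b u \<in> core"
    and core_curve_deriv: "curve_deriv b u (weak_partial b u)"
  using core_partial_ex[OF b u] weak_partial_eq[OF b] by auto

lemma weak_partial_bump_L2: "b \<in> Basis \<Longrightarrow> bumps g \<Longrightarrow> weak_partial b (bump_L2 g) = bump_L2 (dfac b g)"
  by (intro weak_partial_eq has_weak_partial_bump_L2)

lemma laplacian_bump_L2: "bumps g \<Longrightarrow> laplacian (bump_L2 g) = (\<Sum>b\<in>Basis. bump_L2 (dfac b (dfac b g)))"
  unfolding laplacian_def by (intro sum.cong refl) (simp add: weak_partial_bump_L2 bumps_dfac)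

lemma H2_weak_partial:
  assumes "u \<in> H2" "i \<in> Basis"
  shows "has_weak_partial i u (weak_partial i u)"
    and "j \<in> Basis \<Longrightarrow> has_weak_partial j (weak_partial i u) (weak_partial j (weak_partial i u))"
proof -
  obtain v where v: "has_weak_partial i u v" "\<forall>j\<in>Basis. \<exists>w. has_weak_partial j v w"
    using assms by (auto simp: H2_def)
  have e: "weak_partial i u = v" using weak_partial_eq[OF assms(2) v(1)] .
  show "has_weak_partial i u (weak_partial i u)" using v e by simp
  assume "j \<in> Basis"
  then obtain w where "has_weak_partial j v w" using v by blast
  then show "has_weak_partial j (weak_partial i u) (weak_partial j (weak_partial i u))"
    using weak_partial_eq[OF \<open>j \<in> Basis\<close>] e by metis
qed

lemma core_subset_H2: "core \<subseteq> H2"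
  unfolding H2_def using core_weak_partial weak_partial_in_core by blast

lemma
  assumes u: "u \<in> H2" and v: "v \<in> H2"
  shows H2_add: "u + v \<in> H2"
    and weak_partial_add: "b \<in> Basis \<Longrightarrow> weak_partial b (u + v) = weak_partial b u + weak_partial b v"
    and laplacian_add: "laplacian (u + v) = laplacian u + laplacian v"
proof -
  let ?d = weak_partial
  note H = H2_weak_partial[OF u] H2_weak_partial[OF v]
  have 1: "has_weak_partial i (u + v) (?d i u + ?d i v)" if "i \<in> Basis" for i
    using that H by (intro has_weak_partial_add) auto
  have 2: "has_weak_partial j (?d i u + ?d i v)
      (?d j (?d i u) + ?d j (?d i v))" if "i \<in> Basis" "j \<in> Basis" for i j
    using that H by (intro has_weak_partial_add) auto
  show "u + v \<in> H2" unfolding H2_def using 1 2 by blast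
  show 3: "?d b (u + v) = ?d b u + ?d b v" if "b \<in> Basis" for b
    using that 1 by (intro weak_partial_eq)
  have "?d i (?d i (u + v)) = ?d i (?d i u) + ?d i (?d i v)"
    if "i \<in> Basis" for i
    unfolding 3[OF that] using that 2 by (intro weak_partial_eq)
  then show "laplacian (u + v) = laplacian u + laplacian v"
    by (simp add: laplacian_def sum.distrib)
qed

lemma
  assumes u: "u \<in> H2"
  shows H2_cscale: "cscale c u \<in> H2"
    and weak_partial_cscale: "b \<in> Basis \<Longrightarrow> weak_partial b (cscale c u) = cscale c (weak_partial b u)"
    and laplacian_cscale: "laplacian (cscale c u) = cscale c (laplacian u)"
proof -
  let ?d = weak_partial
  note H = H2_weak_partial[OF u]
  have 1: "has_weak_partial i (cscale c u) (cscale c (?d i u))" if "i \<in> Basis" for i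
    using that H by (intro has_weak_partial_cscale) auto
  have 2: "has_weak_partial j (cscale c (?d i u)) (cscale c (?d j (?d i u)))"
    if "i \<in> Basis" "j \<in> Basis" for i j
    using that H by (intro has_weak_partial_cscale) auto
  show "cscale c u \<in> H2" unfolding H2_def using 1 2 by blast
  show 3: "?d b (cscale c u) = cscale c (?d b u)" if "b \<in> Basis" for b
    using that 1 by (intro weak_partial_eq)
  have "?d i (?d i (cscale c u)) = cscale c (?d i (?d i u))"
    if "i \<in> Basis" for i
    unfolding 3[OF that] using that 2 by (intro weak_partial_eq)
  then show "laplacian (cscale c u) = cscale c (laplacian u)"
    by (simp add: laplacian_def cscale_sum_right)
qed

lemma H2_scaleR: "u \<in> H2 \<Longrightarrow> r *\<^sub>R u \<in> H2" and laplacian_scaleR: "u \<in> H2 \<Longrightarrow> laplacian (r *\<^sub>R u) = r *\<^sub>R laplacian u"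
  by (simp_all add: scaleR_L2_def H2_cscale laplacian_cscale)

lemma H2_uminus: "u \<in> H2 \<Longrightarrow> - u \<in> H2" and laplacian_uminus: "u \<in> H2 \<Longrightarrow> laplacian (- u) = - laplacian u"
  and weak_partial_uminus: "u \<in> H2 \<Longrightarrow> b \<in> Basis \<Longrightarrow> weak_partial b (- u) = - weak_partial b u"
  using H2_scaleR[of u "-1"] laplacian_scaleR[of u "-1"] weak_partial_cscale[of u b "-1"]
  by (simp_all add: cscale_minus_left)

lemma H2_diff: "u \<in> H2 \<Longrightarrow> v \<in> H2 \<Longrightarrow> u - v \<in> H2"
  using H2_add[of u "- v"] H2_uminus[of v] by simp

lemma laplacian_diff: "u \<in> H2 \<Longrightarrow> v \<in> H2 \<Longrightarrow> laplacian (u - v) = laplacian u - laplacian v"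
  using laplacian_add[of u "- v"] by (simp add: H2_uminus laplacian_uminus)

lemma weak_partial_diff: "u \<in> H2 \<Longrightarrow> v \<in> H2 \<Longrightarrow> b \<in> Basis \<Longrightarrow> weak_partial b (u - v) = weak_partial b u - weak_partial b v"
  using weak_partial_add[of u "- v"] by (simp add: H2_uminus weak_partial_uminus)

lemma weak_partial_0: "b \<in> Basis \<Longrightarrow> weak_partial b 0 = 0"
  by (intro weak_partial_eq has_weak_partial_0)

text \<open>Integration by parts against elements of the core.\<close>

lemma cinner_weak_partial:
  assumes b: "b \<in> Basis" and u: "has_weak_partial b u v" and w: "w \<in> core"
  shows "cinner v w = - cinner u (weak_partial b w)"
  using w
proof (induction rule: core_induct)
  case zero then show ?case using b by (simp add: weak_partial_0 cinner_zero_right)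
next
  case (add c g w)
  have "weak_partial b (cscale c (bump_L2 g) + w) = cscale c (bump_L2 (dfac b g)) + weak_partial b w"
    using b add core_weak_partial[OF b add(2)]
    by (intro weak_partial_eq has_weak_partial_add has_weak_partial_cscale has_weak_partial_bump_L2)
  then show ?case
    using add has_weak_partialD[OF b u add(1)] by (simp add: cinner_add_right cinner_cscale_right)
qed

lemma weak_partial_commute:
  assumes i: "i \<in> Basis" and j: "j \<in> Basis" and u: "u \<in> core"
  shows "weak_partial i (weak_partial j u) = weak_partial j (weak_partial i u)"
proof -
  let ?d = weak_partial
  have "?d i (?d j u) - ?d j (?d i u) = 0"
  proof (rule L2_eq_0_if_orthogonal_bump_L2)
    fix g :: "'a \<Rightarrow> real \<Rightarrow> real" assume g: "bumps g"
    have *: "cinner (?d i (?d j u)) (bump_L2 g) = cinner u (bump_L2 (dfac j (dfac i g)))"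
      if "i \<in> Basis" "j \<in> Basis" for i j
      using has_weak_partialD[OF that(1) core_weak_partial[OF that(1) weak_partial_in_core[OF that(2) u]] g]
        has_weak_partialD[OF that(2) core_weak_partial[OF that(2) u] bumps_dfac[OF that(1) g]] by simp
    then show "cinner (?d i (?d j u) - ?d j (?d i u)) (bump_L2 g) = 0"
      using *[OF i j] *[OF j i] by (simp add: cinner_diff_left dfac_commute)
  qed
  then show ?thesis by simp
qed

lemma cinner_laplacian_core:
  assumes u: "u \<in> H2" and w: "w \<in> core"
  shows "cinner (laplacian u) w = - (\<Sum>i\<in>Basis. cinner (weak_partial i u) (weak_partial i w))"
    and "cinner (laplacian u) w = cinner u (laplacian w)"
proof -
  show "cinner (laplacian u) w = - (\<Sum>i\<in>Basis. cinner (weak_partial i u) (weak_partial i w))"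
    unfolding laplacian_def cinner_sum_left sum_negf[symmetric]
    by (intro sum.cong refl cinner_weak_partial H2_weak_partial u w)
  then have "cinner (laplacian u) w = (\<Sum>i\<in>Basis. - cinner (weak_partial i u) (weak_partial i w))"
    by (simp add: sum_negf)
  also have "\<dots> = (\<Sum>i\<in>Basis. cinner u (weak_partial i (weak_partial i w)))"
    using cinner_weak_partial[OF _ H2_weak_partial(1)[OF u] weak_partial_in_core[OF _ w]]
    by (intro sum.cong refl) simp
  finally show "cinner (laplacian u) w = cinner u (laplacian w)"
    by (simp add: laplacian_def cinner_sum_right)
qed

text \<open>The quadratic form \<open>\<integral> |\<nabla>u|\<^sup>2\<close> of the negative Laplacian.\<close>

abbreviation kinetic_energy :: "'a::euclidean_space L2 \<Rightarrow> real"
  where "kinetic_energy u \<equiv> (\<Sum>i\<in>Basis. (norm (weak_partial i u))\<^sup>2)"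

lemma cinner_laplacian_self_core:
  assumes u: "u \<in> core"
  shows "cinner (laplacian u) u = - complex_of_real (kinetic_energy u)"
  using cinner_laplacian_core(1)[of u u] u core_subset_H2 by (auto simp: cinner_same)

text \<open>Integrating by parts twice gives \<open>\<parallel>\<Delta>u\<parallel>\<^sup>2 = (\<Sum>i j. \<parallel>\<partial>\<^sub>j \<partial>\<^sub>i u\<parallel>\<^sup>2)\<close>.\<close>

lemma norm_second_partial_le:
  assumes u: "u \<in> core" and i: "i \<in> Basis" and j: "j \<in> Basis"
  shows "norm (weak_partial j (weak_partial i u)) \<le> norm (laplacian u)"
proof -
  let ?d = weak_partial
  have eq: "cinner (?d i (?d i u)) (?d j (?d j u))
      = complex_of_real ((norm (?d j (?d i u)))\<^sup>2)" if i: "i \<in> Basis" and j: "j \<in> Basis" for i j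
  proof -
    note in_core = u weak_partial_in_core[OF i] weak_partial_in_core[OF j]
    have "cinner (?d i (?d i u)) (?d j (?d j u))
      = - cinner (?d i u) (?d i (?d j (?d j u)))"
      by (intro cinner_weak_partial core_weak_partial i in_core)
    also have "?d i (?d j (?d j u)) = ?d j (?d j (?d i u))"
      using weak_partial_commute[OF i j] in_core by metis
    also have "- cinner (?d i u) (?d j (?d j (?d i u)))
      = cinner (?d j (?d i u)) (?d j (?d i u))"
      by (intro cinner_weak_partial[symmetric] core_weak_partial j in_core)
    finally show ?thesis by (simp add: cinner_same)
  qed
  have "complex_of_real ((norm (laplacian u))\<^sup>2)
      = (\<Sum>i\<in>Basis. \<Sum>j\<in>Basis. cinner (?d i (?d i u)) (?d j (?d j u)))"
    unfolding cinner_same[symmetric] laplacian_def cinner_sum_left cinner_sum_right by (rule sum.swap)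
  also have "\<dots> = complex_of_real (\<Sum>i\<in>Basis. \<Sum>j\<in>Basis. (norm (?d j (?d i u)))\<^sup>2)"
    by (simp add: eq)
  finally have "(norm (laplacian u))\<^sup>2 = (\<Sum>i\<in>Basis. \<Sum>j\<in>Basis. (norm (?d j (?d i u)))\<^sup>2)"
    by (simp only: of_real_eq_iff)
  moreover have "(norm (?d j (?d i u)))\<^sup>2 \<le> (\<Sum>j\<in>Basis. (norm (?d j (?d i u)))\<^sup>2)"
    using j by (intro member_le_sum) auto
  moreover have "\<dots> \<le> (\<Sum>i\<in>Basis. \<Sum>j\<in>Basis. (norm (?d j (?d i u)))\<^sup>2)"
    using i by (intro member_le_sum[of i Basis "\<lambda>i. \<Sum>j\<in>Basis. (norm (?d j (?d i u)))\<^sup>2"] sum_nonneg) auto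
  ultimately have "(norm (?d j (?d i u)))\<^sup>2 \<le> (norm (laplacian u))\<^sup>2" by simp
  then show ?thesis by (rule power2_le_imp_le) simp
qed

text \<open>These estimates, together with the bound on the second derivatives by the Laplacian, control all
  derivatives up to order two of \<open>u\<close> by \<open>f = (l - \<Delta>) u\<close>.\<close>

lemma core_resolvent_estimates:
  assumes u: "u \<in> core" and l: "l > 0" and f: "f = l *\<^sub>R u - laplacian u"
  shows "l * norm u \<le> norm f" "norm (laplacian u) \<le> 2 * norm f"
    "i \<in> Basis \<Longrightarrow> norm (weak_partial i u) \<le> (1 / sqrt l) * norm f"
proof -
  have inn: "inner f u = l * (norm u)\<^sup>2 + kinetic_energy u"
    using cinner_laplacian_self_core[OF u]
    by (simp add: f inner_diff_left inner_L2_def[of "laplacian u"] power2_norm_eq_inner)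
  have le: "inner f u \<le> norm f * norm u" by (rule norm_cauchy_schwarz)
  have "0 \<le> kinetic_energy u" by (intro sum_nonneg) auto
  then have "l * norm u * norm u \<le> norm f * norm u"
    using inn le by (simp add: power2_eq_square mult.assoc)
  then show 1: "l * norm u \<le> norm f" by (cases "norm u = 0") auto
  have "laplacian u = l *\<^sub>R u - f" by (simp add: f)
  then have "norm (laplacian u) \<le> norm (l *\<^sub>R u) + norm f" by (metis norm_triangle_ineq4)
  then show "norm (laplacian u) \<le> 2 * norm f" using 1 l by simp
  assume i: "i \<in> Basis"
  have "(norm (weak_partial i u))\<^sup>2 \<le> kinetic_energy u"
    using i by (intro member_le_sum) auto
  moreover have "0 \<le> l * (norm u)\<^sup>2" using l by simp
  ultimately have "(norm (weak_partial i u))\<^sup>2 \<le> norm f * norm u"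
    using inn le by linarith
  also have "\<dots> \<le> norm f * (norm f / l)"
    using 1 l by (intro mult_left_mono) (auto simp: field_simps)
  also have "\<dots> = ((1 / sqrt l) * norm f)\<^sup>2"
    using l by (simp add: power2_eq_square power_mult_distrib field_simps)
  finally show "norm (weak_partial i u) \<le> (1 / sqrt l) * norm f"
    by (rule power2_le_imp_le) (use l in simp)
qed

text \<open>The orthogonal complement of the range is trivial by the Liouville theorem.\<close>

lemma resolvent_range_dense:
  fixes f :: "'a::euclidean_space L2"
  assumes l: "l > 0"
  obtains u where "\<And>n. u n \<in> core" "(\<lambda>n. l *\<^sub>R u n - laplacian (u n)) \<longlonglongrightarrow> f"
proof -
  define T where "T u = l *\<^sub>R u - laplacian u" for u :: "'a L2"
  have lin: "T (u + v) = T u + T v" "T (r *\<^sub>R u) = r *\<^sub>R T u" if "u \<in> core" "v \<in> core" for u v r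
  proof -
    have "u \<in> H2" "v \<in> H2" using that core_subset_H2 by blast+
    then show "T (u + v) = T u + T v" "T (r *\<^sub>R u) = r *\<^sub>R T u"
      by (simp_all add: T_def laplacian_add laplacian_scaleR algebra_simps)
  qed
  have T0: "T 0 = 0" using lin(2)[of 0 0 0] subspace_0[OF subspace_core] by simp
  have "subspace (T ` core)"
  proof (rule subspaceI)
    show "0 \<in> T ` core" using T0 subspace_0[OF subspace_core] by (metis imageI)
    show "x + y \<in> T ` core" if "x \<in> T ` core" "y \<in> T ` core" for x y
      using that lin(1) subspace_add[OF subspace_core] by (smt (verit) image_iff)
    show "c *\<^sub>R x \<in> T ` core" if "x \<in> T ` core" for c x
      using that lin(2) subspace_scale[OF subspace_core] by (smt (verit) image_iff)
  qed
  moreover have "w = 0" if w: "\<And>s. s \<in> T ` core \<Longrightarrow> inner w s = 0" for w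
  proof (rule Liouville_eq_0[OF l])
    fix c and g :: "'a \<Rightarrow> real \<Rightarrow> real" assume g: "bumps g"
    have gD: "bump_L2 g \<in> core" using core_bump_L2[OF g, of 1] by simp
    have "T (cscale c (bump_L2 g)) = cscale c (l *\<^sub>R bump_L2 g - (\<Sum>b\<in>Basis. bump_L2 (dfac b (dfac b g))))"
      using gD core_subset_H2 by (auto simp: T_def laplacian_cscale laplacian_bump_L2[OF g] cscale_diff_right cscale_scaleR)
    then show "inner w (cscale c (l *\<^sub>R bump_L2 g - (\<Sum>b\<in>Basis. bump_L2 (dfac b (dfac b g))))) = 0"
      using w[OF imageI[OF core_bump_L2[OF g, of c]]] by simp
  qed
  ultimately have "f \<in> closure (T ` core)" by (rule subspace_dense_if_orthogonal_trivial)
  then obtain s where s: "\<And>n. s n \<in> T ` core" "s \<longlonglongrightarrow> f" unfolding closure_sequential by blast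
  then have "\<forall>n. \<exists>u. u \<in> core \<and> s n = T u" by blast
  then obtain u where u: "\<And>n. u n \<in> core" "\<And>n. s n = T (u n)" by metis
  have "s = (\<lambda>n. l *\<^sub>R u n - laplacian (u n))" using u(2) by (auto simp: T_def)
  then show ?thesis using that[OF u(1)] s(2) by simp
qed

lemma Cauchy_if_diff_le:
  fixes f :: "nat \<Rightarrow> 'b::real_normed_vector" and h :: "nat \<Rightarrow> 'c::real_normed_vector"
  assumes f: "Cauchy f" and le: "\<And>m n. norm (h m - h n) \<le> C * norm (f m - f n)"
  shows "Cauchy h"
proof (rule CauchyI)
  fix e :: real assume "e > 0"
  define C' where "C' = \<bar>C\<bar> + 1"
  have "C' > 0" by (simp add: C'_def)
  then obtain M where M: "\<And>m n. m \<ge> M \<Longrightarrow> n \<ge> M \<Longrightarrow> norm (f m - f n) < e / C'"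
    using CauchyD[OF f, of "e / C'"] \<open>e > 0\<close> by auto
  have "norm (h m - h n) < e" if "m \<ge> M" "n \<ge> M" for m n
  proof -
    have "norm (h m - h n) \<le> C' * norm (f m - f n)"
    proof (rule order_trans[OF le])
      show "C * norm (f m - f n) \<le> C' * norm (f m - f n)"
        by (intro mult_right_mono) (auto simp: C'_def)
    qed
    also have "\<dots> < C' * (e / C')" using M[OF that] \<open>C' > 0\<close> by (intro mult_strict_left_mono)
    finally show ?thesis using \<open>C' > 0\<close> by simp
  qed
  then show "\<exists>M. \<forall>m\<ge>M. \<forall>n\<ge>M. norm (h m - h n) < e" by blast
qed

text \<open>The equation \<open>(l - \<Delta>) u = f\<close> has a solution in \<open>H\<^sup>2\<close>, and the solution is a limit of elements of
  the core together with its derivatives: if \<open>(l - \<Delta>) v n\<close> tends to \<open>f\<close>, then the derivatives of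
  \<open>v n\<close> up to order two are Cauchy sequences, and weak derivatives are closed.\<close>

lemma resolvent_solution:
  fixes f :: "'a::euclidean_space L2"
  assumes l: "l > 0"
  obtains u v where "u \<in> H2" "l *\<^sub>R u - laplacian u = f" "\<And>n. v n \<in> core" "v \<longlonglongrightarrow> u"
    "\<And>i. i \<in> Basis \<Longrightarrow> (\<lambda>n. weak_partial i (v n)) \<longlonglongrightarrow> weak_partial i u"
    "(\<lambda>n. laplacian (v n)) \<longlonglongrightarrow> laplacian u"
proof -
  let ?d = weak_partial
  obtain v where v: "\<And>n. v n \<in> core" "(\<lambda>n. l *\<^sub>R v n - laplacian (v n)) \<longlonglongrightarrow> f"
    using resolvent_range_dense[OF l] by metis
  define F where "F n = l *\<^sub>R v n - laplacian (v n)" for n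
  have F: "Cauchy F" unfolding F_def using v(2) by (rule LIMSEQ_imp_Cauchy)
  have vH: "v n \<in> H2" for n using v(1) core_subset_H2 by blast
  have dD: "v m - v n \<in> core" for m n using v(1) subspace_core by (blast intro: subspace_diff)
  have dF: "F m - F n = l *\<^sub>R (v m - v n) - laplacian (v m - v n)" for m n
    by (simp add: F_def laplacian_diff vH algebra_simps)
  note est = core_resolvent_estimates[OF dD l dF]
  have "norm (v m - v n) \<le> (1 / l) * norm (F m - F n)" for m n
    using est(1)[of m n] l by (simp add: field_simps)
  from Cauchy_if_diff_le[OF F this] have "Cauchy v" .
  then obtain u where u: "v \<longlonglongrightarrow> u" by (auto simp: Cauchy_convergent_iff convergent_def)
  have "Cauchy (\<lambda>n. ?d i (v n))" if "i \<in> Basis" for i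
    by (rule Cauchy_if_diff_le[OF F, where C = "1 / sqrt l"])
      (use est(3)[OF that] weak_partial_diff[OF vH vH that] in metis)
  then have "\<forall>i\<in>Basis. \<exists>p. (\<lambda>n. ?d i (v n)) \<longlonglongrightarrow> p"
    by (auto simp: Cauchy_convergent_iff convergent_def)
  then obtain p where p: "\<And>i. i \<in> Basis \<Longrightarrow> (\<lambda>n. ?d i (v n)) \<longlonglongrightarrow> p i" by metis
  have "Cauchy (\<lambda>n. ?d j (?d i (v n)))" if ij: "i \<in> Basis" "j \<in> Basis" for i j
  proof (rule Cauchy_if_diff_le[OF F, where C = 2])
    fix m n
    have "?d j (?d i (v m)) - ?d j (?d i (v n))
        = ?d j (?d i (v m - v n))"
      using weak_partial_diff[OF vH vH ij(1)] weak_partial_in_core[OF ij(1) v(1)] core_subset_H2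
        weak_partial_diff[OF _ _ ij(2)] by (metis subsetD)
    then show "norm (?d j (?d i (v m)) - ?d j (?d i (v n))) \<le> 2 * norm (F m - F n)"
      using norm_second_partial_le[OF dD ij, of m n] est(2)[of m n] by simp
  qed
  then have "\<forall>i\<in>Basis. \<forall>j\<in>Basis. \<exists>p. (\<lambda>n. ?d j (?d i (v n))) \<longlonglongrightarrow> p"
    by (auto simp: Cauchy_convergent_iff convergent_def)
  then obtain q where q: "\<And>i j. i \<in> Basis \<Longrightarrow> j \<in> Basis \<Longrightarrow> (\<lambda>n. ?d j (?d i (v n))) \<longlonglongrightarrow> q i j"
    by metis
  have 1: "has_weak_partial i u (p i)" if "i \<in> Basis" for i
    by (rule has_weak_partial_lim[OF that _ u p[OF that]]) (rule core_weak_partial[OF that v(1)])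
  have 2: "has_weak_partial j (p i) (q i j)" if ij: "i \<in> Basis" "j \<in> Basis" for i j
    by (rule has_weak_partial_lim[OF ij(2) _ p[OF ij(1)] q[OF ij]])
      (rule core_weak_partial[OF ij(2) weak_partial_in_core[OF ij(1) v(1)]])
  have uH: "u \<in> H2" unfolding H2_def using 1 2 by blast
  have wp: "?d i u = p i" "?d j (p i) = q i j" if "i \<in> Basis" "j \<in> Basis" for i j
    using that 1 2 by (auto intro: weak_partial_eq)
  have lap: "(\<lambda>n. laplacian (v n)) \<longlonglongrightarrow> laplacian u"
    unfolding laplacian_def using wp q by (intro tendsto_sum) auto
  have "(\<lambda>n. l *\<^sub>R v n - laplacian (v n)) \<longlonglongrightarrow> l *\<^sub>R u - laplacian u"
    by (intro tendsto_intros u lap)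
  from LIMSEQ_unique[OF this v(2)] have "l *\<^sub>R u - laplacian u = f" .
  then show ?thesis using that[OF uH _ v(1) u _ lap] p wp by auto
qed

lemma resolvent_injective:
  assumes l: "l > 0" and u: "u \<in> H2" and 0: "l *\<^sub>R u - laplacian u = 0"
  shows "u = 0"
proof (rule Liouville_eq_0[OF l])
  fix c and g :: "'a \<Rightarrow> real \<Rightarrow> real" assume g: "bumps g"
  have gD: "bump_L2 g \<in> core" "cscale c (bump_L2 g) \<in> core" using core_bump_L2[OF g, of 1] core_bump_L2[OF g, of c] by auto
  have "inner u (cscale c (l *\<^sub>R bump_L2 g - laplacian (bump_L2 g)))
      = inner (l *\<^sub>R u) (cscale c (bump_L2 g)) - inner u (laplacian (cscale c (bump_L2 g)))"
    using gD(1) core_subset_H2 by (auto simp: laplacian_cscale cscale_diff_right inner_diff_right cscale_scaleR)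
  also have "inner u (laplacian (cscale c (bump_L2 g))) = inner (laplacian u) (cscale c (bump_L2 g))"
    using cinner_laplacian_core(2)[OF u gD(2)] by (simp add: inner_L2_def)
  also have "inner (l *\<^sub>R u) (cscale c (bump_L2 g)) - inner (laplacian u) (cscale c (bump_L2 g)) = 0"
    using 0 by (simp only: inner_diff_left[symmetric]) simp
  finally show "inner u (cscale c (l *\<^sub>R bump_L2 g - (\<Sum>b\<in>Basis. bump_L2 (dfac b (dfac b g))))) = 0"
    by (simp add: laplacian_bump_L2[OF g])
qed

text \<open>The span of the products of bump functions is dense in \<open>H\<^sup>2\<close> with respect to the graph norm: the
  approximation of the solution of \<open>(1 - \<Delta>) u' = (1 - \<Delta>) u\<close> is one of \<open>u\<close> since \<open>u' = u\<close>.\<close>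

lemma H2_approximation:
  assumes u: "u \<in> H2"
  obtains v where "\<And>n. v n \<in> core" "v \<longlonglongrightarrow> u"
    "\<And>i. i \<in> Basis \<Longrightarrow> (\<lambda>n. weak_partial i (v n)) \<longlonglongrightarrow> weak_partial i u"
    "(\<lambda>n. laplacian (v n)) \<longlonglongrightarrow> laplacian u"
proof -
  obtain u' v where *: "u' \<in> H2" "1 *\<^sub>R u' - laplacian u' = 1 *\<^sub>R u - laplacian u" "\<And>n. v n \<in> core" "v \<longlonglongrightarrow> u'"
    "\<And>i. i \<in> Basis \<Longrightarrow> (\<lambda>n. weak_partial i (v n)) \<longlonglongrightarrow> weak_partial i u'"
    "(\<lambda>n. laplacian (v n)) \<longlonglongrightarrow> laplacian u'"
    using resolvent_solution[of 1 "1 *\<^sub>R u - laplacian u"] zero_less_one by metis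
  have "u' - u = 0"
    by (rule resolvent_injective[of 1]) (use * u in \<open>auto simp: H2_diff laplacian_diff algebra_simps\<close>)
  then show ?thesis using that[OF *(3)] * by simp
qed

lemma cinner_laplacian_self:
  assumes u: "u \<in> H2"
  shows "cinner (laplacian u) u = - complex_of_real (kinetic_energy u)"
proof -
  obtain v where v: "\<And>n. v n \<in> core" "v \<longlonglongrightarrow> u"
    "\<And>i. i \<in> Basis \<Longrightarrow> (\<lambda>n. weak_partial i (v n)) \<longlonglongrightarrow> weak_partial i u"
    "(\<lambda>n. laplacian (v n)) \<longlonglongrightarrow> laplacian u" using H2_approximation[OF u] by metis
  have "(\<lambda>n. cinner (laplacian (v n)) (v n)) \<longlonglongrightarrow> cinner (laplacian u) u"
    by (intro tendsto_cinner v)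
  moreover have "(\<lambda>n. cinner (laplacian (v n)) (v n)) \<longlonglongrightarrow> - complex_of_real (kinetic_energy u)"
    unfolding cinner_laplacian_self_core[OF v(1)] by (intro tendsto_intros v)
  ultimately show ?thesis by (rule LIMSEQ_unique)
qed

lemma cinner_laplacian_symmetric:
  assumes u: "u \<in> H2" and w: "w \<in> H2"
  shows "cinner (laplacian u) w = cinner u (laplacian w)"
proof -
  obtain v where v: "\<And>n. v n \<in> core" "v \<longlonglongrightarrow> w" "(\<lambda>n. laplacian (v n)) \<longlonglongrightarrow> laplacian w"
    using H2_approximation[OF w] by metis
  have "(\<lambda>n. cinner (laplacian u) (v n)) \<longlonglongrightarrow> cinner (laplacian u) w"
    by (intro tendsto_cinner v tendsto_const)
  moreover have "(\<lambda>n. cinner (laplacian u) (v n)) \<longlonglongrightarrow> cinner u (laplacian w)"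
    unfolding cinner_laplacian_core(2)[OF u v(1)] by (intro tendsto_cinner v tendsto_const)
  ultimately show ?thesis by (rule LIMSEQ_unique)
qed

lemma H2_translate_diff_norm_le:
  fixes u :: "'a::euclidean_space L2"
  assumes u: "u \<in> H2"
  shows "norm (translate h u - u) \<le> (\<Sum>c\<in>Basis. \<bar>h \<bullet> c\<bar> * norm (weak_partial c u))"
proof -
  obtain v where v: "\<And>n. v n \<in> core" "v \<longlonglongrightarrow> u"
    "\<And>i. i \<in> Basis \<Longrightarrow> (\<lambda>n. weak_partial i (v n)) \<longlonglongrightarrow> weak_partial i u"
    using H2_approximation[OF u] by metis
  have "(\<lambda>n. norm (translate h (v n) - v n)) \<longlonglongrightarrow> norm (translate h u - u)"
    by (intro tendsto_intros v bounded_linear.tendsto[OF bounded_linear_translate])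
  moreover have "(\<lambda>n. \<Sum>c\<in>Basis. \<bar>h \<bullet> c\<bar> * norm (weak_partial c (v n))) \<longlonglongrightarrow> (\<Sum>c\<in>Basis. \<bar>h \<bullet> c\<bar> * norm (weak_partial c u))"
    by (intro tendsto_intros v)
  moreover have "norm (translate h (v n) - v n) \<le> (\<Sum>c\<in>Basis. \<bar>h \<bullet> c\<bar> * norm (weak_partial c (v n)))" for n
    by (rule translate_diff_norm_le) (rule core_curve_deriv[OF _ v(1)])
  ultimately show ?thesis by (intro LIMSEQ_le) auto
qed


section \<open>Multiplication by a bounded potential\<close>

lemma mult_fun_abs_L2:
  "V \<in> Linfty \<Longrightarrow> sq_integrable f \<Longrightarrow> mult_fun V (abs_L2 f) = abs_L2 (\<lambda>x. complex_of_real (V x) * f x)"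
  by (subst mult_fun.abs_eq) (auto simp: L2_rel_refl)

lemma Linfty_sq_integrable:
  assumes "V \<in> Linfty" "sq_integrable f" shows "sq_integrable (\<lambda>x. complex_of_real (V x) * f x)"
proof -
  obtain C where "AE x in lebesgue. \<bar>V x\<bar> \<le> C" "V \<in> borel_measurable lebesgue"
    using assms(1) by (auto simp: Linfty_def)
  then show ?thesis using assms(2) by (intro sq_integrable_bounded_mult[where C = C]) auto
qed

lemma mult_fun_rep: "V \<in> Linfty \<Longrightarrow> mult_fun V u = abs_L2 (\<lambda>x. complex_of_real (V x) * rep_L2 u x)"
  using mult_fun_abs_L2[of V "rep_L2 u"] by simp

lemma mult_fun_add:
  assumes V: "V \<in> Linfty" shows "mult_fun V (u + v) = mult_fun V u + mult_fun V v"
proof -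
  have "mult_fun V (u + v) = mult_fun V (abs_L2 (\<lambda>x. rep_L2 u x + rep_L2 v x))"
    by (simp add: abs_L2_add[symmetric])
  then show ?thesis
    using V by (simp add: mult_fun_abs_L2 mult_fun_rep[of V u] mult_fun_rep[of V v] abs_L2_add
        sq_integrable_add Linfty_sq_integrable distrib_left)
qed

lemma mult_fun_cscale:
  assumes V: "V \<in> Linfty" shows "mult_fun V (cscale c u) = cscale c (mult_fun V u)"
proof -
  have "mult_fun V (cscale c u) = mult_fun V (abs_L2 (\<lambda>x. c * rep_L2 u x))"
    by (simp add: abs_L2_cscale[symmetric])
  then show ?thesis
    using V by (simp add: mult_fun_abs_L2 mult_fun_rep[of V u] abs_L2_cscale
        sq_integrable_cmult Linfty_sq_integrable mult.left_commute)
qed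

lemma mult_fun_diff: "V \<in> Linfty \<Longrightarrow> mult_fun V (u - v) = mult_fun V u - mult_fun V v"
  using mult_fun_add[of V u "- v"] mult_fun_cscale[of V "-1" v]
  by (simp add: cscale_minus_left)

lemma cinner_mult_fun:
  assumes V: "V \<in> Linfty"
  shows "cinner (mult_fun V u) v = cinner u (mult_fun V v)"
proof -
  note sq = Linfty_sq_integrable[OF V sq_integrable_rep]
  have "cinner (mult_fun V u) v = cinner (mult_fun V u) (abs_L2 (rep_L2 v))" by simp
  also have "\<dots> = (LINT x|lebesgue. complex_of_real (V x) * rep_L2 u x * cnj (rep_L2 v x))"
    unfolding mult_fun_rep[OF V] by (rule cinner_abs_L2[OF sq sq_integrable_rep])
  also have "\<dots> = (LINT x|lebesgue. rep_L2 u x * cnj (complex_of_real (V x) * rep_L2 v x))"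
    by (intro Bochner_Integration.integral_cong) auto
  also have "\<dots> = cinner (abs_L2 (rep_L2 u)) (mult_fun V v)"
    unfolding mult_fun_rep[OF V] by (rule cinner_abs_L2[OF sq_integrable_rep sq, symmetric])
  finally show ?thesis by simp
qed

text \<open>The quadratic form \<open>\<integral> V |u|\<^sup>2\<close> of the multiplication operator.\<close>

definition pot_energy :: "('a::euclidean_space \<Rightarrow> real) \<Rightarrow> 'a L2 \<Rightarrow> real"
  where "pot_energy V u = (LINT x|lebesgue. V x * (cmod (rep_L2 u x))\<^sup>2)"

lemma Linfty_integrable:
  assumes V: "V \<in> Linfty" and f: "sq_integrable f"
  shows "integrable lebesgue (\<lambda>x. V x * (cmod (f x))\<^sup>2)"
proof -
  have "integrable lebesgue (\<lambda>x. Re (complex_of_real (V x) * f x * cnj (f x)))"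
    by (intro integrable_Re integrable_mult_cnj Linfty_sq_integrable V f)
  moreover have "Re (complex_of_real (V x) * f x * cnj (f x)) = V x * (cmod (f x))\<^sup>2" for x
    by (simp add: mult.assoc complex_norm_square[symmetric])
  ultimately show ?thesis by simp
qed

lemma pot_energy_abs_L2:
  assumes V: "V \<in> Linfty" and f: "sq_integrable f"
  shows "pot_energy V (abs_L2 f) = (LINT x|lebesgue. V x * (cmod (f x))\<^sup>2)"
  unfolding pot_energy_def
proof (intro integral_cong_AE borel_measurable_integrable Linfty_integrable V f sq_integrable_rep)
  show "AE x in lebesgue. V x * (cmod (rep_L2 (abs_L2 f) x))\<^sup>2 = V x * (cmod (f x))\<^sup>2"
    using rep_abs_L2[OF f] by eventually_elim simp
qed

lemma cinner_mult_fun_self: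
  assumes V: "V \<in> Linfty"
  shows "cinner (mult_fun V u) u = complex_of_real (pot_energy V u)"
proof -
  have "cinner (mult_fun V u) u = cinner (mult_fun V u) (abs_L2 (rep_L2 u))" by simp
  also have "\<dots> = (LINT x|lebesgue. complex_of_real (V x) * rep_L2 u x * cnj (rep_L2 u x))"
    unfolding mult_fun_rep[OF V] by (rule cinner_abs_L2[OF Linfty_sq_integrable[OF V sq_integrable_rep] sq_integrable_rep])
  also have "\<dots> = (LINT x|lebesgue. complex_of_real (V x * (cmod (rep_L2 u x))\<^sup>2))"
    by (intro Bochner_Integration.integral_cong refl) (simp add: mult.assoc complex_norm_square[symmetric])
  finally show ?thesis unfolding pot_energy_def integral_complex_of_real .
qed

lemma norm_mult_fun_le:
  assumes V: "V \<in> Linfty" and M: "AE x in lebesgue. \<bar>V x\<bar> \<le> M" "M \<ge> 0"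
  shows "norm (mult_fun V u) \<le> M * norm u"
proof -
  note sq = Linfty_sq_integrable[OF V sq_integrable_rep[of u]]
  have "(norm (mult_fun V u))\<^sup>2 = (LINT x|lebesgue. (cmod (complex_of_real (V x) * rep_L2 u x))\<^sup>2)"
    unfolding mult_fun_rep[OF V] by (rule norm_abs_L2_sq[OF sq])
  also have "\<dots> \<le> (LINT x|lebesgue. M\<^sup>2 * (cmod (rep_L2 u x))\<^sup>2)"
  proof (intro integral_mono_AE)
    show "integrable lebesgue (\<lambda>x. (cmod (complex_of_real (V x) * rep_L2 u x))\<^sup>2)" using sq by blast
    show "integrable lebesgue (\<lambda>x. M\<^sup>2 * (cmod (rep_L2 u x))\<^sup>2)"
      using sq_integrable_rep[of u] by (intro integrable_mult_right) blast
    show "AE x in lebesgue. (cmod (complex_of_real (V x) * rep_L2 u x))\<^sup>2 \<le> M\<^sup>2 * (cmod (rep_L2 u x))\<^sup>2"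
      using M(1)
    proof eventually_elim
      case (elim x)
      then have "(\<bar>V x\<bar> * cmod (rep_L2 u x))\<^sup>2 \<le> (M * cmod (rep_L2 u x))\<^sup>2"
        by (intro power_mono mult_right_mono) auto
      then show ?case by (simp add: norm_mult power_mult_distrib)
    qed
  qed
  also have "\<dots> = M\<^sup>2 * (norm u)\<^sup>2"
    using norm_abs_L2_sq[OF sq_integrable_rep[of u]] by simp
  finally have "(norm (mult_fun V u))\<^sup>2 \<le> (M * norm u)\<^sup>2" by (simp add: power_mult_distrib)
  then show ?thesis by (rule power2_le_imp_le) (use M(2) in simp)
qed

lemma pot_energy_nonneg:
  assumes "AE x in lebesgue. 0 \<le> V x" shows "0 \<le> pot_energy V u"
  unfolding pot_energy_def
  by (rule integral_nonneg_AE) (use assms in \<open>eventually_elim, simp\<close>)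


section \<open>The Schroedinger operator\<close>

text \<open>The action of \<open>- \<Delta> + V\<close>, meant for arguments in \<open>H2\<close>.\<close>

definition schroedinger :: "('a::euclidean_space \<Rightarrow> real) \<Rightarrow> 'a L2 \<Rightarrow> 'a L2"
  where "schroedinger V u = - laplacian u + mult_fun V u"

lemma schroedinger_eq: "schroedinger V u = mult_fun V u - laplacian u"
  by (simp add: schroedinger_def)

lemma op_add_neg_laplacian_mult_op: "op_add neg_laplacian (mult_op V) = (H2, schroedinger V)"
  by (simp add: op_add_def neg_laplacian_def mult_op_def schroedinger_def[abs_def])

text \<open>The quadratic form \<open>\<integral> |\<nabla>u|\<^sup>2 + \<integral> V |u|\<^sup>2\<close> of the Schroedinger operator.\<close>

definition energy :: "('a::euclidean_space \<Rightarrow> real) \<Rightarrow> 'a L2 \<Rightarrow> real"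
  where "energy V u = kinetic_energy u + pot_energy V u"

lemma cinner_schroedinger_self:
  assumes "V \<in> Linfty" "u \<in> H2"
  shows "cinner (schroedinger V u) u = complex_of_real (energy V u)"
  using assms
  by (simp add: schroedinger_eq cinner_diff_left cinner_laplacian_self cinner_mult_fun_self energy_def)

lemma energy_nonneg: "AE x in lebesgue. 0 \<le> V x \<Longrightarrow> 0 \<le> energy V u"
  by (simp add: energy_def pot_energy_nonneg sum_nonneg)

lemma inner_schroedinger_self:
  assumes "V \<in> Linfty" "u \<in> H2" shows "inner (schroedinger V u) u = energy V u"
  by (simp add: inner_L2_def cinner_schroedinger_self[OF assms])

lemma inner_schroedinger_symmetric:
  assumes "V \<in> Linfty" "u \<in> H2" "w \<in> H2"
  shows "inner (schroedinger V u) w = inner u (schroedinger V w)"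
  using cinner_laplacian_symmetric[OF assms(2,3)] cinner_mult_fun[OF assms(1), of u w]
  by (simp add: schroedinger_eq inner_L2_def cinner_diff_left cinner_diff_right)

lemma schroedinger_diff:
  "V \<in> Linfty \<Longrightarrow> u \<in> H2 \<Longrightarrow> v \<in> H2 \<Longrightarrow> schroedinger V (u - v) = schroedinger V u - schroedinger V v"
  by (simp add: schroedinger_eq laplacian_diff mult_fun_diff)

lemma schroedinger_cscale:
  "V \<in> Linfty \<Longrightarrow> u \<in> H2 \<Longrightarrow> schroedinger V (cscale c u) = cscale c (schroedinger V u)"
  by (simp add: schroedinger_eq laplacian_cscale mult_fun_cscale cscale_diff_right)

lemma schroedinger_scaleR:
  "V \<in> Linfty \<Longrightarrow> u \<in> H2 \<Longrightarrow> schroedinger V (r *\<^sub>R u) = r *\<^sub>R schroedinger V u"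
  by (simp add: scaleR_L2_def schroedinger_cscale)

lemma strictly_positive_schroedinger_iff:
  assumes V: "V \<in> Linfty"
  shows "strictly_positive (op_add neg_laplacian (mult_op V)) \<longleftrightarrow>
    (\<exists>\<epsilon>>0. \<forall>u\<in>H2. \<epsilon> * (norm u)\<^sup>2 \<le> energy V u)"
  unfolding strictly_positive_def op_add_neg_laplacian_mult_op
  by (simp add: cinner_schroedinger_self[OF V] cinner_same less_eq_complex_def power2_eq_square)


subsection \<open>Spectrum\<close>

text \<open>A Lipschitz perturbation of a surjective coercive operator is surjective if its Lipschitz
  constant is smaller than the coercivity constant, by the Banach fixed point theorem.\<close>

lemma surjective_perturbation:
  fixes T B :: "'h::{real_normed_vector, complete_space} \<Rightarrow> 'h"
  assumes T: "\<And>u v. u \<in> S \<Longrightarrow> v \<in> S \<Longrightarrow> c * norm (u - v) \<le> norm (T u - T v)" and c: "0 < c"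
    and surj: "\<And>f. \<exists>u\<in>S. T u = f"
    and B: "\<And>u v. norm (B u - B v) \<le> \<beta> * norm (u - v)" and \<beta>: "0 \<le> \<beta>" "\<beta> < c"
  shows "\<exists>u\<in>S. T u + B u = f"
proof -
  obtain G where G: "\<And>f. G f \<in> S" "\<And>f. T (G f) = f" using surj by metis
  define \<Phi> where "\<Phi> w = G (f - B w)" for w
  have "\<exists>!w. \<Phi> w = w"
  proof (rule banach_fix_type)
    show "0 \<le> \<beta> / c" "\<beta> / c < 1" using \<beta> c by auto
    show "\<forall>x y. dist (\<Phi> x) (\<Phi> y) \<le> \<beta> / c * dist x y"
    proof (intro allI)
      fix x y
      have "c * norm (\<Phi> x - \<Phi> y) \<le> norm (B y - B x)"
        using T[OF G(1) G(1), of "f - B x" "f - B y"] by (simp add: \<Phi>_def G(2))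
      also have "\<dots> \<le> \<beta> * norm (x - y)" using B[of y x] by (simp add: norm_minus_commute)
      finally show "dist (\<Phi> x) (\<Phi> y) \<le> \<beta> / c * dist x y"
        using c by (simp add: dist_norm field_simps)
    qed
  qed
  then obtain w where w: "\<Phi> w = w" by auto
  then have "w \<in> S" "T w = f - B w" using G unfolding \<Phi>_def by metis+
  then show ?thesis by (intro bexI[of _ w]) auto
qed

lemma schroedinger_coercive:
  assumes V: "V \<in> Linfty" and pos: "\<And>u. u \<in> H2 \<Longrightarrow> \<epsilon> * (norm u)\<^sup>2 \<le> energy V u"
    and u: "u \<in> H2"
  shows "(\<epsilon> - Re z) * norm u \<le> norm (schroedinger V u - cscale z u)"
proof (cases "u = 0")
  case False
  have "inner (schroedinger V u - cscale z u) u = energy V u - Re z * (norm u)\<^sup>2"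
    using inner_schroedinger_self[OF V u]
    by (simp add: inner_diff_left inner_L2_def[of "cscale z u"] cinner_cscale_left cinner_same)
  moreover have "inner (schroedinger V u - cscale z u) u \<le> norm (schroedinger V u - cscale z u) * norm u"
    by (rule norm_cauchy_schwarz)
  ultimately have "(\<epsilon> - Re z) * norm u * norm u \<le> norm (schroedinger V u - cscale z u) * norm u"
    using pos[OF u] by (simp add: power2_eq_square algebra_simps)
  then show ?thesis using False by simp
qed simp

text \<open>The resolvent set contains the half-plane \<open>Re z < \<epsilon>\<close>. Surjectivity of \<open>- \<Delta> + l\<close> for large \<open>l\<close> is
  carried over first to \<open>- \<Delta> + V + l\<close> and then to \<open>- \<Delta> + V - z\<close>; the discs with centre \<open>-l\<close> and
  radius \<open>l + \<epsilon>\<close> exhaust the half-plane as \<open>l\<close> grows.\<close>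

lemma schroedinger_resolvent:
  fixes V :: "'a::euclidean_space \<Rightarrow> real"
  assumes V: "V \<in> Linfty" and pos: "\<And>u. u \<in> H2 \<Longrightarrow> \<epsilon> * (norm u)\<^sup>2 \<le> energy V u"
    and \<epsilon>: "\<epsilon> > 0" and z: "Re z < \<epsilon>"
  shows "z \<in> resolvent_set (H2, schroedinger V)"
proof -
  obtain M0 where "AE x in lebesgue. \<bar>V x\<bar> \<le> M0" using V by (auto simp: Linfty_def)
  define M where "M = \<bar>M0\<bar>"
  have M: "AE x in lebesgue. \<bar>V x\<bar> \<le> M" "0 \<le> M"
    using \<open>AE x in lebesgue. \<bar>V x\<bar> \<le> M0\<close> by (auto simp: M_def elim: eventually_mono)
  \<comment> \<open>Larger than the bound of \<open>V\<close>, and so large that \<open>|z + l| < l + \<epsilon>\<close>.\<close>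
  define l where "l = M + 1 + (cmod z)\<^sup>2 / (\<epsilon> - Re z)"
  have l: "l > M" "l > 0" using M(2) z by (auto simp: l_def intro: add_pos_nonneg add_nonneg_pos)
  have zl: "cmod (z + of_real l) < l + \<epsilon>"
  proof -
    have "(cmod z)\<^sup>2 / (\<epsilon> - Re z) \<le> l" using M(2) by (simp add: l_def)
    then have "(cmod z)\<^sup>2 \<le> l * (\<epsilon> - Re z)" using z by (simp add: field_simps)
    moreover have "0 < l * (\<epsilon> - Re z)" using l z by simp
    moreover have "(cmod (z + of_real l))\<^sup>2 = (cmod z)\<^sup>2 + 2 * (l * Re z) + l\<^sup>2"
      unfolding cmod_power2 by (simp add: power2_eq_square algebra_simps)
    ultimately have "(cmod (z + of_real l))\<^sup>2 < 2 * (l * (\<epsilon> - Re z)) + 2 * (l * Re z) + l\<^sup>2"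
      by linarith
    also have "\<dots> \<le> (l + \<epsilon>)\<^sup>2" by (simp add: power2_eq_square algebra_simps)
    finally show ?thesis using l \<epsilon> by (intro power2_less_imp_less[of _ "l + \<epsilon>"]) auto
  qed
  have coer: "(\<epsilon> - Re w) * norm (u - v)
      \<le> norm ((schroedinger V u - cscale w u) - (schroedinger V v - cscale w v))"
    if "u \<in> H2" "v \<in> H2" for u v w
    using schroedinger_coercive[OF V pos H2_diff[OF that], of w] that
    by (simp add: schroedinger_diff V cscale_diff_right algebra_simps)
  have "\<exists>u\<in>H2. (l *\<^sub>R u - laplacian u) + mult_fun V u = f" for f :: "'a L2"
  proof (rule surjective_perturbation)
    show "\<exists>u\<in>H2. l *\<^sub>R u - laplacian u = f" for f :: "'a L2"
      using resolvent_solution[OF l(2), of f] by metis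
    show "0 < l" "0 \<le> M" "M < l" by fact+
    show "norm (mult_fun V u - mult_fun V v) \<le> M * norm (u - v)" for u v :: "'a L2"
      using norm_mult_fun_le[OF V M, of "u - v"] by (simp add: mult_fun_diff V)
    fix u v :: "'a L2" assume uv: "u \<in> H2" "v \<in> H2"
    define w where "w = u - v"
    have "w \<in> H2" using uv by (simp add: w_def H2_diff)
    then have "l * (norm w)\<^sup>2 \<le> inner (l *\<^sub>R w - laplacian w) w"
      using cinner_laplacian_self[of w]
      by (simp add: inner_diff_left inner_L2_def[of "laplacian w"] power2_norm_eq_inner sum_nonneg)
    also have "\<dots> \<le> norm (l *\<^sub>R w - laplacian w) * norm w" by (rule norm_cauchy_schwarz)
    finally have "l * norm w * norm w \<le> norm (l *\<^sub>R w - laplacian w) * norm w"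
      by (simp add: power2_eq_square mult.assoc)
    then have "l * norm w \<le> norm (l *\<^sub>R w - laplacian w)" by (cases "w = 0") auto
    moreover have "l *\<^sub>R w - laplacian w = (l *\<^sub>R u - laplacian u) - (l *\<^sub>R v - laplacian v)"
      using uv by (simp add: w_def laplacian_diff algebra_simps)
    ultimately show "l * norm (u - v) \<le> norm ((l *\<^sub>R u - laplacian u) - (l *\<^sub>R v - laplacian v))"
      by (simp add: w_def)
  qed
  then have surj1: "\<exists>u\<in>H2. schroedinger V u - cscale (- of_real l) u = f" for f :: "'a L2"
    by (simp add: schroedinger_def cscale_minus_left cscale_of_real algebra_simps)
  have surj: "\<exists>u\<in>H2. schroedinger V u - cscale z u = f" for f :: "'a L2"
  proof -
    have "\<exists>u\<in>H2. (schroedinger V u - cscale (- of_real l) u) + cscale (- (z + of_real l)) u = f"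
    proof (rule surjective_perturbation[OF _ _ surj1])
      show "(l + \<epsilon>) * norm (u - v) \<le> norm ((schroedinger V u - cscale (- of_real l) u) - (schroedinger V v - cscale (- of_real l) v))"
        if "u \<in> H2" "v \<in> H2" for u v
        using coer[OF that, of "- of_real l"] by (simp add: add.commute)
      show "norm (cscale (- (z + of_real l)) u - cscale (- (z + of_real l)) v) \<le> cmod (z + of_real l) * norm (u - v)"
        for u v :: "'a L2"
        by (simp only: cscale_diff_right[symmetric] norm_cscale norm_minus_cancel)
    qed (use zl l \<epsilon> in auto)
    then obtain u where u: "u \<in> H2" "(schroedinger V u - cscale (- of_real l) u) + cscale (- (z + of_real l)) u = f"
      by blast
    moreover have "(schroedinger V u - cscale (- of_real l) u) + cscale (- (z + of_real l)) u = schroedinger V u - cscale z u"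
      by (simp only: cscale_minus_left cscale_add_left) simp
    ultimately show ?thesis by metis
  qed
  have "bij_betw (\<lambda>u. schroedinger V u - cscale z u) H2 UNIV"
    unfolding bij_betw_def
  proof
    show "inj_on (\<lambda>u. schroedinger V u - cscale z u) H2"
    proof (rule inj_onI)
      fix u v assume uv: "u \<in> H2" "v \<in> H2" and eq: "schroedinger V u - cscale z u = schroedinger V v - cscale z v"
      have "(\<epsilon> - Re z) * norm (u - v) \<le> 0" using coer[OF uv, of z] by (simp add: eq)
      then have "norm (u - v) \<le> 0" using z by (simp add: mult_le_0_iff)
      then show "u = v" by simp
    qed
    show "(\<lambda>u. schroedinger V u - cscale z u) ` H2 = UNIV"
    proof (rule UNIV_eq_I[symmetric])
      show "f \<in> (\<lambda>u. schroedinger V u - cscale z u) ` H2" for f using surj[of f] by auto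
    qed
  qed
  moreover have "norm u \<le> 1 / (\<epsilon> - Re z) * norm (schroedinger V u - cscale z u)" if "u \<in> H2" for u
    using schroedinger_coercive[OF V pos that, of z] z by (simp add: field_simps)
  ultimately show ?thesis unfolding resolvent_set_def by (simp only: mem_Collect_eq fst_conv snd_conv) blast
qed

text \<open>The infimum \<open>m\<close> of the quadratic form on the unit sphere belongs to the spectrum: otherwise the
  form \<open>Q u = \<langle>(A - m) u, u\<rangle> \<ge> 0\<close> would be bounded below on the unit sphere by a positive constant,
  because \<open>u = (A - m) w\<close> for some \<open>w\<close> whose norm is controlled.\<close>

lemma energy_lower_bound_if_inf_spectrum_pos:
  fixes V :: "'a::euclidean_space \<Rightarrow> real"
  assumes V: "V \<in> Linfty" and nonneg: "AE x in lebesgue. 0 \<le> V x"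
    and inf: "inf_spectrum (H2, schroedinger V) > 0"
  shows "\<exists>\<epsilon>>0. \<forall>u\<in>H2. \<epsilon> * (norm u)\<^sup>2 \<le> energy V u"
proof -
  define X where "X = {energy V u |u. u \<in> H2 \<and> norm u = 1}"
  define m where "m = Inf X"
  have energy_scale: "energy V (r *\<^sub>R u) = r\<^sup>2 * energy V u" if "u \<in> H2" for r u
    using inner_schroedinger_self[OF V H2_scaleR[OF that, of r]] inner_schroedinger_self[OF V that]
    by (simp add: schroedinger_scaleR V that power2_eq_square)
  have lower: "a * (norm u)\<^sup>2 \<le> energy V u" if a: "\<And>x. x \<in> X \<Longrightarrow> a \<le> x" and u: "u \<in> H2" for a u
  proof (cases "u = 0")
    case True then show ?thesis using energy_nonneg[OF nonneg] by simp
  next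
    case False
    define w where "w = inverse (norm u) *\<^sub>R u"
    have w: "w \<in> H2" "norm w = 1" "u = norm u *\<^sub>R w" using False u by (auto simp: w_def H2_scaleR)
    have "a \<le> energy V w" using a[of "energy V w"] w(1,2) by (auto simp: X_def)
    then have "a * (norm u)\<^sup>2 \<le> energy V w * (norm u)\<^sup>2" by (rule mult_right_mono) simp
    also have "\<dots> = energy V u" using energy_scale[OF w(1), of "norm u"] w(3) by (simp add: mult.commute)
    finally show ?thesis .
  qed
  show ?thesis
  proof (cases "X = {}")
    \<comment> \<open>Then \<open>H2\<close> is trivial.\<close>
    case True
    then show ?thesis using lower[of 1] by (intro exI[of _ 1]) auto
  next
    case False
    have X0: "0 \<le> x" if "x \<in> X" for x using that energy_nonneg[OF nonneg] by (auto simp: X_def)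
    then have bdd: "bdd_below X" by (intro bdd_belowI[of _ 0])
    have m_le: "m \<le> x" if "x \<in> X" for x unfolding m_def using that bdd by (rule cInf_lower)
    define Q where "Q u = energy V u - m * (norm u)\<^sup>2" for u
    have Q0: "0 \<le> Q u" if "u \<in> H2" for u using lower[OF m_le that] by (simp add: Q_def)
    define T where "T u = schroedinger V u - cscale (of_real m) u" for u
    have T: "T u = schroedinger V u - m *\<^sub>R u" for u by (simp add: T_def cscale_of_real)
    have Q: "Q u = inner (T u) u" if "u \<in> H2" for u
      using inner_schroedinger_self[OF V that] by (simp add: Q_def T inner_diff_left power2_norm_eq_inner)
    have T_sym: "inner (T u) w = inner u (T w)" if "u \<in> H2" "w \<in> H2" for u w
      using inner_schroedinger_symmetric[OF V that] by (simp add: T inner_diff_left inner_diff_right)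
    have T_lin: "T (u - s *\<^sub>R w) = T u - s *\<^sub>R T w" if "u \<in> H2" "w \<in> H2" for u w s
      using that by (simp add: T schroedinger_diff schroedinger_scaleR V H2_scaleR algebra_simps)
    have "complex_of_real m \<in> spectrum (H2, schroedinger V)"
    proof (rule ccontr)
      assume "complex_of_real m \<notin> spectrum (H2, schroedinger V)"
      then have bij: "bij_betw T H2 UNIV" and "\<exists>C. \<forall>u\<in>H2. norm u \<le> C * norm (T u)"
        by (auto simp: spectrum_def resolvent_set_def T_def[abs_def])
      then obtain C0 where C0: "\<And>u. u \<in> H2 \<Longrightarrow> norm u \<le> C0 * norm (T u)" by blast
      define C where "C = \<bar>C0\<bar> + 1"
      have C: "C > 0" "\<And>u. u \<in> H2 \<Longrightarrow> norm u \<le> C * norm (T u)"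
      proof -
        show "C > 0" by (simp add: C_def)
        fix u :: "'a L2" assume "u \<in> H2"
        from C0[OF this] show "norm u \<le> C * norm (T u)"
          by (rule order_trans) (intro mult_right_mono, auto simp: C_def)
      qed
      have "m + 1 / C \<le> energy V u" if u: "u \<in> H2" "norm u = 1" for u
      proof -
        obtain w where w: "w \<in> H2" "T w = u"
          using bij unfolding bij_betw_def by (metis UNIV_I imageE)
        have "inner u w \<le> norm u * norm w" by (rule norm_cauchy_schwarz)
        also have "\<dots> \<le> C" using C(2)[OF w(1)] w(2) u(2) by simp
        finally have Qw: "inner u w \<le> C" .
        \<comment> \<open>This \<open>s\<close> maximises the lower bound \<open>2 s - s\<^sup>2 C\<close> for \<open>Q u\<close> that follows from \<open>0 \<le> Q (u - s w)\<close>.\<close>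
        define s where "s = 1 / C"
        have s: "s > 0" "s * C = 1" using C(1) by (auto simp: s_def)
        have mem: "u - s *\<^sub>R w \<in> H2" using u w by (intro H2_diff H2_scaleR)
        have uu: "inner u u = 1" using u(2) by (simp add: norm_eq_1)
        have Tuw: "inner (T u) w = 1" using T_sym[OF u(1) w(1)] w(2) uu by simp
        have "0 \<le> Q (u - s *\<^sub>R w)" by (rule Q0[OF mem])
        also have "\<dots> = inner (T u) u - s * inner (T u) w - s * inner u u + s * (s * inner u w)"
          unfolding Q[OF mem] T_lin[OF u(1) w(1)] w(2)
          by (simp add: inner_diff_left inner_diff_right algebra_simps)
        also have "\<dots> = Q u - 2 * s + s * (s * inner u w)" using Q[OF u(1)] Tuw uu by simp
        also have "s * (s * inner u w) \<le> s * (s * C)"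
          using s(1) Qw by (intro mult_left_mono) auto
        finally have "s \<le> Q u" using s(2) by simp
        then show ?thesis using u(2) by (simp add: Q_def s_def)
      qed
      then have "m + 1 / C \<le> m" using False
        unfolding m_def by (intro cInf_greatest) (auto simp: X_def m_def)
      then show False using C(1) by simp
    qed
    then have "inf_spectrum (H2, schroedinger V) \<le> ereal (Re (complex_of_real m))"
      unfolding inf_spectrum_def by (rule INF_lower)
    with inf have "0 < ereal (Re (complex_of_real m))" by (rule order_less_le_trans)
    then have "m > 0" by simp
    then show ?thesis using lower[OF m_le] by blast
  qed
qed

lemma strictly_positive_iff_inf_spectrum_pos:
  assumes V: "V \<in> Linfty" and nonneg: "AE x in lebesgue. 0 \<le> V x"
  shows "strictly_positive (op_add neg_laplacian (mult_op V)) \<longleftrightarrow>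
    inf_spectrum (op_add neg_laplacian (mult_op V)) > 0"
proof
  assume "strictly_positive (op_add neg_laplacian (mult_op V))"
  then obtain \<epsilon> where \<epsilon>: "\<epsilon> > 0" "\<And>u. u \<in> H2 \<Longrightarrow> \<epsilon> * (norm u)\<^sup>2 \<le> energy V u"
    unfolding strictly_positive_schroedinger_iff[OF V] by auto
  have "ereal \<epsilon> \<le> inf_spectrum (H2, schroedinger V)"
    unfolding inf_spectrum_def
  proof (rule INF_greatest)
    fix z assume "z \<in> spectrum (H2, schroedinger V)"
    then have "z \<notin> resolvent_set (H2, schroedinger V)" by (simp add: spectrum_def)
    then have "\<not> Re z < \<epsilon>" using schroedinger_resolvent[OF V \<epsilon>(2) \<epsilon>(1), of z] by blast
    then show "ereal \<epsilon> \<le> ereal (Re z)" by simp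
  qed
  then show "inf_spectrum (op_add neg_laplacian (mult_op V)) > 0"
    unfolding op_add_neg_laplacian_mult_op using \<epsilon>(1) by (metis ereal_less(2) order_less_le_trans)
next
  assume "inf_spectrum (op_add neg_laplacian (mult_op V)) > 0"
  then show "strictly_positive (op_add neg_laplacian (mult_op V))"
    unfolding strictly_positive_schroedinger_iff[OF V]
    by (intro energy_lower_bound_if_inf_spectrum_pos[OF V nonneg]) (simp add: op_add_neg_laplacian_mult_op)
qed


section \<open>Thick potentials and positivity\<close>

lemma const_vec_inner_Basis:
  "b \<in> Basis \<Longrightarrow> (\<chi> i. R) \<bullet> (b :: real ^ 'n) = R"
  by (auto simp: Basis_vec_def inner_axis)

lemma cube_eq_box: "cube R y = box y (y + (\<chi> i. R))"
  by (auto simp: cube_def mem_box_cart)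

lemma mem_cube_iff: "x \<in> cube R y \<longleftrightarrow> (\<forall>b\<in>Basis. y \<bullet> b < x \<bullet> b \<and> x \<bullet> b < y \<bullet> b + R)"
  unfolding cube_eq_box mem_box by (simp add: inner_add_left const_vec_inner_Basis)

lemma cube_lmeasurable: "cube R y \<in> lmeasurable" "cube R y \<in> sets borel"
  by (simp_all add: cube_eq_box)

lemma measure_cube:
  fixes y :: "real ^ 'n"
  assumes "0 \<le> R" shows "measure lebesgue (cube R y) = R ^ CARD('n)"
proof -
  have "measure lborel (box y (y + (\<chi> i. R))) = (\<Prod>b\<in>Basis. (y + (\<chi> i. R) - y) \<bullet> b)"
    using assms by (intro measure_lborel_box) (simp add: inner_add_left const_vec_inner_Basis)
  also have "\<dots> = (\<Prod>b\<in>(Basis :: (real ^ 'n) set). R)"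
    by (intro prod.cong refl) (simp add: const_vec_inner_Basis)
  finally show ?thesis by (simp add: cube_eq_box)
qed

lemma Linfty_set_integrable:
  assumes V: "V \<in> Linfty" and S: "S \<in> lmeasurable"
  shows "integrable lebesgue (\<lambda>x. indicator S x * V x)"
proof -
  have "sq_integrable (\<lambda>x. complex_of_real (indicator S x))"
  proof (rule norm_abs_L2_le(1)[where K = 1 and S = S])
    have "(\<lambda>x. complex_of_real (indicator S x)) = indicator S" by (auto simp: indicator_def)
    then show "(\<lambda>x. complex_of_real (indicator S x)) \<in> borel_measurable lebesgue"
      using S by (auto simp: fmeasurable_def)
  qed (use S in \<open>auto simp: indicator_def\<close>)
  from Linfty_integrable[OF V this] have "integrable lebesgue (\<lambda>x. V x * (indicator S x)\<^sup>2)" by simp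
  moreover have "V x * (indicator S x)\<^sup>2 = indicator S x * V x" for x by (simp add: indicator_def)
  ultimately show ?thesis by simp
qed

text \<open>The parallelogram inequality \<open>q w \<le> 2 q u + 2 q (w - u)\<close> for the form of a nonnegative potential.\<close>

lemma pot_energy_le:
  assumes V: "V \<in> Linfty" and nonneg: "AE x in lebesgue. 0 \<le> V x"
    and M: "AE x in lebesgue. \<bar>V x\<bar> \<le> M" "M \<ge> 0"
  shows "pot_energy V w \<le> 2 * pot_energy V u + 2 * M * (norm (w - u))\<^sup>2"
proof -
  have pe: "pot_energy V v = inner (mult_fun V v) v" for v
    by (simp add: inner_L2_def cinner_mult_fun_self[OF V])
  define k where "k = w - u"
  have sym: "inner (mult_fun V k) u = inner (mult_fun V u) k"
    using cinner_mult_fun[OF V, of k u] by (simp add: inner_L2_def inner_commute[of _ k, unfolded inner_L2_def])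
  have "pot_energy V (u - k) = pot_energy V u - 2 * inner (mult_fun V u) k + pot_energy V k"
    by (simp add: pe mult_fun_diff V inner_diff_left inner_diff_right sym)
  moreover have "0 \<le> pot_energy V (u - k)" by (rule pot_energy_nonneg[OF nonneg])
  moreover have "pot_energy V w = pot_energy V u + 2 * inner (mult_fun V u) k + pot_energy V k"
  proof -
    have "w = u + k" by (simp add: k_def)
    then show ?thesis by (simp add: pe mult_fun_add V inner_add_left inner_add_right sym)
  qed
  ultimately have "pot_energy V w \<le> 2 * pot_energy V u + 2 * pot_energy V k" by linarith
  moreover have "pot_energy V k \<le> M * (norm k)\<^sup>2"
  proof -
    have "pot_energy V k \<le> norm (mult_fun V k) * norm k" unfolding pe by (rule norm_cauchy_schwarz)
    also have "\<dots> \<le> (M * norm k) * norm k" by (intro mult_right_mono norm_mult_fun_le V M) simp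
    finally show ?thesis by (simp add: power2_eq_square mult.assoc)
  qed
  ultimately show ?thesis by (simp add: k_def)
qed

lemma pot_energy_translate:
  assumes V: "V \<in> Linfty"
  shows "integrable lebesgue (\<lambda>x. V (x + h) * (cmod (rep_L2 u x))\<^sup>2)"
    and "pot_energy V (translate (- h) u) = (LINT x|lebesgue. V (x + h) * (cmod (rep_L2 u x))\<^sup>2)"
proof -
  have sq: "sq_integrable (\<lambda>x. rep_L2 u (x + - h))" by (intro sq_integrable_shift sq_integrable_rep)
  note int = Linfty_integrable[OF V sq]
  have eq: "translate (- h) u = abs_L2 (\<lambda>x. rep_L2 u (x + - h))"
    using translate_abs_L2[OF sq_integrable_rep, of "- h" u] by simp
  show "integrable lebesgue (\<lambda>x. V (x + h) * (cmod (rep_L2 u x))\<^sup>2)"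
    using integrable_lebesgue_shift[OF int, of h] by simp
  show "pot_energy V (translate (- h) u) = (LINT x|lebesgue. V (x + h) * (cmod (rep_L2 u x))\<^sup>2)"
    unfolding eq pot_energy_abs_L2[OF V sq]
    using integral_lebesgue_shift[OF borel_measurable_integrable[OF int], of h] by simp
qed

lemma Borel_nonneg_representative:
  fixes f :: "'a::euclidean_space \<Rightarrow> real"
  assumes f: "f \<in> borel_measurable lebesgue" and nonneg: "AE x in lebesgue. 0 \<le> f x"
  obtains g where "g \<in> borel_measurable borel" "\<And>x. 0 \<le> g x" "AE x in lebesgue. f x = g x"
proof -
  obtain f0 where f0: "f0 \<in> borel_measurable lborel" "AE x in lborel. f x = f0 x"
    using completion_ex_borel_measurable_real[OF f] by blast
  have m: "(\<lambda>x. max 0 (f0 x)) \<in> borel_measurable borel" using f0(1) by simp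
  have "AE x in lebesgue. f x = f0 x" using f0(2) by (rule AE_completion)
  then have "AE x in lebesgue. f x = max 0 (f0 x)"
    using nonneg by eventually_elim simp
  then show ?thesis using that[OF m] by simp
qed

lemma sum_norm_partial_sq_le:
  fixes h :: "real ^ 'n"
  assumes R: "R \<ge> 0" and h: "\<And>b. b \<in> Basis \<Longrightarrow> \<bar>h \<bullet> b\<bar> \<le> R" and u: "u \<in> H2"
  shows "(norm (translate (- h) u - u))\<^sup>2 \<le> R\<^sup>2 * real CARD('n) * kinetic_energy u"
proof -
  have "norm (translate (- h) u - u) \<le> (\<Sum>b\<in>Basis. \<bar>(- h) \<bullet> b\<bar> * norm (weak_partial b u))"
    by (rule H2_translate_diff_norm_le[OF u])
  also have "\<dots> \<le> (\<Sum>b\<in>Basis. R * norm (weak_partial b u))"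
    by (intro sum_mono mult_right_mono) (use h in auto)
  finally have "(norm (translate (- h) u - u))\<^sup>2 \<le> (R * (\<Sum>b\<in>Basis. norm (weak_partial b u)))\<^sup>2"
    unfolding sum_distrib_left by (rule power_mono) simp
  also have "\<dots> = R\<^sup>2 * (\<Sum>b\<in>Basis. norm (weak_partial b u))\<^sup>2" by (simp add: power_mult_distrib)
  also have "\<dots> \<le> R\<^sup>2 * (kinetic_energy u * card (Basis :: (real ^ 'n) set))"
    by (intro mult_left_mono sum_squared_le_sum_of_squares) simp
  finally show ?thesis by (simp add: mult_ac)
qed

text \<open>Thickness says that the average of \<open>V (x + h)\<close> over \<open>h\<close> in the cube at the origin is at least \<open>\<rho>\<close> for
  every \<open>x\<close>. Hence \<open>\<rho> \<parallel>u\<parallel>\<^sup>2\<close> is at most the average over \<open>h\<close> of the potential energies of the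
  translates \<open>u (x - h)\<close>, by Tonelli. These exceed twice the potential energy of \<open>u\<close> by at
  most \<open>2 M \<parallel>u (x - h) - u x\<parallel>\<^sup>2\<close>, which the kinetic energy controls.\<close>

lemma thick_imp_energy_ge:
  fixes V :: "real ^ 'n \<Rightarrow> real" and u :: "(real ^ 'n) L2"
  assumes V: "V \<in> Linfty" and nonneg: "AE x in lebesgue. 0 \<le> V x"
    and M: "AE x in lebesgue. \<bar>V x\<bar> \<le> M" "M \<ge> 0"
    and R: "R > 0" and \<rho>: "\<rho> > 0" and thick: "thick R \<rho> V" and u: "u \<in> H2"
  shows "\<rho> * (norm u)\<^sup>2 \<le> (2 + 2 * M * R\<^sup>2 * real CARD('n)) * energy V u"
proof -
  obtain W where W: "W \<in> borel_measurable borel" "\<And>x. 0 \<le> W x" "AE x in lebesgue. V x = W x"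
    using Borel_nonneg_representative[of V] V nonneg by (auto simp: Linfty_def)
  obtain S where S: "S \<in> borel_measurable borel" "\<And>x. 0 \<le> S x" "AE x in lebesgue. (cmod (rep_L2 u x))\<^sup>2 = S x"
    using Borel_nonneg_representative[OF borel_measurable_integrable[OF sq_integrableD(2)[OF sq_integrable_rep[of u]]]]
    by auto
  note [measurable] = W(1) S(1) cube_lmeasurable(2)
  define C where "C = cube R (0 :: real ^ 'n)"
  have [measurable]: "C \<in> sets borel" by (simp add: C_def)
  define N where "N = CARD('n)"
  define K where "K = 2 * pot_energy V u + 2 * M * (R\<^sup>2 * real N * kinetic_energy u)"
  have K0: "0 \<le> K" using M(2) pot_energy_nonneg[OF nonneg, of u] by (simp add: K_def sum_nonneg)
  have inner1: "ennreal (R ^ N * \<rho>) \<le> (\<integral>\<^sup>+h. indicator C h * ennreal (W (x + h)) \<partial>lborel)" for x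
  proof -
    have "R ^ N * \<rho> \<le> R ^ N * cube_mean V R x"
      using thick R by (intro mult_left_mono) (auto simp: thick_def)
    also have "\<dots> = (LINT y|lebesgue. indicator (cube R x) y * V y)"
      using R by (simp add: cube_mean_def N_def set_lebesgue_integral_def)
    finally have "ennreal (R ^ N * \<rho>) \<le> ennreal (LINT y|lebesgue. indicator (cube R x) y * V y)"
      by (rule ennreal_leI)
    also have "\<dots> = (\<integral>\<^sup>+y. ennreal (indicator (cube R x) y * V y) \<partial>lebesgue)"
      by (intro nn_integral_eq_integral[symmetric] Linfty_set_integrable V cube_lmeasurable)
        (use nonneg in \<open>eventually_elim, simp\<close>)
    also have "\<dots> = (\<integral>\<^sup>+y. indicator (cube R x) y * ennreal (W y) \<partial>lebesgue)"
      by (intro nn_integral_cong_AE, use W(3) in eventually_elim) (simp add: indicator_def)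
    also have "\<dots> = (\<integral>\<^sup>+y. indicator (cube R x) y * ennreal (W y) \<partial>distr lborel borel ((+) x))"
      by (simp add: nn_integral_completion lborel_distr_plus)
    also have "\<dots> = (\<integral>\<^sup>+h. indicator (cube R x) (x + h) * ennreal (W (x + h)) \<partial>lborel)"
      by (intro nn_integral_distr) measurable
    also have "\<dots> = (\<integral>\<^sup>+h. indicator C h * ennreal (W (x + h)) \<partial>lborel)"
      by (intro nn_integral_cong) (auto simp: C_def cube_def indicator_def)
    finally show ?thesis .
  qed
  have inner2: "(\<integral>\<^sup>+x. ennreal (W (x + h)) * ennreal (S x) \<partial>lborel) \<le> ennreal K" if "h \<in> C" for h
  proof -
    have "(\<integral>\<^sup>+x. ennreal (W (x + h)) * ennreal (S x) \<partial>lborel)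
        = (\<integral>\<^sup>+x. ennreal (W (x + h)) * ennreal (S x) \<partial>lebesgue)" by (simp add: nn_integral_completion)
    also have "\<dots> = (\<integral>\<^sup>+x. ennreal (V (x + h) * (cmod (rep_L2 u x))\<^sup>2) \<partial>lebesgue)"
    proof (intro nn_integral_cong_AE, use AE_lebesgue_shift[OF W(3), of h] S(3) in eventually_elim)
      case (elim x)
      then show ?case using W(2)[of "x + h"] S(2)[of x] by (simp add: ennreal_mult)
    qed
    also have "\<dots> = ennreal (pot_energy V (translate (- h) u))"
      unfolding pot_energy_translate(2)[OF V]
      by (intro nn_integral_eq_integral pot_energy_translate(1) V)
        (use AE_lebesgue_shift[OF nonneg, of h] in \<open>eventually_elim, simp\<close>)
    also have "\<dots> \<le> ennreal K"
    proof (rule ennreal_leI)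
      have "\<bar>h \<bullet> b\<bar> \<le> R" if "b \<in> Basis" for b
        using \<open>h \<in> C\<close> that by (auto simp: C_def mem_cube_iff)
      then have "(norm (translate (- h) u - u))\<^sup>2 \<le> R\<^sup>2 * real N * kinetic_energy u"
        unfolding N_def using R u by (intro sum_norm_partial_sq_le) auto
      then have "2 * M * (norm (translate (- h) u - u))\<^sup>2 \<le> 2 * M * (R\<^sup>2 * real N * kinetic_energy u)"
        using M(2) by (intro mult_left_mono) auto
      then show "pot_energy V (translate (- h) u) \<le> K"
        using pot_energy_le[OF V nonneg M, of "translate (- h) u" u] by (simp add: K_def)
    qed
    finally show ?thesis .
  qed
  have nS: "(\<integral>\<^sup>+x. ennreal (S x) \<partial>lborel) = ennreal ((norm u)\<^sup>2)"
  proof -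
    have "(\<integral>\<^sup>+x. ennreal (S x) \<partial>lborel) = (\<integral>\<^sup>+x. ennreal (S x) \<partial>lebesgue)"
      by (simp add: nn_integral_completion)
    also have "\<dots> = (\<integral>\<^sup>+x. ennreal ((cmod (rep_L2 u x))\<^sup>2) \<partial>lebesgue)"
      by (intro nn_integral_cong_AE, use S(3) in eventually_elim) simp
    also have "\<dots> = ennreal (LINT x|lebesgue. (cmod (rep_L2 u x))\<^sup>2)"
      by (intro nn_integral_eq_integral sq_integrableD(2) sq_integrable_rep) simp
    finally show ?thesis using norm_abs_L2_sq[OF sq_integrable_rep[of u]] by simp
  qed
  have "ennreal (R ^ N * \<rho>) * ennreal ((norm u)\<^sup>2) = (\<integral>\<^sup>+x. ennreal (R ^ N * \<rho>) * ennreal (S x) \<partial>lborel)"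
    by (simp add: nn_integral_cmult nS)
  also have "\<dots> \<le> (\<integral>\<^sup>+x. (\<integral>\<^sup>+h. indicator C h * ennreal (W (x + h)) \<partial>lborel) * ennreal (S x) \<partial>lborel)"
    by (intro nn_integral_mono mult_right_mono inner1) simp
  also have "\<dots> = (\<integral>\<^sup>+x. (\<integral>\<^sup>+h. indicator C h * (ennreal (W (x + h)) * ennreal (S x)) \<partial>lborel) \<partial>lborel)"
    by (simp add: nn_integral_multc[symmetric] mult.assoc)
  also have "\<dots> = (\<integral>\<^sup>+h. (\<integral>\<^sup>+x. indicator C h * (ennreal (W (x + h)) * ennreal (S x)) \<partial>lborel) \<partial>lborel)"
    by (rule lborel_pair.Fubini') measurable
  also have "\<dots> = (\<integral>\<^sup>+h. indicator C h * (\<integral>\<^sup>+x. ennreal (W (x + h)) * ennreal (S x) \<partial>lborel) \<partial>lborel)"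
    by (simp add: nn_integral_cmult)
  also have "\<dots> \<le> (\<integral>\<^sup>+h. ennreal K * indicator C h \<partial>lborel)"
    by (intro nn_integral_mono) (use inner2 in \<open>auto simp: indicator_def\<close>)
  also have "\<dots> = ennreal K * emeasure lborel C" by (simp add: nn_integral_cmult)
  also have "emeasure lborel C = ennreal (R ^ N)"
  proof -
    have "emeasure lborel C = emeasure lebesgue C" by simp
    also have "\<dots> = ennreal (measure lebesgue C)"
      using cube_lmeasurable(1) by (intro emeasure_eq_measure2) (simp add: C_def)
    finally show ?thesis using measure_cube[of R 0] R by (simp add: C_def N_def)
  qed
  finally have "ennreal (R ^ N * \<rho> * (norm u)\<^sup>2) \<le> ennreal (K * R ^ N)"
    using R \<rho> K0 by (simp add: ennreal_mult[symmetric])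
  then have "R ^ N * \<rho> * (norm u)\<^sup>2 \<le> K * R ^ N"
    using R K0 by (subst (asm) ennreal_le_iff) auto
  then have "R ^ N * (\<rho> * (norm u)\<^sup>2) \<le> R ^ N * K" by (simp add: mult_ac)
  then have "\<rho> * (norm u)\<^sup>2 \<le> K" using R by simp
  also have "K \<le> (2 + 2 * M * R\<^sup>2 * real N) * energy V u"
  proof -
    define E where "E = kinetic_energy u"
    have E: "0 \<le> E" by (simp add: E_def sum_nonneg)
    have q: "0 \<le> pot_energy V u" by (rule pot_energy_nonneg[OF nonneg])
    define a where "a = 2 * M * R\<^sup>2 * real N"
    have a: "0 \<le> a" using M(2) by (simp add: a_def)
    have "K = 2 * pot_energy V u + a * E" by (simp add: K_def a_def E_def)
    moreover have "(2 + a) * energy V u = 2 * pot_energy V u + a * E + (2 * E + a * pot_energy V u)"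
      by (simp add: energy_def E_def algebra_simps)
    moreover have "0 \<le> 2 * E + a * pot_energy V u" using E q a by simp
    ultimately show ?thesis unfolding a_def by linarith
  qed
  finally show ?thesis unfolding N_def .
qed

lemma thick_imp_strictly_positive:
  fixes V :: "real ^ 'n \<Rightarrow> real"
  assumes V: "V \<in> Linfty" and nonneg: "AE x in lebesgue. 0 \<le> V x"
    and R: "R > 0" and \<rho>: "\<rho> > 0" and thick: "thick R \<rho> V"
  shows "strictly_positive (op_add neg_laplacian (mult_op V))"
proof -
  obtain M0 where "AE x in lebesgue. \<bar>V x\<bar> \<le> M0" using V by (auto simp: Linfty_def)
  define M where "M = \<bar>M0\<bar>"
  have M: "AE x in lebesgue. \<bar>V x\<bar> \<le> M" "0 \<le> M"
    using \<open>AE x in lebesgue. \<bar>V x\<bar> \<le> M0\<close> by (auto simp: M_def elim: eventually_mono)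
  define K where "K = 2 + 2 * M * R\<^sup>2 * real CARD('n)"
  have K: "K > 0" using M(2) by (simp add: K_def add_pos_nonneg)
  have "\<rho> / K * (norm u)\<^sup>2 \<le> energy V u" if "u \<in> H2" for u
  proof -
    have "\<rho> * (norm u)\<^sup>2 \<le> energy V u * K"
      using thick_imp_energy_ge[OF V nonneg M R \<rho> thick that] unfolding K_def by (simp only: mult.commute)
    then show ?thesis using K by (simp add: pos_divide_le_eq)
  qed
  moreover have "\<rho> / K > 0" using \<rho> K by simp
  ultimately show ?thesis unfolding strictly_positive_schroedinger_iff[OF V] by blast
qed


section \<open>Positivity implies large cube means\<close>

text \<open>Also at the end points of the interval, where the function attains its minimum.\<close>

lemma deriv_ibump_zero:
  assumes k: "k > 0" and t: "t \<notin> {a<..<b}" shows "deriv (ibump a b k) t = 0"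
proof (rule DERIV_local_min)
  show "(ibump a b k has_real_derivative deriv (ibump a b k) t) (at t)"
    using bump1_ibump[OF k] by (intro smooth1_has_deriv) (simp add: bump1_def)
  show "0 < (1::real)" by simp
  show "\<forall>s. \<bar>t - s\<bar> < 1 \<longrightarrow> ibump a b k t \<le> ibump a b k s"
    using ibump_zero[OF k t] ibump_bounds(1) by simp
qed

lemma ibump_lower: "1/4 < t \<Longrightarrow> t < 3/4 \<Longrightarrow> exp (- 8) \<le> ibump 0 1 1 t"
proof -
  have *: "exp (- 4) \<le> flat 1 s" if "1/4 < s" for s :: real
    using that by (simp add: flat_def field_simps)
  assume "1/4 < t" "t < 3/4"
  then have "exp (- 4) * exp (- 4) \<le> flat 1 t * flat 1 (1 - t)"
    by (intro mult_mono *) (auto simp: flat1_bounds)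
  then show ?thesis by (simp add: ibump_def exp_add[symmetric])
qed

text \<open>The one-dimensional factors of the bump function adapted to \<open>cube R y\<close>.\<close>

definition cube_bump :: "real \<Rightarrow> 'a::euclidean_space \<Rightarrow> 'a \<Rightarrow> real \<Rightarrow> real"
  where "cube_bump R y b t = ibump 0 1 1 ((t - y \<bullet> b) / R)"

lemma cube_bump_affine: "cube_bump R y b = (\<lambda>t. ibump 0 1 1 ((1 / R) * t + - (y \<bullet> b / R)))"
  by (auto simp: cube_bump_def diff_divide_distrib)

lemma bumps_cube_bump: "R > 0 \<Longrightarrow> bumps (cube_bump R y)"
  unfolding bumps_def cube_bump_affine by (intro ballI bump1_scale bump1_ibump) auto

lemma deriv_cube_bump:
  assumes R: "R > 0"
  shows "deriv (cube_bump R y b) t = deriv (ibump 0 1 1) ((t - y \<bullet> b) / R) / R"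
proof -
  have "((\<lambda>t. (t - y \<bullet> b) / R) has_real_derivative 1 / R) (at t)"
    using R by (auto intro!: derivative_eq_intros)
  then have "(cube_bump R y b has_real_derivative deriv (ibump 0 1 1) ((t - y \<bullet> b) / R) * (1 / R)) (at t)"
    unfolding cube_bump_def[abs_def]
    using bump1_ibump[of 1 0 1] by (intro DERIV_chain2[OF smooth1_has_deriv]) (auto simp: bump1_def)
  then show ?thesis using DERIV_imp_deriv by fastforce
qed

lemma scaled_mem_iff: "R > 0 \<Longrightarrow> (t - s) / R \<in> {0<..<1} \<longleftrightarrow> s < t \<and> t < s + R" for R s t :: real
  by (auto simp: field_simps)

lemma bprod_cube_bump:
  fixes y :: "real ^ 'n"
  assumes R: "R > 0"
  shows "cmod (bprod (cube_bump R y) x) \<le> indicator (cube R y) x"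
    and "x \<in> cube (R / 2) (y + (\<chi> i. R / 4)) \<Longrightarrow> exp (- 8) ^ CARD('n) \<le> cmod (bprod (cube_bump R y) x)"
proof -
  have b01: "0 \<le> cube_bump R y b t" "cube_bump R y b t \<le> 1" for b t
    using ibump_bounds by (auto simp: cube_bump_def)
  have n: "cmod (bprod (cube_bump R y) x) = (\<Prod>b\<in>Basis. cube_bump R y b (x \<bullet> b))"
    using b01 by (simp only: bprod_def norm_of_real) (simp add: prod_nonneg)
  show "cmod (bprod (cube_bump R y) x) \<le> indicator (cube R y) x"
  proof (cases "x \<in> cube R y")
    case True
    have "(\<Prod>b\<in>Basis. cube_bump R y b (x \<bullet> b)) \<le> 1" using b01 by (intro prod_le_1) auto
    then show ?thesis unfolding n using True by simp
  next
    case False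
    then obtain b where b: "b \<in> Basis" "\<not> (y \<bullet> b < x \<bullet> b \<and> x \<bullet> b < y \<bullet> b + R)"
      by (auto simp: mem_cube_iff)
    then have "cube_bump R y b (x \<bullet> b) = 0"
      unfolding cube_bump_def by (intro ibump_zero) (use scaled_mem_iff[OF R] in auto)
    then have "(\<Prod>b\<in>Basis. cube_bump R y b (x \<bullet> b)) = 0" using b(1) by auto
    then show ?thesis unfolding n by (simp only:) simp
  qed
  assume x: "x \<in> cube (R / 2) (y + (\<chi> i. R / 4))"
  have "(\<Prod>b\<in>(Basis :: (real ^ 'n) set). exp (- 8)) \<le> (\<Prod>b\<in>Basis. cube_bump R y b (x \<bullet> b))"
  proof (intro prod_mono conjI)
    fix b :: "real ^ 'n" assume "b \<in> Basis"
    then have "y \<bullet> b + R / 4 < x \<bullet> b" "x \<bullet> b < y \<bullet> b + R / 4 + R / 2"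
      using x by (auto simp: mem_cube_iff inner_add_left const_vec_inner_Basis)
    then show "exp (- 8) \<le> cube_bump R y b (x \<bullet> b)"
      unfolding cube_bump_def using R by (intro ibump_lower) (auto simp: field_simps)
  qed simp
  then show "exp (- 8) ^ CARD('n) \<le> cmod (bprod (cube_bump R y) x)" unfolding n by simp
qed

lemma bprod_dfac_cube_bump:
  fixes y :: "real ^ 'n"
  assumes R: "R > 0" and b: "b \<in> Basis" and K: "\<And>t. \<bar>deriv (ibump 0 1 1) t\<bar> \<le> K"
  shows "cmod (bprod (dfac b (cube_bump R y)) x) \<le> K / R"
    and "x \<notin> cube R y \<Longrightarrow> bprod (dfac b (cube_bump R y)) x = 0"
proof -
  have b01: "0 \<le> cube_bump R y b t" "cube_bump R y b t \<le> 1" for b t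
    using ibump_bounds by (auto simp: cube_bump_def)
  have K0: "0 \<le> K" using K[of 0] by linarith
  have "(\<Prod>c\<in>Basis. dfac b (cube_bump R y) c (x \<bullet> c))
      = dfac b (cube_bump R y) b (x \<bullet> b) * (\<Prod>c\<in>Basis - {b}. dfac b (cube_bump R y) c (x \<bullet> c))"
    using b by (simp add: prod.remove)
  also have "(\<Prod>c\<in>Basis - {b}. dfac b (cube_bump R y) c (x \<bullet> c)) = (\<Prod>c\<in>Basis - {b}. cube_bump R y c (x \<bullet> c))"
    by (intro prod.cong) (auto simp: dfac_def)
  finally have eq: "cmod (bprod (dfac b (cube_bump R y)) x)
      = \<bar>deriv (cube_bump R y b) (x \<bullet> b)\<bar> * (\<Prod>c\<in>Basis - {b}. cube_bump R y c (x \<bullet> c))"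
    using b01 by (simp only: bprod_def norm_of_real) (simp add: abs_mult prod_nonneg dfac_def)
  have "(\<Prod>c\<in>Basis - {b}. cube_bump R y c (x \<bullet> c)) \<le> 1" using b01 by (intro prod_le_1) auto
  moreover have "0 \<le> (\<Prod>c\<in>Basis - {b}. cube_bump R y c (x \<bullet> c))" using b01 by (intro prod_nonneg) auto
  moreover have "\<bar>deriv (cube_bump R y b) (x \<bullet> b)\<bar> \<le> K / R"
    using K R by (simp add: deriv_cube_bump divide_right_mono)
  ultimately have "\<bar>deriv (cube_bump R y b) (x \<bullet> b)\<bar> * (\<Prod>c\<in>Basis - {b}. cube_bump R y c (x \<bullet> c)) \<le> (K / R) * 1"
    using K0 R by (intro mult_mono) auto
  then show "cmod (bprod (dfac b (cube_bump R y)) x) \<le> K / R" unfolding eq by simp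
  assume "x \<notin> cube R y"
  then obtain c where c: "c \<in> Basis" "\<not> (y \<bullet> c < x \<bullet> c \<and> x \<bullet> c < y \<bullet> c + R)"
    by (auto simp: mem_cube_iff)
  then have out: "(x \<bullet> c - y \<bullet> c) / R \<notin> {0<..<1}" using scaled_mem_iff[OF R] by blast
  have "dfac b (cube_bump R y) c (x \<bullet> c) = 0"
  proof (cases "c = b")
    case True
    then show ?thesis using deriv_ibump_zero[OF _ out] R by (simp add: dfac_def deriv_cube_bump)
  next
    case False
    then show ?thesis using ibump_zero[OF _ out] by (simp add: dfac_def cube_bump_def)
  qed
  then show "bprod (dfac b (cube_bump R y)) x = 0" using c(1) by (auto simp: bprod_def)
qed

text \<open>The bump functions adapted to the cubes of side length \<open>R\<close> are used as trial functions. Divided by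
  \<open>R^N\<close>, their squared norms are bounded below, their kinetic energies are of order \<open>R^-2\<close>, and their
  potential energies are at most the means of \<open>V\<close> over the cubes.\<close>

lemma strictly_positive_imp_cube_mean_ge:
  fixes V :: "real ^ 'n \<Rightarrow> real"
  assumes V: "V \<in> Linfty" and nonneg: "AE x in lebesgue. 0 \<le> V x"
    and pos: "strictly_positive (op_add neg_laplacian (mult_op V))"
  obtains \<kappa> R0 where "\<kappa> > 0" "\<And>R y. R \<ge> R0 \<Longrightarrow> \<kappa> \<le> cube_mean V R y"
proof -
  obtain \<epsilon> where \<epsilon>: "\<epsilon> > 0" "\<And>u. u \<in> H2 \<Longrightarrow> \<epsilon> * (norm u)\<^sup>2 \<le> energy V u"
    using pos unfolding strictly_positive_schroedinger_iff[OF V] by auto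
  obtain K where K: "\<And>t. \<bar>deriv (ibump 0 1 1) t\<bar> \<le> K"
    using bump1_bounded[OF bump1_deriv[OF bump1_ibump[of 1 0 1]]] by auto
  have K0: "0 \<le> K" using K[of 0] by linarith
  define N where "N = CARD('n)"
  \<comment> \<open>A lower bound of the squared bump function on the concentric cube with side length \<open>R / 2\<close>.\<close>
  define c :: real where "c = (exp (- 8) ^ N)\<^sup>2"
  have c: "c > 0" by (simp add: c_def)
  define \<kappa> where "\<kappa> = \<epsilon> * c / 2 ^ N / 2"
  have \<kappa>: "\<kappa> > 0" using \<epsilon>(1) c by (simp add: \<kappa>_def)
  \<comment> \<open>For \<open>R \<ge> R0\<close> the kinetic energy is at most \<open>\<kappa> R^N\<close>, half of the available lower bound.\<close>
  define R0 where "R0 = sqrt (real N * K\<^sup>2 / \<kappa>) + 1"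
  have "\<kappa> \<le> cube_mean V R y" if "R \<ge> R0" for R y
  proof -
    have sq0: "0 \<le> sqrt (real N * K\<^sup>2 / \<kappa>)" using \<kappa> by simp
    have R: "R > 0" using that sq0 unfolding R0_def by linarith
    have "(sqrt (real N * K\<^sup>2 / \<kappa>))\<^sup>2 \<le> R\<^sup>2" using that sq0 by (intro power_mono) (auto simp: R0_def)
    then have "real N * K\<^sup>2 / \<kappa> \<le> R\<^sup>2" using \<kappa> by simp
    then have small: "real N * (K / R)\<^sup>2 \<le> \<kappa>" using \<kappa> R by (simp add: field_simps)
    define g where "g = cube_bump R y"
    have g: "bumps g" unfolding g_def by (rule bumps_cube_bump[OF R])
    note sqg = bprod_sq_integrable[OF g]
    have in_H2: "bump_L2 g \<in> H2" using core_bump_L2[OF g, of 1] core_subset_H2 by auto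
    have kinetic: "(norm (weak_partial b (bump_L2 g)))\<^sup>2 \<le> (K / R)\<^sup>2 * R ^ N" if b: "b \<in> Basis" for b
    proof -
      have "norm (abs_L2 (bprod (dfac b g))) \<le> K / R * sqrt (measure lebesgue (cube R y))"
      proof (rule norm_abs_L2_le(2))
        show "bprod (dfac b g) \<in> borel_measurable lebesgue" using bprod_sq_integrable[OF bumps_dfac[OF b g]] by blast
        show "cmod (bprod (dfac b g) x) \<le> K / R" for x
          unfolding g_def by (rule bprod_dfac_cube_bump(1)[OF R b K])
        show "bprod (dfac b g) x = 0" if "x \<notin> cube R y" for x
          unfolding g_def by (rule bprod_dfac_cube_bump(2)[OF R b K that])
        show "0 \<le> K / R" using K0 R by simp
      qed (rule cube_lmeasurable)
      then have "norm (weak_partial b (bump_L2 g)) \<le> K / R * sqrt (R ^ N)"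
        using R by (simp add: weak_partial_bump_L2[OF b g] measure_cube N_def) (simp add: bump_L2_def)
      then have "(norm (weak_partial b (bump_L2 g)))\<^sup>2 \<le> (K / R * sqrt (R ^ N))\<^sup>2" by (rule power_mono) simp
      also have "(K / R * sqrt (R ^ N))\<^sup>2 = (K / R)\<^sup>2 * R ^ N"
        unfolding power_mult_distrib using R by simp
      finally show ?thesis .
    qed
    have "kinetic_energy (bump_L2 g) \<le> (\<Sum>b\<in>(Basis :: (real ^ 'n) set). (K / R)\<^sup>2 * R ^ N)"
      by (rule sum_mono) (rule kinetic)
    also have "\<dots> = real N * (K / R)\<^sup>2 * R ^ N" by (simp add: N_def)
    also have "\<dots> \<le> \<kappa> * R ^ N" using small R by (intro mult_right_mono) auto
    finally have kin: "kinetic_energy (bump_L2 g) \<le> \<kappa> * R ^ N" .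
    have "pot_energy V (bump_L2 g) = (LINT x|lebesgue. V x * (cmod (bprod g x))\<^sup>2)"
      unfolding bump_L2_def by (rule pot_energy_abs_L2[OF V sqg])
    also have "\<dots> \<le> (LINT x|lebesgue. indicator (cube R y) x * V x)"
    proof (rule integral_mono_AE[OF Linfty_integrable[OF V sqg] Linfty_set_integrable[OF V cube_lmeasurable(1)]])
      show "AE x in lebesgue. V x * (cmod (bprod g x))\<^sup>2 \<le> indicator (cube R y) x * V x"
        using nonneg
      proof eventually_elim
        case (elim x)
        have "(cmod (bprod g x))\<^sup>2 \<le> (indicator (cube R y) x)\<^sup>2"
          unfolding g_def by (intro power_mono bprod_cube_bump(1) R) simp
        also have "(indicator (cube R y) x)\<^sup>2 = (indicator (cube R y) x :: real)"
          by (cases "x \<in> cube R y") auto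
        finally have "(cmod (bprod g x))\<^sup>2 \<le> indicator (cube R y) x" .
        from mult_right_mono[OF this elim] show ?case by (simp add: mult.commute)
      qed
    qed
    finally have pot: "pot_energy V (bump_L2 g) \<le> R ^ N * cube_mean V R y"
      using R by (simp add: cube_mean_def set_lebesgue_integral_def N_def)
    define I where "I = cube (R / 2) (y + (\<chi> i. R / 4))"
    have "c * (R / 2) ^ N = (LINT x|lebesgue. c * indicator I x)"
      using measure_cube[of "R / 2" "y + (\<chi> i. R / 4)"] R by (simp add: I_def N_def)
    also have "\<dots> \<le> (LINT x|lebesgue. (cmod (bprod g x))\<^sup>2)"
    proof (rule integral_mono)
      show "integrable lebesgue (\<lambda>x. c * indicator I x)"
        using cube_lmeasurable(1)[of "R / 2" "y + (\<chi> i. R / 4)"]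
        by (intro integrable_mult_right integrable_real_indicator) (auto simp: I_def fmeasurable_def)
      show "integrable lebesgue (\<lambda>x. (cmod (bprod g x))\<^sup>2)" using sqg by blast
      show "c * indicator I x \<le> (cmod (bprod g x))\<^sup>2" for x
      proof (cases "x \<in> I")
        case True
        then have "exp (- 8) ^ N \<le> cmod (bprod g x)"
          using bprod_cube_bump(2)[OF R] by (simp add: I_def g_def N_def)
        then have "c \<le> (cmod (bprod g x))\<^sup>2" unfolding c_def by (rule power_mono) simp
        then show ?thesis using True by simp
      qed simp
    qed
    finally have low: "c * (R / 2) ^ N \<le> (norm (bump_L2 g))\<^sup>2" using norm_abs_L2_sq[OF sqg] by (simp add: bump_L2_def)
    have "2 * \<kappa> * R ^ N = \<epsilon> * (c * (R / 2) ^ N)" by (simp add: \<kappa>_def power_divide)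
    also have "\<dots> \<le> \<epsilon> * (norm (bump_L2 g))\<^sup>2" using low \<epsilon>(1) by (intro mult_left_mono) auto
    also have "\<dots> \<le> energy V (bump_L2 g)" by (rule \<epsilon>(2)[OF in_H2])
    also have "\<dots> \<le> \<kappa> * R ^ N + R ^ N * cube_mean V R y" unfolding energy_def by (intro add_mono kin pot)
    finally have "R ^ N * \<kappa> \<le> R ^ N * cube_mean V R y" by (simp add: algebra_simps)
    then show ?thesis using R by simp
  qed
  then show ?thesis using that \<kappa> by blast
qed


section \<open>The equivalences\<close>

lemma strictly_positive_imp_Liminf_pos:
  fixes V :: "real ^ 'n \<Rightarrow> real"
  assumes V: "V \<in> Linfty" and nonneg: "AE x in lebesgue. 0 \<le> V x"
    and pos: "strictly_positive (op_add neg_laplacian (mult_op V))"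
  shows "Liminf at_top (\<lambda>R::real. INF y. ereal (cube_mean V R y)) > 0"
proof -
  obtain \<kappa> R0 where \<kappa>: "\<kappa> > 0" "\<And>R y. R \<ge> R0 \<Longrightarrow> \<kappa> \<le> cube_mean V R y"
    using strictly_positive_imp_cube_mean_ge[OF V nonneg pos] by metis
  have "ereal \<kappa> \<le> Liminf at_top (\<lambda>R::real. INF y. ereal (cube_mean V R y))"
  proof (rule Liminf_bounded)
    show "\<forall>\<^sub>F R in at_top. ereal \<kappa> \<le> (INF y. ereal (cube_mean V R y))"
      using eventually_ge_at_top[of R0] by eventually_elim (intro INF_greatest, simp add: \<kappa>(2))
  qed
  then show ?thesis using \<kappa>(1) by (metis ereal_less(2) order_less_le_trans)
qed

lemma Liminf_pos_imp_thick:
  fixes V :: "real ^ 'n \<Rightarrow> real"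
  assumes "Liminf at_top (\<lambda>R::real. INF y. ereal (cube_mean V R y)) > 0"
  obtains R \<rho> where "R > 0" "\<rho> > 0" "thick R \<rho> V"
proof -
  obtain \<rho> where \<rho>: "0 < ereal \<rho>" "ereal \<rho> < Liminf at_top (\<lambda>R::real. INF y. ereal (cube_mean V R y))"
    using ereal_dense2[OF assms] by blast
  have "\<forall>\<^sub>F R in at_top. ereal \<rho> < (INF y. ereal (cube_mean V R y))"
    using less_LiminfD[OF \<rho>(2)] .
  then have "\<forall>\<^sub>F R in at_top. ereal \<rho> < (INF y. ereal (cube_mean V R y)) \<and> R > 0"
    using eventually_gt_at_top[of 0] by (rule eventually_conj)
  then obtain R :: real where R: "ereal \<rho> < (INF y. ereal (cube_mean V R y))" "R > 0"
    using eventually_happens'[OF trivial_limit_at_top_linorder] by blast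
  have "\<rho> \<le> cube_mean V R y" for y
  proof -
    have "ereal \<rho> \<le> ereal (cube_mean V R y)"
      using R(1) INF_lower[of y UNIV "\<lambda>y. ereal (cube_mean V R y)"] by (meson UNIV_I less_imp_le order_trans)
    then show ?thesis by simp
  qed
  then show ?thesis using that[OF R(2)] \<rho>(1) by (simp add: thick_def)
qed

theorem theorem2p2:
  fixes V :: "real ^ 'n \<Rightarrow> real"
  assumes "V \<in> Linfty"
    and "AE x in lebesgue. 0 \<le> V x"
  defines "A \<equiv> op_add neg_laplacian (mult_op V)"
  shows "(strictly_positive A \<longleftrightarrow> inf_spectrum A > 0) \<and>
    (strictly_positive A \<longleftrightarrow> (\<exists>R \<rho>. R > 0 \<and> \<rho> > 0 \<and> thick R \<rho> V)) \<and>
    (strictly_positive A \<longleftrightarrow>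
      Liminf at_top (\<lambda>R::real. INF y. ereal (cube_mean V R y)) > 0)"
proof -
  note V = assms(1,2)
  have "\<exists>R \<rho>. R > 0 \<and> \<rho> > 0 \<and> thick R \<rho> V"
    if "Liminf at_top (\<lambda>R::real. INF y. ereal (cube_mean V R y)) > 0"
    using Liminf_pos_imp_thick[OF that] by metis
  then show ?thesis
    unfolding A_def
    using strictly_positive_iff_inf_spectrum_pos[OF V] thick_imp_strictly_positive[OF V]
      strictly_positive_imp_Liminf_pos[OF V] by blast
qed

end
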